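(* Let $\alpha>-1$ with $\alpha\neq0$, and let $u$ be an $\alpha$-harmonic function in $\mathbb{H}$ which is of temperate growth at infinity. Assume that (1)' $\lim_{y\to0+}u(\cdot+iy)=0$ in $\mathcal{D}'(\mathbb{R})$; and (2) there is a sequence $\{z_j\}$ in $\mathbb{H}$ with $z_j\to\infty$ in $\mathbb{C}_\infty$ as $j\to\infty$ such that $$\lim_{j\to\infty}\frac{u(z_j)}{(\operatorname{Im} z_j)^{\alpha+1}}=0.$$ Then $u(z)=0$ for all $z\in\mathbb{H}$.
   Context: $\mathbb{H}=\{z\in\mathbb{C}:\operatorname{Im} z>0\}$ is the open upper half-plane and $\mathbb{C}_\infty=\mathbb{C}\cup\{\infty\}$ is the extended complex plane. Functions are complex-valued. $\partial_z$ and $\bar\partial_z$ are the usual complex partial derivatives, $\partial_z=\frac12(\partial_x-i\partial_y)$, $\bar\partial_z=\frac12(\partial_x+i\partial_y)$ for $z=x+iy$. For $\alpha>-1$, a function $u\in C^2(\mathbb{H})$ is called $\alpha$-harmonic in $\mathbb{H}$ if $\partial_z\big((\operatorname{Im} z)^{-\alpha}\,\bar\partial_z u(z)\big)=0$ for all $z\in\mathbb{H}$. A function $u$ in $\mathbb{H}$ is of temperate growth at infinity if there are positive constants $C,R,N$ such that $|u(z)|\leq C\,(|z|^2/\operatorname{Im} z)^N$ for all $z\in\mathbb{H}$ with $|z|>R$. $\lim_{y\to0+}u(\cdot+iy)=0$ in $\mathcal{D}'(\mathbb{R})$ means that $\lim_{y\to0+}\int_{-\infty}^\infty u(x+iy)\psi(x)\,dx=0$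 for every $\psi\in C_0^\infty(\mathbb{R})$ (smooth compactly supported test functions). *)

theory Defs
  imports "HOL-Analysis.Analysis"
begin

definition upper_half_plane :: "complex set" where
  "upper_half_plane = {z. Im z > 0}"

definition partial_x :: "(complex \<Rightarrow> complex) \<Rightarrow> complex \<Rightarrow> complex" where
  "partial_x f z = vector_derivative (\<lambda>t. f (z + of_real t)) (at 0)"

definition partial_y :: "(complex \<Rightarrow> complex) \<Rightarrow> complex \<Rightarrow> complex" where
  "partial_y f z = vector_derivative (\<lambda>t. f (z + \<i> * of_real t)) (at 0)"

definition d_z :: "(complex \<Rightarrow> complex) \<Rightarrow> complex \<Rightarrow> complex" where
  "d_z f z = (partial_x f z - \<i> * partial_y f z) / 2"

definition dbar_z :: "(complex \<Rightarrow> complex) \<Rightarrow> complex \<Rightarrow> complex" where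
  "dbar_z f z = (partial_x f z + \<i> * partial_y f z) / 2"

(* Real k-fold continuous differentiability; meant for open S.  "differentiable"
   is the real (Frechet) notion, with the complex plane as a real vector space. *)
fun Ck_on :: "nat \<Rightarrow> (complex \<Rightarrow> complex) \<Rightarrow> complex set \<Rightarrow> bool" where
  "Ck_on 0 f S \<longleftrightarrow> continuous_on S f"
| "Ck_on (Suc k) f S \<longleftrightarrow>
     (\<forall>z\<in>S. f differentiable (at z)) \<and> Ck_on k (partial_x f) S \<and> Ck_on k (partial_y f) S"

definition alpha_harmonic :: "real \<Rightarrow> (complex \<Rightarrow> complex) \<Rightarrow> bool" where
  "alpha_harmonic \<alpha> u \<longleftrightarrow>
     Ck_on 2 u upper_half_plane \<and>
     (\<forall>z\<in>upper_half_plane. d_z (\<lambda>w. of_real (Im w powr (- \<alpha>)) * dbar_z u w) z = 0)"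

definition temperate_growth_at_infinity :: "(complex \<Rightarrow> complex) \<Rightarrow> bool" where
  "temperate_growth_at_infinity u \<longleftrightarrow>
     (\<exists>C R N :: real. C > 0 \<and> R > 0 \<and> N > 0 \<and>
        (\<forall>z\<in>upper_half_plane. cmod z > R \<longrightarrow> cmod (u z) \<le> C * ((cmod z)\<^sup>2 / Im z) powr N))"

definition test_function :: "(real \<Rightarrow> complex) \<Rightarrow> bool" where
  "test_function \<psi> \<longleftrightarrow>
     (\<forall>n x. ((\<lambda>f t. vector_derivative f (at t)) ^^ n) \<psi> differentiable (at x)) \<and>
     compact (closure {x. \<psi> x \<noteq> 0})"

definition vanishes_in_distributions_at_boundary :: "(complex \<Rightarrow> complex) \<Rightarrow> bool" where
  "vanishes_in_distributions_at_boundary u \<longleftrightarrow>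
     (\<forall>\<psi>. test_function \<psi> \<longrightarrow>
        ((\<lambda>y. LINT x|lborel. u (Complex x y) * \<psi> x) \<longlongrightarrow> 0) (at_right 0))"

end

theory Submission
  imports Defs "HOL-Complex_Analysis.Complex_Analysis"
begin

text \<open>Convolving \<open>u\<close> in \<open>x\<close> with a bump function gives a solution which, by uniform boundedness near a
  bounded part of the real line and by integrating the equation in \<open>y\<close> far out, is bounded by a power of
  \<open>1 + |z|\<close> and tends to \<open>0\<close> at every real point. A Cayley transform with the factor \<open>(1 - w)\<^sup>\<alpha>\<close>
  turns it into a solution on the unit disc whose boundary values vanish except at \<open>1\<close>, where it has
  at most a pole of some order \<open>M\<close>; hence its Fourier coefficients on the circle have vanishing \<open>M\<close>-th
  differences. This condition involves only the values on one fixed circle, so it passes to \<open>u\<close> itself. The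
  solutions satisfying it form an \<open>M\<close>-dimensional space, spanned by \<open>y\<^bsup>\<alpha>+1\<^esup> P\<^sub>j(z)\<close>, \<open>j < M\<close>,
  with explicit homogeneous polynomials \<open>P\<^sub>j\<close> of degree \<open>j\<close> in \<open>z\<close> and its conjugate. For
  \<open>\<alpha> \<noteq> 0\<close> the coefficients of \<open>P\<^sub>j\<close> are strictly monotone, so \<open>P\<^sub>j\<close> has no zero besides the
  origin, and a nontrivial combination cannot tend to \<open>0\<close> along any sequence going to infinity.\<close>

section \<open>Wirtinger derivatives and the first order system\<close>

text \<open>The boundary hypothesis is only distributional, so \<open>u\<close> itself need have
  neither boundary values nor a polynomial bound near the real line. Each mollification has both,
  but with constants that blow up as the bump shrinks. What survives the limit must therefore be
  free of constants: a linear relation whose order depends only on the growth exponent, which is why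
  that exponent is fixed before the bump is chosen. Stated for Fourier coefficients on one circle,
  the relation is continuous under locally uniform convergence, and its order bounds the dimension
  of the solution space, so no representation theorem for boundary distributions is used. The
  sequence in the last hypothesis may go to infinity in any manner, so a nonzero combination has to
  be bounded below in all directions at once. This is where \<alpha> = 0 fails: the harmonic
  function Re z Im z vanishes on the real line and on the imaginary axis. Hence the insistence on
  polynomials without zeros, not merely on linear independence.\<close>

abbreviation (input) "uhp \<equiv> upper_half_plane"

lemma uhp_iff [simp]: "z \<in> upper_half_plane \<longleftrightarrow> Im z > 0"
  by (simp add: upper_half_plane_def)

lemma open_uhp: "open upper_half_plane"
  unfolding upper_half_plane_def by (rule open_halfspace_Im_gt)

text \<open>\<open>p\<close> and \<open>q\<close> are the derivatives by z and by cnj z, carried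
  along as explicit witnesses, so that the product, chain and conjugation rules follow from those of
  \<open>has_derivative\<close>. Their continuity is included because differentiation under the
  integral sign needs it.\<close>

definition has_wirtinger ::
    "(complex \<Rightarrow> complex) \<Rightarrow> (complex \<Rightarrow> complex) \<Rightarrow> (complex \<Rightarrow> complex) \<Rightarrow> complex set \<Rightarrow> bool" where
  "has_wirtinger f p q S \<longleftrightarrow>
     (\<forall>z\<in>S. (f has_derivative (\<lambda>d. p z * d + q z * cnj d)) (at z)) \<and>
     continuous_on S p \<and> continuous_on S q"

lemma has_wirtingerD:
  assumes "has_wirtinger f p q S"
  shows "z \<in> S \<Longrightarrow> (f has_derivative (\<lambda>d. p z * d + q z * cnj d)) (at z)"
    and "continuous_on S p" and "continuous_on S q"
  using assms by (auto simp: has_wirtinger_def)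

lemma has_wirtinger_continuous_on: "has_wirtinger f p q S \<Longrightarrow> continuous_on S f"
  by (meson continuous_at_imp_continuous_on has_derivative_continuous has_wirtinger_def)

lemma has_wirtinger_cong:
  assumes "has_wirtinger f p q S" "open S"
    and "\<And>z. z \<in> S \<Longrightarrow> f z = g z" "\<And>z. z \<in> S \<Longrightarrow> p z = p' z" "\<And>z. z \<in> S \<Longrightarrow> q z = q' z"
  shows "has_wirtinger g p' q' S"
  unfolding has_wirtinger_def
proof (intro conjI ballI)
  fix z assume z: "z \<in> S"
  have "(f has_derivative (\<lambda>d. p z * d + q z * cnj d)) (at z)"
    using assms(1) z by (rule has_wirtingerD)
  then have "(g has_derivative (\<lambda>d. p z * d + q z * cnj d)) (at z)"
    by (rule has_derivative_transform_within_open) (use assms z in auto)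
  then show "(g has_derivative (\<lambda>d. p' z * d + q' z * cnj d)) (at z)"
    using assms z by simp
next
  show "continuous_on S p'" "continuous_on S q'"
    using assms continuous_on_cong by (metis has_wirtingerD(2), metis has_wirtingerD(3))
qed

lemma has_wirtinger_add:
  assumes "has_wirtinger f p q S" "has_wirtinger f' p' q' S"
  shows "has_wirtinger (\<lambda>z. f z + f' z) (\<lambda>z. p z + p' z) (\<lambda>z. q z + q' z) S"
  unfolding has_wirtinger_def
proof (intro conjI ballI)
  fix z assume z: "z \<in> S"
  show "((\<lambda>z. f z + f' z) has_derivative (\<lambda>d. (p z + p' z) * d + (q z + q' z) * cnj d)) (at z)"
    by (rule has_derivative_eq_rhs,
        rule has_derivative_add[OF has_wirtingerD(1)[OF assms(1) z] has_wirtingerD(1)[OF assms(2) z]])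
       (simp add: algebra_simps)
qed (use assms in \<open>auto intro!: continuous_intros dest: has_wirtingerD\<close>)

lemma has_wirtinger_mult:
  assumes "has_wirtinger f p q S" "has_wirtinger f' p' q' S"
  shows "has_wirtinger (\<lambda>z. f z * f' z) (\<lambda>z. f z * p' z + p z * f' z) (\<lambda>z. f z * q' z + q z * f' z) S"
  unfolding has_wirtinger_def
proof (intro conjI ballI)
  fix z assume z: "z \<in> S"
  show "((\<lambda>z. f z * f' z) has_derivative
      (\<lambda>d. (f z * p' z + p z * f' z) * d + (f z * q' z + q z * f' z) * cnj d)) (at z)"
    by (rule has_derivative_eq_rhs,
        rule has_derivative_mult[OF has_wirtingerD(1)[OF assms(1) z] has_wirtingerD(1)[OF assms(2) z]])
       (simp add: algebra_simps)
qed (use assms in \<open>auto intro!: continuous_intros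
       dest: has_wirtingerD has_wirtinger_continuous_on\<close>)

lemma has_wirtinger_holomorphic:
  assumes "f holomorphic_on S" "open S"
  shows "has_wirtinger f (deriv f) (\<lambda>_. 0) S"
  unfolding has_wirtinger_def
proof (intro conjI ballI)
  fix z assume "z \<in> S"
  then have "(f has_field_derivative deriv f z) (at z)"
    using assms holomorphic_derivI by blast
  then show "(f has_derivative (\<lambda>d. deriv f z * d + 0 * cnj d)) (at z)"
    by (simp add: has_field_derivative_def)
qed (use assms in \<open>auto intro!: holomorphic_on_imp_continuous_on holomorphic_deriv\<close>)

lemma has_wirtinger_const: "has_wirtinger (\<lambda>_. c) (\<lambda>_. 0) (\<lambda>_. 0) S"
  by (auto simp: has_wirtinger_def)

lemma has_wirtinger_cmult:
  assumes "has_wirtinger f p q S"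
  shows "has_wirtinger (\<lambda>z. c * f z) (\<lambda>z. c * p z) (\<lambda>z. c * q z) S"
  using has_wirtinger_mult[OF has_wirtinger_const assms, of c] by simp

lemma has_wirtinger_cnj:
  assumes "has_wirtinger f p q S"
  shows "has_wirtinger (\<lambda>z. cnj (f z)) (\<lambda>z. cnj (q z)) (\<lambda>z. cnj (p z)) S"
  unfolding has_wirtinger_def
proof (intro conjI ballI)
  fix z assume z: "z \<in> S"
  show "((\<lambda>z. cnj (f z)) has_derivative (\<lambda>d. cnj (q z) * d + cnj (p z) * cnj d)) (at z)"
    by (rule has_derivative_eq_rhs,
        rule bounded_linear.has_derivative[OF bounded_linear_cnj has_wirtingerD(1)[OF assms z]])
       (simp add: algebra_simps)
qed (use assms in \<open>auto intro!: continuous_intros dest: has_wirtingerD\<close>)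

lemma has_wirtinger_imp_holomorphic:
  assumes "has_wirtinger f p q S" "open S" "\<And>z. z \<in> S \<Longrightarrow> q z = 0"
  shows "f holomorphic_on S"
proof -
  have "(f has_field_derivative p z) (at z)" if "z \<in> S" for z
    using has_wirtingerD(1)[OF assms(1) that] assms(3)[OF that] by (simp add: has_field_derivative_def)
  then show ?thesis
    using holomorphic_on_open assms(2) by blast
qed

lemma has_wirtinger_compose_holomorphic:
  assumes "has_wirtinger f p q T" "g holomorphic_on S" "open S" "g ` S \<subseteq> T"
  shows "has_wirtinger (\<lambda>z. f (g z)) (\<lambda>z. p (g z) * deriv g z) (\<lambda>z. q (g z) * cnj (deriv g z)) S"
  unfolding has_wirtinger_def
proof (intro conjI ballI)
  fix z assume z: "z \<in> S"
  have g: "(g has_derivative (\<lambda>d. deriv g z * d)) (at z)"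
    using holomorphic_derivI[OF assms(2,3) z] by (simp add: has_field_derivative_def)
  have "(f has_derivative (\<lambda>d. p (g z) * d + q (g z) * cnj d)) (at (g z))"
    using assms z by (auto intro: has_wirtingerD)
  from diff_chain_at[OF g this]
  show "((\<lambda>z. f (g z)) has_derivative
      (\<lambda>d. (p (g z) * deriv g z) * d + (q (g z) * cnj (deriv g z)) * cnj d)) (at z)"
    by (simp add: o_def mult.assoc)
next
  have g: "continuous_on S g" "continuous_on S (deriv g)"
    using assms by (auto intro!: holomorphic_on_imp_continuous_on holomorphic_deriv)
  have "continuous_on S (\<lambda>z. p (g z))" "continuous_on S (\<lambda>z. q (g z))"
    using g(1) assms(4) has_wirtingerD[OF assms(1)] continuous_on_compose2 by blast+
  with g show "continuous_on S (\<lambda>z. p (g z) * deriv g z)" 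
    "continuous_on S (\<lambda>z. q (g z) * cnj (deriv g z))"
    by (auto intro!: continuous_intros)
qed

lemma has_wirtinger_Im_powr:
  "has_wirtinger (\<lambda>z. of_real (Im z powr a))
     (\<lambda>z. - \<i> / 2 * of_real (a * Im z powr (a - 1))) (\<lambda>z. \<i> / 2 * of_real (a * Im z powr (a - 1))) uhp"
  unfolding has_wirtinger_def
proof (intro conjI ballI)
  fix z assume z: "z \<in> uhp"
  have *: "((\<lambda>y. y powr a) has_derivative (\<lambda>d. d * (a * Im z powr (a - 1)))) (at (Im z))"
    using has_real_derivative_powr[of "Im z" a] z 
    by (simp add: has_field_derivative_def mult_commute_abs)
  have "((\<lambda>z. Im z) has_derivative Im) (at z)"
    by (rule bounded_linear_imp_has_derivative) (rule bounded_linear_Im)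
  from diff_chain_at[OF this *]
  have "((\<lambda>z. Im z powr a) has_derivative (\<lambda>d. Im d * (a * Im z powr (a - 1)))) (at z)"
    by (simp add: o_def)
  from bounded_linear.has_derivative[OF bounded_linear_of_real this]
  show "((\<lambda>z. complex_of_real (Im z powr a)) has_derivative
      (\<lambda>d. - \<i> / 2 * of_real (a * Im z powr (a - 1)) * d + \<i> / 2 * of_real (a * Im z powr (a - 1)) * cnj d)) (at z)"
    by (rule has_derivative_eq_rhs) (auto simp: fun_eq_iff complex_eq_iff)
qed (auto intro!: continuous_intros)

text \<open>A \<open>C\<^sup>2\<close> solution of the second order equation is encoded by the first order system
  \<open>\<partial>bar u = y\<^sup>\<alpha> k\<close>, \<open>\<partial> k = 0\<close>, with \<open>p = \<partial> u\<close> and \<open>k' = \<partial>bar k\<close>.\<close>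

definition alpha_system ::
    "real \<Rightarrow> (complex \<Rightarrow> complex) \<Rightarrow> (complex \<Rightarrow> complex) \<Rightarrow> (complex \<Rightarrow> complex) \<Rightarrow> (complex \<Rightarrow> complex) \<Rightarrow> bool" where
  "alpha_system \<alpha> u p k k' \<longleftrightarrow>
     has_wirtinger u p (\<lambda>z. of_real (Im z powr \<alpha>) * k z) uhp \<and> has_wirtinger k (\<lambda>_. 0) k' uhp"

text \<open>A real-linear map \<open>D\<close> of the plane is determined by \<open>D 1\<close> and
  \<open>D \<i>\<close>, which are the two partial derivatives; writing Re d and Im d through d and
  cnj d gives this form.\<close>

lemma has_derivative_partials:
  assumes "f differentiable (at z)"
  shows "(f has_derivative (\<lambda>d. d_z f z * d + dbar_z f z * cnj d)) (at z)"
proof -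
  obtain D where D: "(f has_derivative D) (at z)"
    using assms differentiable_def by blast
  interpret D: bounded_linear D using D by (rule has_derivative_bounded_linear)
  have *: "((\<lambda>t. f (z + c * of_real t)) has_vector_derivative D c) (at 0)" for c :: complex
  proof -
    have "((\<lambda>t. z + c * of_real t) has_derivative (\<lambda>t. c * of_real t)) (at (0::real))"
      by (auto intro!: derivative_eq_intros bounded_linear_imp_has_derivative 
          bounded_linear_intros simp: bounded_linear_of_real)
    then have "((\<lambda>t. f (z + c * of_real t)) has_derivative (\<lambda>t. D (c * of_real t))) (at 0)"
      using diff_chain_at[of "\<lambda>t. z + c * of_real t" _ "0::real" f D] D by (simp add: o_def)
    moreover have "D (c * of_real t) = t *\<^sub>R D c" for t
      by (metis D.scaleR mult.commute scaleR_conv_of_real)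
    ultimately show ?thesis by (simp add: has_vector_derivative_def)
  qed
  have x: "partial_x f z = D 1"
    using *[of 1] by (simp add: partial_x_def vector_derivative_at)
  have y: "partial_y f z = D \<i>"
    using *[of \<i>] by (simp add: partial_y_def vector_derivative_at)
  have "D d = d_z f z * d + dbar_z f z * cnj d" for d
  proof -
    have "D d = D (Re d *\<^sub>R 1 + Im d *\<^sub>R \<i>)"
      by (metis complex_eq scaleR_conv_of_real mult.commute mult.right_neutral)
    also have "\<dots> = of_real (Re d) * D 1 + of_real (Im d) * D \<i>"
      unfolding D.add D.scaleR by (simp add: scaleR_conv_of_real)
    also have "\<dots> = d_z f z * d + dbar_z f z * cnj d"
      unfolding d_z_def dbar_z_def x y
      by (subst (3 4) complex_eq[of d]) (simp add: field_simps complex_eq_iff)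
    finally show ?thesis .
  qed
  then show ?thesis using D by (metis (no_types, lifting) ext)
qed

text \<open>The first partials of a C^2 function are continuously differentiable, so k =
  y^(-\<alpha>) \<open>dbar_z u\<close> has Wirtinger derivatives; the equation says that the first
  of them is 0.\<close>

lemma alpha_harmonic_imp_alpha_system:
  assumes "alpha_harmonic \<alpha> u"
  shows "\<exists>p k k'. alpha_system \<alpha> u p k k'"
proof -
  have ux: "\<And>z. z \<in> uhp \<Longrightarrow> u differentiable (at z)" 
    "\<And>z. z \<in> uhp \<Longrightarrow> partial_x u differentiable (at z)"
    "\<And>z. z \<in> uhp \<Longrightarrow> partial_y u differentiable (at z)"
    "continuous_on uhp (partial_x (partial_x u))" "continuous_on uhp (partial_y (partial_x u))"
    "continuous_on uhp (partial_x (partial_y u))" "continuous_on uhp (partial_y (partial_y u))"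
    using assms by (auto simp: alpha_harmonic_def numeral_2_eq_2)
  have dx: "has_wirtinger (partial_x u) (d_z (partial_x u)) (dbar_z (partial_x u)) uhp"
    unfolding has_wirtinger_def using ux
    by (auto intro!: has_derivative_partials) (auto simp: d_z_def dbar_z_def intro!: continuous_intros)
  have dy: "has_wirtinger (partial_y u) (d_z (partial_y u)) (dbar_z (partial_y u)) uhp"
    unfolding has_wirtinger_def using ux
    by (auto intro!: has_derivative_partials) (auto simp: d_z_def dbar_z_def intro!: continuous_intros)
  define k where "k = (\<lambda>w. of_real (Im w powr (- \<alpha>)) * dbar_z u w)"
  have cu: "continuous_on uhp (d_z u)" "continuous_on uhp (dbar_z u)"
    using has_wirtinger_continuous_on[OF dx] has_wirtinger_continuous_on[OF dy]
    unfolding d_z_def dbar_z_def by (auto intro!: continuous_intros)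
  have wu: "has_wirtinger u (d_z u) (dbar_z u) uhp"
    unfolding has_wirtinger_def using ux cu by (auto intro!: has_derivative_partials)
  have du: "dbar_z u = (\<lambda>z. (1/2) * (partial_x u z + \<i> * partial_y u z))"
    by (auto simp: dbar_z_def)
  obtain p q where pq: "has_wirtinger k p q uhp"
    unfolding k_def du
    using has_wirtinger_mult[OF has_wirtinger_Im_powr[of "-\<alpha>"] 
        has_wirtinger_cmult[OF has_wirtinger_add[OF dx has_wirtinger_cmult[OF dy, of \<i>]], of "1/2"]]
    by blast
  have "p z = 0" if z: "z \<in> uhp" for z
  proof -
    have D: "(k has_derivative (\<lambda>d. p z * d + q z * cnj d)) (at z)"
      using pq z by (rule has_wirtingerD)
    have "d_z k z = 0" using assms z unfolding k_def alpha_harmonic_def by blast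
    moreover have "(k has_derivative (\<lambda>d. d_z k z * d + dbar_z k z * cnj d)) (at z)"
      using D by (intro has_derivative_partials) (auto simp: differentiable_def)
    ultimately have e: "(\<lambda>d. p z * d + q z * cnj d) = (\<lambda>d. dbar_z k z * cnj d)"
      using has_derivative_unique[OF D] by fastforce
    \<comment> \<open>For D = \<open>dbar_z k z\<close> the arguments \<open>1\<close> and
      \<open>\<i>\<close> give p + q = D and p - q = -D.\<close>
    show ?thesis using fun_cong[OF e, of 1] fun_cong[OF e, of \<i>] 
      by (simp add: algebra_simps) (simp add: complex_eq_iff)
  qed
  then have "has_wirtinger k (\<lambda>_. 0) q uhp"
    using has_wirtinger_cong[OF pq open_uhp] by auto
  moreover have "has_wirtinger u (d_z u) (\<lambda>z. of_real (Im z powr \<alpha>) * k z) uhp"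
    by (rule has_wirtinger_cong[OF wu open_uhp])
      (auto simp: k_def powr_minus field_simps simp flip: of_real_mult)
  ultimately show ?thesis unfolding alpha_system_def by blast
qed

section \<open>Test functions and mollification\<close>

definition vderiv :: "(real \<Rightarrow> complex) \<Rightarrow> real \<Rightarrow> complex" where
  "vderiv f t = vector_derivative f (at t)"

definition smooth_fun :: "(real \<Rightarrow> complex) \<Rightarrow> bool" where
  "smooth_fun f \<longleftrightarrow> (\<forall>n x. (vderiv ^^ n) f differentiable (at x))"

text \<open>Replaces explicit n-th derivatives: it suffices to name a family closed under
  differentiation. The families below are spans of bump products, translates, and series of
  translates.\<close>

lemma smooth_fun_coinduct:
  assumes "f \<in> S" and "\<And>g. g \<in> S \<Longrightarrow> \<exists>h\<in>S. \<forall>x. (g has_vector_derivative h x) (at x)"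
  shows "smooth_fun f"
proof -
  have *: "vderiv g \<in> S \<and> (\<forall>x. g differentiable (at x))" if "g \<in> S" for g
  proof -
    obtain h where "h \<in> S" "\<forall>x. (g has_vector_derivative h x) (at x)"
      using assms(2)[OF \<open>g \<in> S\<close>] by blast
    moreover from this have "vderiv g = h"
      by (auto simp: vderiv_def vector_derivative_at)
    ultimately show ?thesis
      by (auto intro: differentiableI_vector)
  qed
  have "(vderiv ^^ n) f \<in> S" for n
    by (induction n) (use assms(1) * in auto)
  with * show ?thesis by (auto simp: smooth_fun_def)
qed

lemma smooth_fun_vderiv:
  assumes "smooth_fun f"
  shows "(f has_vector_derivative vderiv f x) (at x)" and "smooth_fun (vderiv f)"
proof -
  have "(vderiv ^^ 0) f differentiable (at x)"
    using assms smooth_fun_def by blast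
  then show "(f has_vector_derivative vderiv f x) (at x)"
    unfolding vderiv_def funpow_0 by (rule vector_derivative_works[THEN iffD1])
  have "(vderiv ^^ n) (vderiv f) = (vderiv ^^ Suc n) f" for n
    by (simp add: funpow_swap1)
  then show "smooth_fun (vderiv f)"
    using assms unfolding smooth_fun_def by metis
qed

lemma smooth_fun_continuous_on: "smooth_fun f \<Longrightarrow> continuous_on A f"
  by (intro continuous_at_imp_continuous_on ballI has_vector_derivative_continuous[OF smooth_fun_vderiv(1)])

definition unit_bump :: "(real \<Rightarrow> complex) \<Rightarrow> bool" where
  "unit_bump \<phi> \<longleftrightarrow> smooth_fun \<phi> \<and> (\<forall>t. \<bar>t\<bar> > 1 \<longrightarrow> \<phi> t = 0)"

lemma unit_bump_vderiv:
  assumes "unit_bump \<phi>"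
  shows "unit_bump (vderiv \<phi>)"
  unfolding unit_bump_def
proof (intro conjI allI impI)
  show "smooth_fun (vderiv \<phi>)"
    using assms smooth_fun_vderiv(2) unit_bump_def by blast
  fix t :: real assume t: "\<bar>t\<bar> > 1"
  have "((\<lambda>_. 0) has_vector_derivative 0) (at t)" by simp
  then have "(\<phi> has_vector_derivative 0) (at t)"
    by (rule has_vector_derivative_transform_within_open[where S = "{s. \<bar>s\<bar> > 1}"])
      (use t assms in \<open>auto simp: unit_bump_def intro!: open_Collect_less continuous_intros\<close>)
  then show "vderiv \<phi> t = 0"
    by (simp add: vderiv_def vector_derivative_at)
qed

lemma unit_bump_continuous_on: "unit_bump \<phi> \<Longrightarrow> continuous_on A \<phi>"
  by (simp add: smooth_fun_continuous_on unit_bump_def)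

section \<open>Bump functions of small support\<close>

definition flat_exp :: "nat \<Rightarrow> real \<Rightarrow> real" where
  "flat_exp k x = (if x > 0 then (1/x)^k * exp (- (1/x)) else 0)"

lemma flat_exp_tendsto_0: "(flat_exp k \<longlongrightarrow> 0) (at 0)"
proof -
  have r: "(flat_exp k \<longlongrightarrow> 0) (at_right 0)"
  proof (rule Lim_transform_eventually)
    show "((\<lambda>x. (1/x)^k / exp (1/x)) \<longlongrightarrow> (0::real)) (at_right 0)"
      using filterlim_compose[OF tendsto_power_div_exp_0[of k] filterlim_inverse_at_top_right]
      by (simp add: divide_inverse)
    show "\<forall>\<^sub>F x in at_right 0. (1/x)^k / exp (1/x) = flat_exp k x"
      using eventually_at_right_less[of 0]
      by eventually_elim (simp add: flat_exp_def exp_minus field_simps)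
  qed
  have l: "(flat_exp k \<longlongrightarrow> 0) (at_left 0)"
  proof (rule Lim_transform_eventually[OF tendsto_const])
    show "\<forall>\<^sub>F x in at_left 0. 0 = flat_exp k x"
      by (rule eventually_at_leftI[of "-1"]) (auto simp: flat_exp_def)
  qed
  from l r show ?thesis by (simp add: filterlim_split_at)
qed

text \<open>The powers of 1/x in front of exp(-1/x) are what differentiation produces, so these
  functions span a space closed under it. At 0 the difference quotient of \<open>flat_exp k\<close>
  is exactly \<open>flat_exp (k + 1)\<close>, which tends to 0.\<close>

lemma flat_exp_deriv:
  "(flat_exp k has_real_derivative flat_exp (k + 2) x - k * flat_exp (k + 1) x) (at x)"
proof -
  consider "x > 0" | "x < 0" | "x = 0" by linarith
  then show ?thesis
  proof cases
    case 1
    have "((\<lambda>x. (1/x)^k * exp (- (1/x))) has_real_derivative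
        flat_exp (k + 2) x - k * flat_exp (k + 1) x) (at x)"
    proof -
      have i: "((\<lambda>x. 1/x) has_real_derivative - ((1/x)^2)) (at x)"
        using DERIV_inverse[of x] 1 by (simp add: inverse_eq_divide power2_eq_square)
      have "((\<lambda>x. (1/x)^k * exp (- (1/x))) has_real_derivative
         (k * (- ((1/x)^2) * (1/x)^(k - 1))) * exp (- (1/x)) + (exp (- (1/x)) * ((1/x)^2)) * (1/x)^k) (at x)"
        using DERIV_mult[OF DERIV_power[OF i, of k] DERIV_fun_exp[OF DERIV_minus[OF i]]]
        by simp
      moreover have "(k * (- ((1/x)^2) * (1/x)^(k - 1))) * exp (- (1/x)) = - real k * flat_exp (k + 1) x"
        using 1 by (cases k) (simp_all add: flat_exp_def power2_eq_square field_simps)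
      ultimately show ?thesis
        using 1 by (simp add: flat_exp_def power2_eq_square algebra_simps)
    qed
    then show ?thesis
      by (rule has_field_derivative_transform_within_open[where S = "{0<..}"])
        (use 1 in \<open>auto simp: flat_exp_def\<close>)
  next
    case 2
    have "((\<lambda>x. 0) has_real_derivative 0) (at x)" by simp
    then have "(flat_exp k has_real_derivative 0) (at x)"
      by (rule has_field_derivative_transform_within_open[where S = "{..<0}"])
        (use 2 in \<open>auto simp: flat_exp_def\<close>)
    then show ?thesis using 2 by (simp add: flat_exp_def)
  next
    case 3
    have "((\<lambda>h. (flat_exp k (0 + h) - flat_exp k 0) / h) \<longlongrightarrow> 0) (at 0)"
    proof (rule Lim_transform_eventually[OF flat_exp_tendsto_0[of "k+1"]])
      show "\<forall>\<^sub>F x in at 0. flat_exp (k + 1) x = (flat_exp k (0 + x) - flat_exp k 0) / x"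
        by (rule always_eventually) (auto simp: flat_exp_def field_simps)
    qed
    then show ?thesis using 3 by (simp add: DERIV_def flat_exp_def)
  qed
qed

text \<open>The span of the products \<open>flat_exp i (e + t) flat_exp j (e - t)\<close> is closed under
  differentiation, which makes its members smooth.\<close>

inductive_set bump_span :: "real \<Rightarrow> (real \<Rightarrow> complex) set" for e :: real where
  base: "(\<lambda>t. of_real (c * (flat_exp i (e + t) * flat_exp j (e - t)))) \<in> bump_span e"
| add: "f \<in> bump_span e \<Longrightarrow> g \<in> bump_span e \<Longrightarrow> (\<lambda>t. f t + g t) \<in> bump_span e"

lemma bump_span_smooth:
  assumes "f \<in> bump_span e"
  shows "smooth_fun f"
proof (rule smooth_fun_coinduct[OF assms])
  fix g assume "g \<in> bump_span e"
  then show "\<exists>h\<in>bump_span e. \<forall>x. (g has_vector_derivative h x) (at x)"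
  proof induction
    case (base c i j)
    define h where "h = (\<lambda>t. complex_of_real (c * (flat_exp (i+2) (e + t) * flat_exp j (e - t))) +
       (complex_of_real (- c * i * (flat_exp (i+1) (e + t) * flat_exp j (e - t))) +
       (complex_of_real (- c * (flat_exp i (e + t) * flat_exp (j+2) (e - t))) +
        complex_of_real (c * j * (flat_exp i (e + t) * flat_exp (j+1) (e - t))))))"
    have "h \<in> bump_span e"
      unfolding h_def by (intro bump_span.intros)
    moreover have "((\<lambda>t. complex_of_real (c * (flat_exp i (e + t) * flat_exp j (e - t)))) has_vector_derivative h x) (at x)" for x
    proof -
      have 1: "((\<lambda>t. flat_exp i (e + t)) has_real_derivative 
          (flat_exp (i + 2) (e + x) - i * flat_exp (i + 1) (e + x))) (at x)"
        using DERIV_chain2[where g = "\<lambda>t. e + t" and f = "flat_exp i" and x = x and Db = 1 and s = UNIV,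
            OF flat_exp_deriv] DERIV_add[OF DERIV_const[of e] DERIV_ident, of x UNIV] by simp
      have 2: "((\<lambda>t. flat_exp j (e - t)) has_real_derivative 
          - (flat_exp (j + 2) (e - x) - j * flat_exp (j + 1) (e - x))) (at x)"
        using DERIV_chain2[where g = "\<lambda>t. e - t" and f = "flat_exp j" and x = x and Db = "-1" and s = UNIV,
 OF flat_exp_deriv] DERIV_diff[OF DERIV_const[of e] DERIV_ident, of x UNIV] by simp
      have "((\<lambda>t. c * (flat_exp i (e + t) * flat_exp j (e - t))) has_real_derivative
         Re (h x)) (at x)"
        by (rule derivative_eq_intros 1 2 refl)+ (simp add: h_def algebra_simps)
      from has_vector_derivative_of_real[OF this]
      show ?thesis by (simp add: h_def)
    qed
    ultimately show ?case by blast
  next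
    case (add f g)
    then obtain hf hg where "hf \<in> bump_span e" "hg \<in> bump_span e"
      "\<forall>x. (f has_vector_derivative hf x) (at x)" "\<forall>x. (g has_vector_derivative hg x) (at x)" by blast
    then show ?case
      by (intro bexI[of _ "\<lambda>t. hf t + hg t"])
        (auto intro: bump_span.add has_vector_derivative_add)
  qed
qed

lemma exists_unit_bump:
  fixes e :: real
  assumes "0 < e" "e \<le> 1"
  obtains \<phi> :: "real \<Rightarrow> real" where "unit_bump (\<lambda>t. of_real (\<phi> t))" "\<And>t. \<phi> t \<ge> 0"
    "\<And>t. \<bar>t\<bar> > e \<Longrightarrow> \<phi> t = 0" "(\<phi> has_integral 1) {-2..2}" "continuous_on UNIV \<phi>"
proof -
  define b where "b = (\<lambda>t. flat_exp 0 (e + t) * flat_exp 0 (e - t))"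
  have cf: "continuous_on UNIV (flat_exp 0)"
    using flat_exp_deriv[of 0] by (meson DERIV_isCont continuous_at_imp_continuous_on)
  have cb: "continuous_on A b" for A
    unfolding b_def by (intro continuous_intros continuous_on_compose2[OF cf]) auto
  have b0: "b t \<ge> 0" for t by (simp add: b_def flat_exp_def)
  have int: "b integrable_on {-2..2}"
    by (rule integrable_continuous_interval) (rule cb)
  define I where "I = integral {-2..2} b"
  have "I \<noteq> 0"
  proof
    assume "I = 0"
    then have "(b has_integral 0) (cbox (-2) 2)"
      using int I_def by (metis cbox_interval integrable_integral)
    then have "b 0 = 0"
      by (rule has_integral_0_cbox_imp_0[rotated 2]) (use b0 cb in auto)
    then show False using assms by (simp add: b_def flat_exp_def)
  qed
  moreover have "I \<ge> 0"
    unfolding I_def by (rule integral_nonneg[OF int]) (simp add: b0)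
  ultimately have I: "I > 0" by simp
  show ?thesis
  proof
    have "(\<lambda>t. complex_of_real (1 / I * (flat_exp 0 (e + t) * flat_exp 0 (e - t)))) \<in> bump_span e"
      by (rule bump_span.base)
    then have "smooth_fun (\<lambda>t. complex_of_real (b t / I))"
      by (intro bump_span_smooth[of _ e]) (simp add: b_def)
    moreover have "b t = 0" if "\<bar>t\<bar> > e" for t
      using that by (auto simp: b_def flat_exp_def)
    ultimately show "unit_bump (\<lambda>t. complex_of_real (b t / I))"
      "\<And>t. \<bar>t\<bar> > e \<Longrightarrow> b t / I = 0"
      using assms by (auto simp: unit_bump_def)
    show "\<And>t. b t / I \<ge> 0" using b0 I by simp
    show "((\<lambda>t. b t / I) has_integral 1) {-2..2}"
      using has_integral_divide[OF integrable_integral[OF int], of I] I by (simp add: I_def)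
    show "continuous_on UNIV (\<lambda>t. b t / I)" using I by (intro continuous_intros cb) auto
  qed
qed

section \<open>Mollification along horizontal lines\<close>

text \<open>Written with z + t, not z - t, so that the value at x + iy pairs the slice at height y
  with the bump translated by x. The interval exceeds the support [-1,1] of a unit bump, which
  therefore vanishes at the endpoints.\<close>

definition mollify :: "(complex \<Rightarrow> complex) \<Rightarrow> (real \<Rightarrow> complex) \<Rightarrow> complex \<Rightarrow> complex" where
  "mollify f \<phi> z = integral {-2..2} (\<lambda>t. f (z + of_real t) * \<phi> t)"

lemma continuous_on_mollify_integrand:
  fixes f :: "complex \<Rightarrow> complex" and \<phi> :: "real \<Rightarrow> complex"
  assumes "continuous_on uhp f" "continuous_on UNIV \<phi>"
  shows "continuous_on (uhp \<times> cbox (-2) 2) (\<lambda>(z, t). f (z + of_real t) * \<phi> t)"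
  unfolding split_beta
  by (intro continuous_on_mult continuous_on_compose2[OF assms(1)] continuous_on_compose2[OF assms(2), of _ snd] continuous_intros) auto

lemma mollify_integrable:
  fixes f :: "complex \<Rightarrow> complex" and \<phi> :: "real \<Rightarrow> complex"
  assumes "continuous_on uhp f" "continuous_on UNIV \<phi>" "z \<in> uhp"
  shows "(\<lambda>t. f (z + of_real t) * \<phi> t) integrable_on {a..b}"
  by (intro integrable_continuous_interval continuous_on_mult continuous_on_compose2[OF assms(1)] 
      continuous_on_subset[OF assms(2)] continuous_intros) (use assms(3) in auto)

lemma continuous_on_mollify:
  assumes "continuous_on uhp f" "continuous_on UNIV \<phi>"
  shows "continuous_on uhp (mollify f \<phi>)"
  using integral_continuous_on_param[OF continuous_on_mollify_integrand[OF assms]]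
  by (simp add: mollify_def[abs_def])

lemma convex_uhp: "convex uhp"
  unfolding upper_half_plane_def by (rule convex_halfspace_Im_gt)

lemma has_wirtinger_mollify:
  assumes w: "has_wirtinger f p q uhp" and \<phi>: "continuous_on UNIV \<phi>"
  shows "has_wirtinger (mollify f \<phi>) (mollify p \<phi>) (mollify q \<phi>) uhp"
  unfolding has_wirtinger_def
proof (intro conjI ballI continuous_on_mollify)
  note c = has_wirtingerD(2,3)[OF w] has_wirtinger_continuous_on[OF w]
  show "continuous_on uhp p" "continuous_on uhp q" by fact+
  show "continuous_on UNIV \<phi>" "continuous_on UNIV \<phi>" by fact+
  fix z assume z: "z \<in> uhp"
  \<comment> \<open>The Leibniz rule used here takes the derivative as a bounded linear operator
    depending continuously on the point, so the real-linear map d -> a d + b cnj d is packaged as a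
    \<open>blinfun\<close>.\<close>
  define B where "B = (\<lambda>a b. blinfun_mult_right a + (blinfun_mult_right b o\<^sub>L Blinfun cnj))"
  have B: "blinfun_apply (B a b) d = a * d + b * cnj d" for a b d
    by (simp add: B_def plus_blinfun.rep_eq bounded_linear_Blinfun_apply bounded_linear_cnj)
  define fx where "fx = (\<lambda>z t. B (p (z + of_real t) * \<phi> t) (q (z + of_real t) * \<phi> t))"
  have cfx: "continuous_on (uhp \<times> cbox (-2) 2) (\<lambda>(z, t). fx z t)"
    unfolding fx_def B_def split_beta
    using continuous_on_mollify_integrand[OF c(1) \<phi>] continuous_on_mollify_integrand[OF c(2) \<phi>]
    by (auto simp: split_beta intro!: continuous_intros)
  have "((\<lambda>z. integral (cbox (-2) 2) (\<lambda>t. f (z + of_real t) * \<phi> t)) has_derivative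
     blinfun_apply (integral (cbox (-2) 2) (fx z))) (at z within uhp)"
  proof (rule leibniz_rule[OF _ _ cfx z convex_uhp])
    fix x t assume x: "x \<in> uhp" and t: "t \<in> cbox (-2) (2::real)"
    have "((\<lambda>x. f (x + of_real t)) has_derivative 
       (\<lambda>d. p (x + of_real t) * d + q (x + of_real t) * cnj d)) (at x)"
    proof -
      have "((\<lambda>x. x + of_real t) has_derivative (\<lambda>d. d)) (at x)"
        by (auto intro!: derivative_eq_intros)
      from diff_chain_at[OF this has_wirtingerD(1)[OF w]] x
      show ?thesis by (simp add: o_def)
    qed
    moreover have fx': "blinfun_apply (fx x t) = (\<lambda>d. (p (x + of_real t) * d + q (x + of_real t) * cnj d) * \<phi> t)"
      by (simp add: fx_def B algebra_simps fun_eq_iff)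
    ultimately have "((\<lambda>x. f (x + of_real t) * \<phi> t) has_derivative 
       (\<lambda>d. (p (x + of_real t) * d + q (x + of_real t) * cnj d) * \<phi> t)) (at x)"
      by (intro has_derivative_mult_left)
    then show "((\<lambda>x. f (x + of_real t) * \<phi> t) has_derivative blinfun_apply (fx x t)) (at x within uhp)"
      unfolding fx' by (rule has_derivative_at_withinI)
  next
    fix x assume "x \<in> uhp"
    then show "(\<lambda>t. f (x + of_real t) * \<phi> t) integrable_on cbox (-2) 2"
      using mollify_integrable[OF c(3) \<phi>] by simp
  qed
  moreover have "blinfun_apply (integral (cbox (-2) 2) (fx z)) d = mollify p \<phi> z * d + mollify q \<phi> z * cnj d" for d
  proof -
    have "continuous_on (cbox (-2) 2) (\<lambda>t. (\<lambda>(z, t). fx z t) (z, t))"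
      by (rule continuous_on_compose2[OF cfx]) (use z in \<open>auto intro!: continuous_intros\<close>)
    then have i: "fx z integrable_on cbox (-2) 2"
      by (intro integrable_continuous) simp
    have "blinfun_apply (integral (cbox (-2) 2) (fx z)) d = integral (cbox (-2) 2) (\<lambda>t. fx z t d)"
      using integral_linear[OF i blinfun.bounded_linear_left[of d]] by (simp add: o_def)
    also have "\<dots> = integral {-2..2} (\<lambda>t. (p (z + of_real t) * \<phi> t) * d + (q (z + of_real t) * \<phi> t) * cnj d)"
      by (simp add: fx_def B)
    also have "\<dots> = mollify p \<phi> z * d + mollify q \<phi> z * cnj d"
      using mollify_integrable[OF c(1) \<phi> z] mollify_integrable[OF c(2) \<phi> z]
      by (subst integral_add) (auto simp: mollify_def intro!: integrable_on_mult_left)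
    finally show ?thesis .
  qed
  then have "blinfun_apply (integral (cbox (-2) 2) (fx z)) = (\<lambda>d. mollify p \<phi> z * d + mollify q \<phi> z * cnj d)"
    by (rule ext)
  ultimately have "((\<lambda>z. integral (cbox (-2) 2) (\<lambda>t. f (z + of_real t) * \<phi> t)) has_derivative
     (\<lambda>d. mollify p \<phi> z * d + mollify q \<phi> z * cnj d)) (at z within uhp)"
    by simp
  then show "(mollify f \<phi> has_derivative (\<lambda>d. mollify p \<phi> z * d + mollify q \<phi> z * cnj d)) (at z)"
    using at_within_open[OF z open_uhp] by (simp add: mollify_def[abs_def])
qed

lemma has_wirtinger_curve:
  assumes "has_wirtinger f p q S" "(\<gamma> has_vector_derivative g) (at t)" "\<gamma> t \<in> S"
  shows "((\<lambda>t. f (\<gamma> t)) has_vector_derivative p (\<gamma> t) * g + q (\<gamma> t) * cnj g) (at t)"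
proof -
  have "(\<gamma> has_derivative (\<lambda>h. h *\<^sub>R g)) (at t)"
    using assms(2) by (simp add: has_vector_derivative_def)
  from diff_chain_at[OF this has_wirtingerD(1)[OF assms(1,3)]]
  have "((\<lambda>t. f (\<gamma> t)) has_derivative (\<lambda>h. p (\<gamma> t) * (h *\<^sub>R g) + q (\<gamma> t) * cnj (h *\<^sub>R g))) (at t)"
    by (simp add: o_def)
  then show ?thesis
    unfolding has_vector_derivative_def by (simp add: algebra_simps)
qed

text \<open>p + q is the derivative in x, and integration by parts moves it onto the bump. So
  x-derivatives of mollifications are again mollifications, and a bound valid for all unit bumps
  also bounds them.\<close>

lemma mollify_by_parts:
  assumes w: "has_wirtinger f p q uhp" and \<phi>: "unit_bump \<phi>" and z: "z \<in> uhp"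
  shows "mollify p \<phi> z + mollify q \<phi> z = - mollify f (vderiv \<phi>) z"
proof -
  note c = has_wirtingerD(2,3)[OF w] has_wirtinger_continuous_on[OF w]
  have cp: "continuous_on A \<phi>" "continuous_on A (vderiv \<phi>)" for A
    using \<phi> unit_bump_continuous_on unit_bump_vderiv by blast+
  have cz: "continuous_on {-2..2} (\<lambda>t. g (z + complex_of_real t))" if "continuous_on uhp g" for g :: "complex \<Rightarrow> complex"
    by (intro continuous_on_compose2[OF that] continuous_intros) (use z in auto)
  have "((\<lambda>t. (p (z + of_real t) + q (z + of_real t)) * \<phi> t) has_integral - mollify f (vderiv \<phi>) z) {-2..2}"
  proof (rule integration_by_parts[OF bounded_bilinear_mult])
    show "(-2::real) \<le> 2" by simp
    show "continuous_on {-2..2} (\<lambda>t. f (z + complex_of_real t))" by (rule cz) fact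
    show "continuous_on {-2..2} \<phi>" by (rule cp)
    fix t :: real assume "t \<in> {-2..2}"
    have "((\<lambda>t. z + complex_of_real t) has_vector_derivative 1) (at t)"
      by (auto intro!: derivative_eq_intros)
    from has_wirtinger_curve[OF w this]
    show "((\<lambda>t. f (z + complex_of_real t)) has_vector_derivative p (z + of_real t) + q (z + of_real t)) (at t)"
      using z by simp
    show "(\<phi> has_vector_derivative vderiv \<phi> t) (at t)"
      using \<phi> smooth_fun_vderiv(1) unit_bump_def by blast
  next
    have "((\<lambda>t. f (z + of_real t) * vderiv \<phi> t) has_integral mollify f (vderiv \<phi>) z) {-2..2}"
      unfolding mollify_def
      by (rule integrable_integral) (rule mollify_integrable[OF c(3) cp(2) z])
    then show "((\<lambda>t. f (z + of_real t) * vderiv \<phi> t) has_integral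
       f (z + of_real 2) * \<phi> 2 - f (z + of_real (-2)) * \<phi> (-2) - - mollify f (vderiv \<phi>) z) {-2..2}"
      using \<phi> by (simp add: unit_bump_def)
  qed
  moreover have "((\<lambda>t. (p (z + of_real t) + q (z + of_real t)) * \<phi> t) has_integral mollify p \<phi> z + mollify q \<phi> z) {-2..2}"
    unfolding mollify_def distrib_right
    by (intro has_integral_add integrable_integral mollify_integrable c cp z)
  ultimately show ?thesis
    using has_integral_unique by blast
qed

lemma mollify_Im_powr_mult:
  "mollify (\<lambda>z. of_real (Im z powr a) * k z) \<phi> = (\<lambda>z. of_real (Im z powr a) * mollify k \<phi> z)"
  by (simp add: mollify_def mult.assoc fun_eq_iff)

text \<open>The weight depends on Im z alone and so commutes with averaging in x.\<close>

lemma alpha_system_mollify: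
  assumes a: "alpha_system \<alpha> u p k k'" and \<phi>: "continuous_on UNIV \<phi>"
  shows "alpha_system \<alpha> (mollify u \<phi>) (mollify p \<phi>) (mollify k \<phi>) (mollify k' \<phi>)"
  unfolding alpha_system_def
proof
  have "has_wirtinger (mollify u \<phi>) (mollify p \<phi>) (mollify (\<lambda>z. of_real (Im z powr \<alpha>) * k z) \<phi>) uhp"
    by (rule has_wirtinger_mollify) (use a \<phi> in \<open>auto simp: alpha_system_def\<close>)
  then show "has_wirtinger (mollify u \<phi>) (mollify p \<phi>) (\<lambda>z. of_real (Im z powr \<alpha>) * mollify k \<phi> z) uhp"
    by (simp add: mollify_Im_powr_mult)
  have "mollify (\<lambda>_. 0) \<phi> = (\<lambda>_. 0)" by (auto simp: mollify_def)
  moreover have "has_wirtinger (mollify k \<phi>) (mollify (\<lambda>_. 0) \<phi>) (mollify k' \<phi>) uhp"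
    by (rule has_wirtinger_mollify) (use a \<phi> in \<open>auto simp: alpha_system_def\<close>)
  ultimately show "has_wirtinger (mollify k \<phi>) (\<lambda>_. 0) (mollify k' \<phi>) uhp" by simp
qed

text \<open>The equation on a vertical line in divergence form: \<open>G\<close> is y^(-\<alpha>) v'
  for the mollification v. With all x-derivatives moved onto the bump, \<open>k\<close> drops out,
  and the right-hand side of the equation for \<open>G\<close> is bounded as soon as mollifications
  of \<open>u\<close> are.\<close>

lemma alpha_system_mollify_ode:
  assumes a: "alpha_system \<alpha> u p k k'" and \<phi>: "unit_bump \<phi>"
  obtains G where 
    "\<And>y. y > 0 \<Longrightarrow> ((\<lambda>y. mollify u \<phi> (Complex x y)) has_vector_derivative of_real (y powr \<alpha>) * G y) (at y)"
    "\<And>y. y > 0 \<Longrightarrow> (G has_vector_derivative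
        \<i> * of_real (\<alpha> * y powr (- \<alpha> - 1)) * mollify u (vderiv \<phi>) (Complex x y) 
        - of_real (y powr (- \<alpha>)) * mollify u (vderiv (vderiv \<phi>)) (Complex x y)) (at y)"
proof -
  have w: "has_wirtinger u p (\<lambda>z. of_real (Im z powr \<alpha>) * k z) uhp" "has_wirtinger k (\<lambda>_. 0) k' uhp"
    using a by (auto simp: alpha_system_def)
  have line: "((\<lambda>y. Complex x y) has_vector_derivative \<i>) (at y)" for y
  proof -
    have "((\<lambda>y. of_real x + \<i> * of_real y) has_vector_derivative \<i>) (at y)"
      by (auto intro!: derivative_eq_intros)
    then show ?thesis by (simp add: complex_eq[symmetric] Complex_eq)
  qed
  have U: "((\<lambda>y. mollify u \<psi> (Complex x y)) has_vector_derivative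
      - \<i> * mollify u (vderiv \<psi>) (Complex x y) - 2 * \<i> * of_real (y powr \<alpha>) * mollify k \<psi> (Complex x y)) (at y)"
    and K: "((\<lambda>y. mollify k \<psi> (Complex x y)) has_vector_derivative \<i> * mollify k (vderiv \<psi>) (Complex x y)) (at y)"
    if \<psi>: "unit_bump \<psi>" and y: "y > 0" for \<psi> y
  proof -
    have cp: "continuous_on UNIV \<psi>" using unit_bump_continuous_on[OF \<psi>] .
    have s: "has_wirtinger (mollify u \<psi>) (mollify p \<psi>) (\<lambda>z. of_real (Im z powr \<alpha>) * mollify k \<psi> z) uhp" 
      "has_wirtinger (mollify k \<psi>) (\<lambda>_. 0) (mollify k' \<psi>) uhp"
      using alpha_system_mollify[OF a cp] by (auto simp: alpha_system_def)
    have z: "Complex x y \<in> uhp" using y by simp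
    have "mollify (\<lambda>z. of_real (Im z powr \<alpha>) * k z) \<psi> (Complex x y) = of_real (y powr \<alpha>) * mollify k \<psi> (Complex x y)"
      by (simp add: mollify_Im_powr_mult)
    then have e1: "mollify p \<psi> (Complex x y) =
        - mollify u (vderiv \<psi>) (Complex x y) - of_real (y powr \<alpha>) * mollify k \<psi> (Complex x y)"
      using mollify_by_parts[OF w(1) \<psi> z] by (simp add: eq_diff_eq)
    show "((\<lambda>y. mollify u \<psi> (Complex x y)) has_vector_derivative
      - \<i> * mollify u (vderiv \<psi>) (Complex x y) - 2 * \<i> * of_real (y powr \<alpha>) * mollify k \<psi> (Complex x y)) (at y)"
      using has_wirtinger_curve[OF s(1) line, of y] z by (simp add: e1 algebra_simps)
    have "mollify k' \<psi> (Complex x y) = - mollify k (vderiv \<psi>) (Complex x y)"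
      using mollify_by_parts[OF w(2) \<psi> z] by (simp add: mollify_def)
    then show "((\<lambda>y. mollify k \<psi> (Complex x y)) has_vector_derivative \<i> * mollify k (vderiv \<psi>) (Complex x y)) (at y)"
      using has_wirtinger_curve[OF s(2) line, of y] z by (simp add: algebra_simps)
  qed
  \<comment> \<open>This is y^(-\<alpha>) times the y-derivative found in \<open>U\<close>. When it
    is differentiated, the two terms with \<open>mollify k (vderiv \<phi>)\<close> cancel.\<close>
  define G where "G = (\<lambda>y. - 2 * \<i> * mollify k \<phi> (Complex x y) 
      - \<i> * (of_real (y powr (- \<alpha>)) * mollify u (vderiv \<phi>) (Complex x y)))"
  show ?thesis
  proof
    fix y :: real assume y: "y > 0"
    have pp: "complex_of_real (y powr \<alpha>) * complex_of_real (y powr (-\<alpha>)) = 1"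
      using y by (simp flip: of_real_mult powr_add)
    have "of_real (y powr \<alpha>) * G y = - 2 * \<i> * of_real (y powr \<alpha>) * mollify k \<phi> (Complex x y) 
       - \<i> * ((complex_of_real (y powr \<alpha>) * complex_of_real (y powr (-\<alpha>))) * mollify u (vderiv \<phi>) (Complex x y))"
      by (simp add: G_def algebra_simps)
    also have "\<dots> = - \<i> * mollify u (vderiv \<phi>) (Complex x y) - 2 * \<i> * of_real (y powr \<alpha>) * mollify k \<phi> (Complex x y)"
      by (simp add: pp)
    finally show "((\<lambda>y. mollify u \<phi> (Complex x y)) has_vector_derivative of_real (y powr \<alpha>) * G y) (at y)"
      using U[OF \<phi> y] by simp
    have "((\<lambda>y. y powr (-\<alpha>)) has_real_derivative - \<alpha> * y powr (-\<alpha> - 1)) (at y)"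
      using y by (auto intro!: derivative_eq_intros)
    then have P: "((\<lambda>y. complex_of_real (y powr (-\<alpha>))) has_vector_derivative of_real (- \<alpha> * y powr (-\<alpha> - 1))) (at y)"
      by (intro has_vector_derivative_of_real) (simp add: has_real_derivative_iff_has_vector_derivative)
    have "(G has_vector_derivative
      - 2 * \<i> * (\<i> * mollify k (vderiv \<phi>) (Complex x y)) -
      \<i> * (of_real (y powr (- \<alpha>)) * (- \<i> * mollify u (vderiv (vderiv \<phi>)) (Complex x y) 
           - 2 * \<i> * of_real (y powr \<alpha>) * mollify k (vderiv \<phi>) (Complex x y)) 
         + of_real (- \<alpha> * y powr (-\<alpha> - 1)) * mollify u (vderiv \<phi>) (Complex x y))) (at y)" (is "(_ has_vector_derivative ?D) _")
      unfolding G_def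
      by (intro has_vector_derivative_diff has_vector_derivative_mult_right has_vector_derivative_mult
          P U[OF unit_bump_vderiv[OF \<phi>] y] K[OF \<phi> y])
    moreover have "?D = \<i> * of_real (\<alpha> * y powr (- \<alpha> - 1)) * mollify u (vderiv \<phi>) (Complex x y) 
        - of_real (y powr (- \<alpha>)) * mollify u (vderiv (vderiv \<phi>)) (Complex x y)"
    proof -
      have "?D = 2 * mollify k (vderiv \<phi>) (Complex x y) 
        - 2 * (complex_of_real (y powr \<alpha>) * complex_of_real (y powr (-\<alpha>))) * mollify k (vderiv \<phi>) (Complex x y)
        + \<i> * of_real (\<alpha> * y powr (- \<alpha> - 1)) * mollify u (vderiv \<phi>) (Complex x y) 
        - of_real (y powr (- \<alpha>)) * mollify u (vderiv (vderiv \<phi>)) (Complex x y)"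
        by (simp add: algebra_simps)
      then show ?thesis by (simp add: pp)
    qed
    ultimately show "(G has_vector_derivative
        \<i> * of_real (\<alpha> * y powr (- \<alpha> - 1)) * mollify u (vderiv \<phi>) (Complex x y) 
        - of_real (y powr (- \<alpha>)) * mollify u (vderiv (vderiv \<phi>)) (Complex x y)) (at y)" by simp
  qed
qed

text \<open>The support radius \<open>r\<close> of the bump is taken below the modulus of uniform
  continuity of \<open>f\<close> on \<open>K'\<close>, that is, on \<open>K\<close> enlarged by
  horizontal shifts of length at most 1.\<close>

lemma mollify_approx:
  assumes f: "continuous_on uhp f" and K: "compact K" "K \<subseteq> uhp" and e: "e > 0"
  shows "\<exists>\<phi>. unit_bump \<phi> \<and> (\<forall>z\<in>K. norm (mollify f \<phi> z - f z) \<le> e)"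
proof -
  define K' where "K' = (\<lambda>(z, t). z + complex_of_real t) ` (K \<times> {-1..1})"
  have "compact K'" unfolding K'_def split_beta
    by (intro compact_continuous_image compact_Times K(1) continuous_intros) auto
  moreover have sub: "K' \<subseteq> uhp" using K(2) by (auto simp: K'_def)
  ultimately have "uniformly_continuous_on K' f"
    using f continuous_on_subset compact_uniformly_continuous by blast
  then obtain d where d: "d > 0" "\<And>x y. x \<in> K' \<Longrightarrow> y \<in> K' \<Longrightarrow> dist y x < d \<Longrightarrow> dist (f y) (f x) < e"
    using e unfolding uniformly_continuous_on_def by metis
  define r where "r = min 1 (d/2)"
  have r: "0 < r" "r \<le> 1" "r < d" using d(1) by (auto simp: r_def)
  obtain \<phi> :: "real \<Rightarrow> real" where \<phi>: "unit_bump (\<lambda>t. of_real (\<phi> t))" "\<And>t. \<phi> t \<ge> 0"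
    "\<And>t. \<bar>t\<bar> > r \<Longrightarrow> \<phi> t = 0" "(\<phi> has_integral 1) {-2..2}" "continuous_on UNIV \<phi>"
    using exists_unit_bump[OF r(1,2)] by blast
  have "norm (mollify f (\<lambda>t. of_real (\<phi> t)) z - f z) \<le> e" if z: "z \<in> K" for z
  proof -
    have zu: "z \<in> uhp" using z K(2) by blast
    have 1: "((\<lambda>t. f z * of_real (\<phi> t)) has_integral f z * of_real 1) {-2..2}"
      using has_integral_linear[OF \<phi>(4) bounded_linear_of_real] 
      by (intro has_integral_mult_right) (simp add: o_def)
    have 2: "((\<lambda>t. f (z + of_real t) * of_real (\<phi> t)) has_integral mollify f (\<lambda>t. of_real (\<phi> t)) z) {-2..2}"
      unfolding mollify_def
      by (intro integrable_integral mollify_integrable f zu unit_bump_continuous_on \<phi>(1))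
    have 3: "((\<lambda>t. e * \<phi> t) has_integral e * 1) {-2..2}"
      by (intro has_integral_mult_right \<phi>(4))
    have 4: "norm (f (z + of_real t) * of_real (\<phi> t) - f z * of_real (\<phi> t)) \<le> e * \<phi> t" for t
    proof (cases "\<bar>t\<bar> > r")
      case False
      have "(\<lambda>(z, t). z + complex_of_real t) (z, 0) \<in> K'" unfolding K'_def by (rule imageI) (use z in auto)
      moreover have "(\<lambda>(z, t). z + complex_of_real t) (z, t) \<in> K'" unfolding K'_def by (rule imageI) (use z False r in auto)
      ultimately have "z + of_real t \<in> K'" "z \<in> K'" by simp_all
      then show ?thesis
        using d(2)[of z "z + of_real t"] \<phi>(2)[of t] False r
        by (simp add: norm_mult dist_norm mult_right_mono flip: left_diff_distrib)
    qed (simp add: \<phi>(3))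
    have "norm (mollify f (\<lambda>t. of_real (\<phi> t)) z - f z * of_real 1) \<le> e * 1"
      using has_integral_diff[OF 2 1] 3 4 
      by (metis (no_types, lifting) integral_norm_bound_integral has_integral_integrable integral_unique)
    then show ?thesis by simp
  qed
  with \<phi>(1) show ?thesis by blast
qed

section \<open>Pairing with test functions on horizontal lines\<close>

definition slice_pairing :: "(complex \<Rightarrow> complex) \<Rightarrow> (real \<Rightarrow> complex) \<Rightarrow> real \<Rightarrow> complex" where
  "slice_pairing u \<psi> y = (LINT s|lborel. u (Complex s y) * \<psi> s)"

lemma continuous_on_slice:
  assumes "continuous_on uhp u" "y > 0"
  shows "continuous_on A (\<lambda>s. u (Complex s y))"
  by (rule continuous_on_compose2[OF assms(1)])
     (use assms(2) in \<open>auto simp: Complex_eq intro!: continuous_intros\<close>)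

lemma lborel_integral_eq_integral_support:
  fixes g :: "real \<Rightarrow> complex"
  assumes "continuous_on {a..b} g" "\<And>s. s \<notin> {a..b} \<Longrightarrow> g s = 0"
  shows "(LINT s|lborel. g s) = integral {a..b} g"
proof -
  have "(LINT s|lborel. g s) = (LINT s:{a..b}|lborel. g s)"
    unfolding set_lebesgue_integral_def
    by (rule Bochner_Integration.integral_cong) (use assms(2) in \<open>auto simp: indicator_def\<close>)
  also have "\<dots> = integral {a..b} g"
    by (rule set_borel_integral_eq_integral(2)) (rule borel_integrable_atLeastAtMost'[OF assms(1)])
  finally show ?thesis .
qed

lemma slice_pairing_eq_integral:
  assumes "continuous_on uhp u" "y > 0" "continuous_on UNIV \<psi>" "\<And>s. \<bar>s\<bar> > B \<Longrightarrow> \<psi> s = 0"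
  shows "slice_pairing u \<psi> y = integral {-B..B} (\<lambda>s. u (Complex s y) * \<psi> s)"
  unfolding slice_pairing_def
proof (rule lborel_integral_eq_integral_support)
  show "continuous_on {-B..B} (\<lambda>s. u (Complex s y) * \<psi> s)"
    by (intro continuous_on_mult continuous_on_slice assms continuous_on_subset[OF assms(3)]) auto
  show "u (Complex s y) * \<psi> s = 0" if "s \<notin> {-B..B}" for s
    using that assms(4)[of s] by (cases "s \<ge> 0") auto
qed

lemma mollify_eq_slice_pairing:
  assumes "continuous_on uhp u" "y > 0" "unit_bump \<phi>"
  shows "mollify u \<phi> (Complex x y) = slice_pairing u (\<lambda>s. \<phi> (s - x)) y"
proof -
  have "slice_pairing u (\<lambda>s. \<phi> (s - x)) y = (LINT t|lborel. u (Complex (x + t) y) * \<phi> t)"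
    unfolding slice_pairing_def
    by (subst lborel_integral_real_affine[where c = 1 and t = x]) auto
  also have "\<dots> = integral {-2..2} (\<lambda>t. u (Complex (x + t) y) * \<phi> t)"
  proof (rule lborel_integral_eq_integral_support)
    have "continuous_on {-2..2} (\<lambda>t. u (Complex (x + t) y))"
      by (rule continuous_on_compose2[OF assms(1)])
        (use assms(2) in \<open>auto simp: Complex_eq intro!: continuous_intros\<close>)
    then show "continuous_on {-2..2} (\<lambda>t. u (Complex (x + t) y) * \<phi> t)"
      by (intro continuous_on_mult unit_bump_continuous_on[OF assms(3)])
    show "u (Complex (x + s) y) * \<phi> s = 0" if "s \<notin> {-2..2}" for s
      using that assms(3) by (cases "s \<ge> 0") (auto simp: unit_bump_def)
  qed
  also have "\<dots> = mollify u \<phi> (Complex x y)"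
    by (simp add: mollify_def Complex_eq algebra_simps)
  finally show ?thesis ..
qed

lemma smooth_imp_test_function:
  assumes "smooth_fun \<psi>" "\<And>t. \<bar>t\<bar> > B \<Longrightarrow> \<psi> t = 0"
  shows "test_function \<psi>"
proof -
  have "vderiv = (\<lambda>f t. vector_derivative f (at t))"
    by (auto simp: vderiv_def fun_eq_iff)
  moreover have "bounded {x. \<psi> x \<noteq> 0}"
  proof (rule bounded_subset[of "{-B..B}"])
    show "{x. \<psi> x \<noteq> 0} \<subseteq> {-B..B}"
      using assms(2) by (metis (mono_tags, lifting) abs_le_iff atLeastAtMost_iff linorder_not_less
          mem_Collect_eq minus_le_iff subsetI)
  qed simp
  ultimately show ?thesis
    using assms(1) by (auto simp: test_function_def smooth_fun_def)
qed

lemma smooth_fun_shift: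
  assumes "smooth_fun \<phi>"
  shows "smooth_fun (\<lambda>t. \<phi> (t - x))"
proof (rule smooth_fun_coinduct)
  show "(\<lambda>t. \<phi> (t - x)) \<in> {\<lambda>t. \<eta> (t - x) | \<eta>. smooth_fun \<eta>}" using assms by blast
  fix g assume "g \<in> {\<lambda>t. \<eta> (t - x) | \<eta>. smooth_fun \<eta>}"
  then obtain \<eta> where \<eta>: "smooth_fun \<eta>" "g = (\<lambda>t. \<eta> (t - x))" by blast
  have "(g has_vector_derivative vderiv \<eta> (t - x)) (at t)" for t
  proof -
    have "((\<lambda>t. t - x) has_real_derivative 1) (at t)" by (auto intro!: derivative_eq_intros)
    from vector_diff_chain_at[OF this[unfolded has_real_derivative_iff_has_vector_derivative] smooth_fun_vderiv(1)[OF \<eta>(1)]]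
    show ?thesis by (simp add: \<eta>(2) o_def)
  qed
  then show "\<exists>h\<in>{\<lambda>t. \<eta> (t - x) | \<eta>. smooth_fun \<eta>}. \<forall>t. (g has_vector_derivative h t) (at t)"
    using smooth_fun_vderiv(2)[OF \<eta>(1)] by (intro bexI[of _ "\<lambda>t. vderiv \<eta> (t - x)"]) auto
qed

lemma mollify_tendsto_0_vertical:
  assumes "continuous_on uhp u" "vanishes_in_distributions_at_boundary u" "unit_bump \<phi>"
  shows "((\<lambda>y. mollify u \<phi> (Complex x y)) \<longlongrightarrow> 0) (at_right 0)"
proof -
  have "test_function (\<lambda>s. \<phi> (s - x))"
    by (rule smooth_imp_test_function[where B = "\<bar>x\<bar> + 1"])
      (use assms(3) smooth_fun_shift in \<open>auto simp: unit_bump_def\<close>)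
  then have "((\<lambda>y. slice_pairing u (\<lambda>s. \<phi> (s - x)) y) \<longlongrightarrow> 0) (at_right 0)"
    using assms(2) by (simp add: vanishes_in_distributions_at_boundary_def slice_pairing_def)
  then show ?thesis
    by (rule Lim_transform_eventually)
      (use eventually_at_right_less[of 0] in \<open>eventually_elim, simp add: mollify_eq_slice_pairing assms\<close>)
qed

lemma unit_bump_bounded:
  assumes "unit_bump \<phi>"
  obtains M where "M \<ge> 0" "\<And>t. norm (\<phi> t) \<le> M"
proof -
  have "compact (\<phi> ` {-1..1})"
    by (intro compact_continuous_image unit_bump_continuous_on assms) auto
  then obtain M where M: "\<And>t. t \<in> {-1..1} \<Longrightarrow> norm (\<phi> t) \<le> M"
    using compact_imp_bounded bounded_iff by (metis image_eqI)
  have "norm (\<phi> t) \<le> max M 0" for t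
  proof (cases "\<bar>t\<bar> > 1")
    case True
    then show ?thesis using assms by (simp add: unit_bump_def)
  next
    case False
    then have "norm (\<phi> t) \<le> M" by (intro M) auto
    then show ?thesis by linarith
  qed
  then show ?thesis using that by (meson max.cobounded2)
qed

section \<open>Uniform boundedness\<close>

text \<open>Sokal's proof of the uniform boundedness principle: signs are chosen so that the
  \<open>n\<close>-th partial sum already dominates its last term; the geometric tail cannot undo this.\<close>

lemma exists_signs:
  fixes a :: "nat \<Rightarrow> nat \<Rightarrow> complex"
  shows "\<exists>s :: nat \<Rightarrow> complex. \<forall>n. (s n = 1 \<or> s n = -1) \<and>
     norm ((\<Sum>j<n. s j * a n j) + s n * a n n) \<ge> norm (a n n)"
proof (rule dependent_wellorder_choice[where P = "\<lambda>s n r. (r = 1 \<or> r = -1) \<and>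
     norm ((\<Sum>j<n. s j * a n j) + r * a n n) \<ge> norm (a n n)"])
  fix r :: complex and f g :: "nat \<Rightarrow> complex" and n
  assume "\<And>m. m < n \<Longrightarrow> f m = g m"
  then have "(\<Sum>j<n. f j * a n j) = (\<Sum>j<n. g j * a n j)" by (intro sum.cong) auto
  then show "((r = 1 \<or> r = -1) \<and> norm ((\<Sum>j<n. f j * a n j) + r * a n n) \<ge> norm (a n n)) =
    ((r = 1 \<or> r = -1) \<and> norm ((\<Sum>j<n. g j * a n j) + r * a n n) \<ge> norm (a n n))" by simp
next
  fix n and s :: "nat \<Rightarrow> complex"
  define S where "S = (\<Sum>j<n. s j * a n j)"
  have "2 * norm (a n n) = norm ((S + a n n) - (S - a n n))" by (simp add: norm_mult flip: mult_2)
  also have "\<dots> \<le> norm (S + a n n) + norm (S - a n n)" by (rule norm_triangle_ineq4)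
  finally have "norm (a n n) \<le> norm (S + 1 * a n n) \<or> norm (a n n) \<le> norm (S + (-1) * a n n)" by auto
  then show "\<exists>r. (r = 1 \<or> r = -1) \<and> norm ((\<Sum>j<n. s j * a n j) + r * a n n) \<ge> norm (a n n)"
    unfolding S_def by blast
qed

text \<open>All translates of a bump share one bound, and so do those of its derivative; with
  absolutely summable \<open>c\<close> the differentiated series therefore converges uniformly, and
  the family over all unit bumps is closed under differentiation. The arbitrary centres make this
  the source of the test function in the uniform boundedness argument.\<close>

lemma smooth_fun_series:
  assumes \<phi>: "unit_bump \<phi>" and c: "summable (\<lambda>j. norm (c j))"
  shows "smooth_fun (\<lambda>t. \<Sum>j. c j * \<phi> (t - x j))"
proof (rule smooth_fun_coinduct)
  let ?S = "{\<lambda>t. \<Sum>j. c j * \<eta> (t - x j) | \<eta>. unit_bump \<eta>}"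
  show "(\<lambda>t. \<Sum>j. c j * \<phi> (t - x j)) \<in> ?S" using \<phi> by blast
  fix g assume "g \<in> ?S"
  then obtain \<eta> where \<eta>: "unit_bump \<eta>" and g: "g = (\<lambda>t. \<Sum>j. c j * \<eta> (t - x j))" by blast
  define h where "h = (\<lambda>t. \<Sum>j. c j * vderiv \<eta> (t - x j))"
  have sm: "summable (\<lambda>j. c j * \<zeta> (t - x j))" if "unit_bump \<zeta>" for t \<zeta>
  proof -
    obtain M where "\<And>t. norm (\<zeta> t) \<le> M" using unit_bump_bounded[OF \<open>unit_bump \<zeta>\<close>] by blast
    then show ?thesis
      by (intro summable_comparison_test'[OF summable_mult2[OF c, of M]]) (simp add: norm_mult mult_left_mono)
  qed
  have "(g has_vector_derivative h t) (at t)" for t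
  proof -
    have u: "uniform_limit UNIV (\<lambda>n t. \<Sum>j<n. c j * vderiv \<eta> (t - x j)) h sequentially"
    proof -
      obtain M where "\<And>t. norm (vderiv \<eta> t) \<le> M" using unit_bump_bounded[OF unit_bump_vderiv[OF \<eta>]] by blast
      then show ?thesis unfolding h_def
        by (intro Weierstrass_m_test[OF _ summable_mult2[OF c, of M]]) (simp add: norm_mult mult_left_mono)
    qed
    have "\<exists>g'. \<forall>t\<in>UNIV. (\<lambda>j. c j * \<eta> (t - x j)) sums g' t \<and> (g' has_derivative (\<lambda>d. d *\<^sub>R h t)) (at t within UNIV)"
    proof (rule has_derivative_series[where f' = "\<lambda>j t d. d *\<^sub>R (c j * vderiv \<eta> (t - x j))" and x = 0])
      fix n and t :: real
      have "((\<lambda>t. t - x n) has_real_derivative 1) (at t)" by (auto intro!: derivative_eq_intros)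
      from vector_diff_chain_at[OF this[unfolded has_real_derivative_iff_has_vector_derivative] smooth_fun_vderiv(1), of \<eta>]
      have "((\<lambda>t. \<eta> (t - x n)) has_vector_derivative vderiv \<eta> (t - x n)) (at t)"
        using \<eta> by (simp add: o_def unit_bump_def)
      from has_vector_derivative_mult_right[OF this, of "c n"]
      show "((\<lambda>t. c n * \<eta> (t - x n)) has_derivative (\<lambda>d. d *\<^sub>R (c n * vderiv \<eta> (t - x n)))) (at t within UNIV)"
        by (simp add: has_vector_derivative_def)
    next
      fix e :: real assume "e > 0"
      from uniform_limitD[OF u this]
      show "\<forall>\<^sub>F n in sequentially. \<forall>t\<in>UNIV. \<forall>d. 
        norm ((\<Sum>i<n. d *\<^sub>R (c i * vderiv \<eta> (t - x i))) - d *\<^sub>R h t) \<le> e * norm d"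
      proof eventually_elim
        case (elim n)
        show ?case
        proof (intro ballI allI)
          fix t d :: real
          have "norm ((\<Sum>i<n. d *\<^sub>R (c i * vderiv \<eta> (t - x i))) - d *\<^sub>R h t) =
              \<bar>d\<bar> * norm ((\<Sum>i<n. c i * vderiv \<eta> (t - x i)) - h t)"
            by (simp flip: scaleR_sum_right scaleR_diff_right)
          also have "\<dots> \<le> \<bar>d\<bar> * e"
            using elim[rule_format, of t] by (intro mult_left_mono) (auto simp: dist_norm)
          finally show "norm ((\<Sum>i<n. d *\<^sub>R (c i * vderiv \<eta> (t - x i))) - d *\<^sub>R h t) \<le> e * norm d"
            by (simp add: mult.commute)
        qed
      qed
    next
      show "(\<lambda>j. c j * \<eta> (0 - x j)) sums (\<Sum>j. c j * \<eta> (0 - x j))"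
        by (rule summable_sums) (rule sm[OF \<eta>])
    qed auto
    then obtain g' where g': "\<And>t. (\<lambda>j. c j * \<eta> (t - x j)) sums g' t"
      "\<And>t. (g' has_derivative (\<lambda>d. d *\<^sub>R h t)) (at t)" by auto
    have "g' = g" using g'(1) unfolding g by (auto simp: sums_iff)
    then show ?thesis using g'(2) by (simp add: has_vector_derivative_def)
  qed
  then show "\<exists>h\<in>?S. \<forall>t. (g has_vector_derivative h t) (at t)"
    using unit_bump_vderiv[OF \<eta>] by (intro bexI[of _ h]) (auto simp: h_def)
qed

text \<open>Convergence handles heights near 0, continuity on a compact interval the others.\<close>

lemma slice_pairing_bounded:
  assumes u: "continuous_on uhp u" "vanishes_in_distributions_at_boundary u"
    and \<psi>: "smooth_fun \<psi>" "\<And>t. \<bar>t\<bar> > B \<Longrightarrow> \<psi> t = 0"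
  shows "\<exists>C. \<forall>y. 0 < y \<and> y \<le> 1 \<longrightarrow> norm (slice_pairing u \<psi> y) \<le> C"
proof -
  have "((\<lambda>y. slice_pairing u \<psi> y) \<longlongrightarrow> 0) (at_right 0)"
    using u(2) smooth_imp_test_function[OF \<psi>]
    by (simp add: vanishes_in_distributions_at_boundary_def slice_pairing_def)
  then have "\<forall>\<^sub>F y in at_right 0. dist (slice_pairing u \<psi> y) 0 < 1"
    by (rule tendstoD) simp
  then obtain d where d: "d > 0" "\<And>y. 0 < y \<Longrightarrow> y < d \<Longrightarrow> norm (slice_pairing u \<psi> y) < 1"
    by (auto simp: eventually_at_right_field)
  have c: "continuous_on UNIV \<psi>" by (rule smooth_fun_continuous_on[OF \<psi>(1)])
  have "continuous_on ({d..1} \<times> cbox (-B) B) (\<lambda>(y, s). u (Complex s y) * \<psi> s)"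
    unfolding split_beta
    by (intro continuous_on_mult continuous_on_compose2[OF u(1)] continuous_on_compose2[OF c, of _ snd])
      (use d(1) in \<open>auto simp: Complex_eq intro!: continuous_intros\<close>)
  from integral_continuous_on_param[OF this]
  have "continuous_on {d..1} (\<lambda>y. integral {-B..B} (\<lambda>s. u (Complex s y) * \<psi> s))" by simp
  then have "continuous_on {d..1} (slice_pairing u \<psi>)"
    by (rule continuous_on_eq) (use d(1) c \<psi>(2) in \<open>simp add: slice_pairing_eq_integral[OF u(1), where B = B]\<close>)
  then have "compact (slice_pairing u \<psi> ` {d..1})"
    by (rule compact_continuous_image) auto
  then obtain C where C: "\<And>y. y \<in> {d..1} \<Longrightarrow> norm (slice_pairing u \<psi> y) \<le> C"
    using compact_imp_bounded bounded_iff by (metis image_eqI)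
  have "norm (slice_pairing u \<psi> y) \<le> max C 1" if "0 < y" "y \<le> 1" for y
    using C[of y] d(2)[of y] that by (cases "y < d") (auto simp: max_def)
  then show ?thesis by blast
qed

text \<open>For a single test function the pairings are bounded in y; the issue is uniformity over
  the translates of the bump. If it failed, there would be points x n at heights y n with values of
  size at least 4^n. The series of translates by x j with coefficients 3^(-j), up to sign, is one
  test function whose pairing at height y n has size at least (4/3)^n / 2.\<close>

lemma mollify_bounded_near_boundary:
  assumes u: "continuous_on uhp u" "vanishes_in_distributions_at_boundary u" and \<phi>: "unit_bump \<phi>"
  shows "\<exists>C. \<forall>x y. \<bar>x\<bar> \<le> X \<and> 0 < y \<and> y \<le> 1 \<longrightarrow> norm (mollify u \<phi> (Complex x y)) \<le> C"
proof (rule ccontr)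
  assume contr: "\<not> ?thesis"
  define v where "v = (\<lambda>x y. mollify u \<phi> (Complex x y))"
  have vc: "continuous_on A (\<lambda>x. v x y)" if "y > 0" for A y
    unfolding v_def by (rule continuous_on_slice[OF continuous_on_mollify that])
      (use u \<phi> unit_bump_continuous_on in auto)
  \<comment> \<open>\<open>fst p\<close> is chosen maximal among all admissible x at its height, so
    that at height y n every term of the tail is controlled by the same \<open>V n\<close>.\<close>
  have "\<exists>p. \<bar>fst p\<bar> \<le> X \<and> 0 < snd p \<and> snd p \<le> 1 \<and> norm (v (fst p) (snd p)) \<ge> 4 ^ n \<and>
      (\<forall>x'. \<bar>x'\<bar> \<le> X \<longrightarrow> norm (v x' (snd p)) \<le> norm (v (fst p) (snd p)))" for n :: nat
  proof -
    obtain x0 y where y: "\<bar>x0\<bar> \<le> X" "0 < y" "y \<le> 1" "norm (v x0 y) > 4 ^ n"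
      using contr unfolding v_def by (meson linorder_not_le)
    obtain x where x: "x \<in> {-X..X}" "\<forall>x'\<in>{-X..X}. norm (v x' y) \<le> norm (v x y)"
    proof -
      have "continuous_on {-X..X} (\<lambda>x. norm (v x y))" by (intro continuous_on_norm vc y)
      moreover have "{-X..X} \<noteq> {}" using y(1) by auto
      ultimately show ?thesis
        using continuous_attains_sup[of "{-X..X}" "\<lambda>x. norm (v x y)"] that by blast
    qed
    then have "norm (v x y) \<ge> 4 ^ n" using y by (smt (verit) atLeastAtMost_iff)
    with x y show ?thesis by (intro exI[of _ "(x, y)"]) (auto simp: abs_le_iff)
  qed
  then obtain P where P: "\<And>n::nat. \<bar>fst (P n)\<bar> \<le> X \<and> 0 < snd (P n) \<and> snd (P n) \<le> 1 \<and> norm (v (fst (P n)) (snd (P n))) \<ge> 4 ^ n \<and>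
      (\<forall>x'. \<bar>x'\<bar> \<le> X \<longrightarrow> norm (v x' (snd (P n))) \<le> norm (v (fst (P n)) (snd (P n))))"
    by metis
  define x where "x = (\<lambda>n. fst (P n))"
  define y where "y = (\<lambda>n. snd (P n))"
  define V where "V = (\<lambda>n. norm (v (x n) (y n)))"
  have x: "\<bar>x n\<bar> \<le> X" and y: "0 < y n" "y n \<le> 1" and V: "V n \<ge> 4 ^ n" 
    and Vmax: "norm (v (x m) (y n)) \<le> V n" for n m
    using P unfolding x_def y_def V_def by auto
  obtain s :: "nat \<Rightarrow> complex" where s: "\<And>n. s n = 1 \<or> s n = -1"
    and sn: "\<And>n. norm ((\<Sum>j<n. s j * ((1/3)^j * v (x j) (y n))) + s n * ((1/3)^n * v (x n) (y n))) 
        \<ge> norm ((1/3)^n * v (x n) (y n))"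
    using exists_signs[of "\<lambda>n j. (1/3)^j * v (x j) (y n)"] by blast
  define c where "c = (\<lambda>j. s j * (1/3)^j)"
  have nc: "norm (c j) = (1/3)^j" for j
    using s[of j] by (auto simp: c_def norm_mult norm_power norm_divide)
  have cs: "summable (\<lambda>j. norm (c j))" unfolding nc by (rule summable_geometric) simp
  define \<psi> where "\<psi> = (\<lambda>t. \<Sum>j. c j * \<phi> (t - x j))"
  have \<psi>: "smooth_fun \<psi>" unfolding \<psi>_def by (rule smooth_fun_series[OF \<phi> cs])
  have \<psi>0: "\<psi> t = 0" if "\<bar>t\<bar> > X + 1" for t
  proof -
    have "\<phi> (t - x j) = 0" for j
      using \<phi> x[of j] that by (auto simp: unit_bump_def)
    then show ?thesis by (simp add: \<psi>_def)
  qed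
  have lim: "(\<lambda>n. \<Sum>j<n. c j * v (x j) r) \<longlonglongrightarrow> slice_pairing u \<psi> r" if r: "r > 0" for r
  proof -
    define B where "B = X + 1"
    obtain M where M: "M \<ge> 0" "\<And>t. norm (\<phi> t) \<le> M" using unit_bump_bounded[OF \<phi>] by blast
    have uc: "continuous_on {-B..B} (\<lambda>t. u (Complex t r))" by (rule continuous_on_slice[OF u(1) r])
    then have "compact ((\<lambda>t. u (Complex t r)) ` {-B..B})" by (rule compact_continuous_image) auto
    then obtain U where U: "\<And>t. t \<in> {-B..B} \<Longrightarrow> norm (u (Complex t r)) \<le> U"
      using compact_imp_bounded bounded_iff by (metis image_eqI)
    have pc: "continuous_on A (\<lambda>t. \<phi> (t - x j))" for A j
      by (rule smooth_fun_continuous_on, rule smooth_fun_shift) (use \<phi> unit_bump_def in blast)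
    have p0: "\<phi> (t - x j) = 0" if "\<bar>t\<bar> > B" for t j
      using \<phi> x[of j] that by (auto simp: unit_bump_def B_def)
    have "uniform_limit {-B..B} (\<lambda>n t. \<Sum>j<n. u (Complex t r) * (c j * \<phi> (t - x j))) 
       (\<lambda>t. \<Sum>j. u (Complex t r) * (c j * \<phi> (t - x j))) sequentially"
    proof (rule Weierstrass_m_test)
      show "norm (u (Complex t r) * (c n * \<phi> (t - x n))) \<le> U * (norm (c n) * M)" if "t \<in> {-B..B}" for n t
      proof -
        have "0 \<le> U" using U[OF that] norm_ge_zero order_trans by blast
        then show ?thesis
          unfolding norm_mult using U[OF that] M by (intro mult_mono mult_nonneg_nonneg) auto
      qed
      show "summable (\<lambda>n. U * (norm (c n) * M))" by (intro summable_mult summable_mult2 cs)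
    qed
    then have ul: "uniform_limit {-B..B} (\<lambda>n t. \<Sum>j<n. u (Complex t r) * (c j * \<phi> (t - x j))) 
       (\<lambda>t. u (Complex t r) * \<psi> t) sequentially"
      unfolding \<psi>_def
    proof (rule uniform_limit_cong'[THEN iffD1, rotated -1])
      fix t assume "t \<in> {-B..B}"
      have "summable (\<lambda>j. c j * \<phi> (t - x j))"
        using M by (intro summable_comparison_test'[OF summable_mult2[OF cs, of M]]) (simp add: norm_mult mult_left_mono)
      then show "(\<Sum>j. u (Complex t r) * (c j * \<phi> (t - x j))) = u (Complex t r) * (\<Sum>j. c j * \<phi> (t - x j))"
        by (rule suminf_mult)
    qed auto
    have cont: "continuous_on {-B..B} (\<lambda>t. \<Sum>j<n. u (Complex t r) * (c j * \<phi> (t - x j)))" for n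
      by (intro continuous_intros uc pc)
    obtain I J where IJ: "\<And>n. ((\<lambda>t. \<Sum>j<n. u (Complex t r) * (c j * \<phi> (t - x j))) has_integral I n) {-B..B}"
        "((\<lambda>t. u (Complex t r) * \<psi> t) has_integral J) {-B..B}" "I \<longlonglongrightarrow> J"
      using uniform_limit_integral[OF ul cont] by auto
    have "slice_pairing u \<psi> r = J"
      using IJ(2) slice_pairing_eq_integral[OF u(1) r smooth_fun_continuous_on[OF \<psi>], of B] \<psi>0 
      by (auto simp: B_def integral_unique)
    moreover have "I n = (\<Sum>j<n. c j * v (x j) r)" for n
    proof -
      have "I n = integral {-B..B} (\<lambda>t. \<Sum>j<n. c j * (u (Complex t r) * \<phi> (t - x j)))"
        using IJ(1)[of n] by (simp add: integral_unique mult.left_commute)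
      also have "\<dots> = (\<Sum>j<n. integral {-B..B} (\<lambda>t. c j * (u (Complex t r) * \<phi> (t - x j))))"
        by (intro integral_sum integrable_continuous_interval continuous_intros uc pc) auto
      also have "\<dots> = (\<Sum>j<n. c j * v (x j) r)"
        unfolding v_def using pc p0 
        by (simp add: mollify_eq_slice_pairing[OF u(1) r \<phi>] slice_pairing_eq_integral[OF u(1) r, where B = B])
      finally show ?thesis .
    qed
    then have "I = (\<lambda>n. \<Sum>j<n. c j * v (x j) r)" by (rule ext)
    ultimately show ?thesis using IJ(3) by simp
  qed
  \<comment> \<open>1/2 + (1/2) 3^(-m) equals 1 - (3^(-1) + ... + 3^(-m)): the share of the n-th
    term that remains after m later terms have worked against it.\<close>
  have partial: "norm (\<Sum>j<Suc n + m. c j * v (x j) (y n)) \<ge> (1/3)^n * V n * (1/2 + (1/2) * (1/3)^m)" for n m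
  proof (induction m)
    case 0
    then show ?case using sn[of n] by (simp add: c_def V_def norm_mult norm_power norm_divide mult.assoc)
  next
    case (Suc m)
    have "norm (c (Suc n + m) * v (x (Suc n + m)) (y n)) \<le> (1/3)^(Suc n + m) * V n"
      unfolding norm_mult nc by (intro mult_left_mono Vmax) auto
    then have "norm (\<Sum>j<Suc n + Suc m. c j * v (x j) (y n)) \<ge> 
        norm (\<Sum>j<Suc n + m. c j * v (x j) (y n)) - (1/3)^(Suc n + m) * V n"
      using norm_diff_ineq[of "\<Sum>j<Suc n + m. c j * v (x j) (y n)" "c (Suc n + m) * v (x (Suc n + m)) (y n)"]
      by simp
    moreover have "(1/3)^n * V n * (1/2 + (1/2) * (1/3)^m) - (1/3)^(Suc n + m) * V n = 
        (1/3)^n * V n * (1/2 + (1/2) * (1/3)^Suc m)"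
      by (simp add: power_add algebra_simps)
    ultimately show ?case using Suc by linarith
  qed
  obtain C where C: "\<And>r. 0 < r \<Longrightarrow> r \<le> 1 \<Longrightarrow> norm (slice_pairing u \<psi> r) \<le> C"
    using slice_pairing_bounded[OF u \<psi> \<psi>0] by blast
  have "(4/3)^n / 2 \<le> C" for n
  proof -
    have "(\<lambda>m. \<Sum>j<m + Suc n. c j * v (x j) (y n)) \<longlonglongrightarrow> slice_pairing u \<psi> (y n)"
      by (rule LIMSEQ_ignore_initial_segment) (rule lim[OF y(1)])
    then have "(\<lambda>m. norm (\<Sum>j<m + Suc n. c j * v (x j) (y n))) \<longlonglongrightarrow> norm (slice_pairing u \<psi> (y n))"
      by (rule tendsto_norm)
    moreover have "(1/3)^n * V n * (1/2) \<le> norm (\<Sum>j<m + Suc n. c j * v (x j) (y n))" for m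
    proof -
      have "0 \<le> (1/3)^n * V n" by (simp add: V_def)
      then have "(1/3)^n * V n * (1/2) \<le> (1/3)^n * V n * (1/2 + (1/2) * (1/3)^m)"
        by (intro mult_left_mono) auto
      also have "\<dots> \<le> norm (\<Sum>j<m + Suc n. c j * v (x j) (y n))"
        using partial[of n m] by (simp only: add.commute)
      finally show ?thesis .
    qed
    ultimately have "(1/3)^n * V n * (1/2) \<le> norm (slice_pairing u \<psi> (y n))"
      by (intro LIMSEQ_le_const) auto
    moreover have "(1/3)^n * 4^n \<le> (1/3)^n * V n" using V by (intro mult_left_mono) auto
    ultimately have "(1/3)^n * 4^n / 2 \<le> C" using C[OF y[of n]] by linarith
    then show ?thesis by (simp add: power_divide)
  qed
  moreover obtain n where "(4/3::real)^n > 2 * C" using real_arch_pow[of "4/3" "2 * C"] by auto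
  ultimately show False by (smt (verit) field_sum_of_halves)
qed

section \<open>Growth of mollified solutions\<close>

text \<open>Two integrations improve the bound y^(-q) by one power, or to a constant when q < 1.
  Since \<alpha> + q > 0, integrating g from 1 down gives G = O(y^(-\<alpha>-q)), whence v' =
  O(y^(-q)); q \<noteq> 1 excludes a logarithm. \<open>K\<close> is uniform in the functions and in
  \<open>A\<close>, so that \<open>A\<close> may later depend on x.\<close>

lemma ode_bootstrap:
  fixes \<alpha> q :: real
  assumes \<alpha>: "\<alpha> > -1" and q: "q > 0" "\<alpha> + q > 0" "q \<noteq> 1"
  shows "\<exists>K\<ge>0. \<forall>(v :: real \<Rightarrow> complex) G g A.
    (\<forall>y. 0 < y \<and> y \<le> 2 \<longrightarrow> (v has_vector_derivative of_real (y powr \<alpha>) * G y) (at y) \<and>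
       (G has_vector_derivative g y) (at y) \<and> norm (g y) \<le> A * y powr (- \<alpha> - q - 1) \<and>
       norm (v y) \<le> A * y powr (- q)) \<longrightarrow>
    (\<forall>y. 0 < y \<and> y \<le> 2 \<longrightarrow> norm (v y) \<le> K * A * y powr (- max (q - 1) 0))"
proof -
  define c where "c = (2::real) powr \<bar>\<alpha>\<bar>"
  define b where "b = (2 powr (\<alpha> + 1) - 1) / (\<alpha> + 1)"
  have c: "c \<ge> 1" by (simp add: c_def ge_one_powr_ge_zero)
  have "(2::real) powr (\<alpha> + 1) > 1" using \<alpha> by simp
  then have b: "b > 0" using \<alpha> by (simp add: b_def)
  define K1 where "K1 = (2 + c / (\<alpha> + q)) / b"
  define K2 where "K2 = K1 + 1 / (\<alpha> + q)"
  define K where "K = 2 powr q + K2 / \<bar>q - 1\<bar> + 1"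
  have K1: "K1 \<ge> 0" using b c q by (simp add: K1_def)
  have K2: "K2 \<ge> 0" using K1 q by (simp add: K2_def)
  have K: "K \<ge> 0" using K2 by (simp add: K_def)
  show ?thesis
  proof (intro exI[of _ K] conjI K allI impI)
    fix v G g :: "real \<Rightarrow> complex" and A y :: real
    assume H: "\<forall>y. 0 < y \<and> y \<le> 2 \<longrightarrow> (v has_vector_derivative of_real (y powr \<alpha>) * G y) (at y) \<and>
       (G has_vector_derivative g y) (at y) \<and> norm (g y) \<le> A * y powr (- \<alpha> - q - 1) \<and>
       norm (v y) \<le> A * y powr (- q)" and y: "0 < y \<and> y \<le> 2"
    have v': "\<And>y. 0 < y \<Longrightarrow> y \<le> 2 \<Longrightarrow> (v has_vector_derivative of_real (y powr \<alpha>) * G y) (at y)"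
      and G': "\<And>y. 0 < y \<Longrightarrow> y \<le> 2 \<Longrightarrow> (G has_vector_derivative g y) (at y)"
      and g: "\<And>y. 0 < y \<Longrightarrow> y \<le> 2 \<Longrightarrow> norm (g y) \<le> A * y powr (- \<alpha> - q - 1)"
      and v: "\<And>y. 0 < y \<Longrightarrow> y \<le> 2 \<Longrightarrow> norm (v y) \<le> A * y powr (- q)"
      using H by auto
    have "0 \<le> A * 1 powr (- q)" by (rule order_trans[OF norm_ge_zero v[of 1]]) auto
    then have A: "A \<ge> 0" by simp
    have vc: "continuous_on {r..s} v" and Gc: "continuous_on {r..s} G" if "0 < r" "s \<le> 2" for r s
      by (intro continuous_at_imp_continuous_on ballI has_vector_derivative_continuous[OF v'] 
           has_vector_derivative_continuous[OF G']; use that in auto)+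
    have Gdiff: "norm (G s - G r) \<le> A / (\<alpha> + q) * (r powr (- \<alpha> - q) - s powr (- \<alpha> - q))"
      if rs: "0 < r" "r < s" "s \<le> 2" for r s
    proof -
      have "norm (G s - G r) \<le> (- A / (\<alpha> + q) * s powr (- \<alpha> - q)) - (- A / (\<alpha> + q) * r powr (- \<alpha> - q))"
      proof (rule differentiable_bound_general[OF rs(2) Gc[OF rs(1,3)]])
        show "continuous_on {r..s} (\<lambda>x. - A / (\<alpha> + q) * x powr (- \<alpha> - q))"
          using rs by (intro continuous_intros) auto
        fix x assume x: "r < x" "x < s"
        show "(G has_vector_derivative g x) (at x)" by (rule G') (use x rs in auto)
        have "((\<lambda>x. - A / (\<alpha> + q) * x powr (- \<alpha> - q)) has_real_derivative 
            - A / (\<alpha> + q) * ((- \<alpha> - q) * x powr (- \<alpha> - q - 1))) (at x)"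
          by (intro DERIV_cmult has_real_derivative_powr) (use x rs in auto)
        moreover have "- A / (\<alpha> + q) * ((- \<alpha> - q) * x powr (- \<alpha> - q - 1)) = A * x powr (- \<alpha> - q - 1)"
          using q by (simp add: field_simps)
        ultimately show "((\<lambda>x. - A / (\<alpha> + q) * x powr (- \<alpha> - q)) has_vector_derivative A * x powr (- \<alpha> - q - 1)) (at x)"
          by (simp add: has_real_derivative_iff_has_vector_derivative)
        show "norm (g x) \<le> A * x powr (- \<alpha> - q - 1)" by (rule g) (use x rs in auto)
      qed
      then show ?thesis by (simp add: algebra_simps)
    qed
    \<comment> \<open>Nothing is assumed about the size of \<open>G\<close>, so \<open>G 1\<close>
      is recovered from v: the difference v 2 - v 1 is \<open>G 1\<close> times b, the integral of
      s^\<alpha> over [1,2], up to an error controlled by \<open>Gdiff\<close>. This is why the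
      range reaches up to 2.\<close>
    have G1: "norm (G 1) \<le> A * K1"
    proof -
      define w where "w = (\<lambda>s. v s - G 1 * of_real (s powr (\<alpha> + 1) / (\<alpha> + 1)))"
      have "norm (w 2 - w 1) \<le> A * c / (\<alpha> + q) * 2 - A * c / (\<alpha> + q) * 1"
      proof (rule differentiable_bound_general[where f' = "\<lambda>s. of_real (s powr \<alpha>) * (G s - G 1)" and \<phi>' = "\<lambda>_. A * c / (\<alpha> + q)"])
        show "continuous_on {1..2} w" unfolding w_def
          by (intro continuous_intros vc) (use \<alpha> in auto)
        show "continuous_on {1..2} ((*) (A * c / (\<alpha> + q)))" by (intro continuous_intros)
        fix s :: real assume s: "1 < s" "s < 2"
        have "((\<lambda>s. s powr (\<alpha> + 1) / (\<alpha> + 1)) has_real_derivative s powr \<alpha>) (at s)"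
          using DERIV_cdivide[OF has_real_derivative_powr[of s "\<alpha> + 1"], of "\<alpha> + 1"] s \<alpha> by simp
        then have "((\<lambda>s. complex_of_real (s powr (\<alpha> + 1) / (\<alpha> + 1))) has_vector_derivative of_real (s powr \<alpha>)) (at s)"
          by (rule has_vector_derivative_of_real)
        from has_vector_derivative_diff[OF v' has_vector_derivative_mult_right[OF this, of "G 1"]]
        show "(w has_vector_derivative of_real (s powr \<alpha>) * (G s - G 1)) (at s)"
          using s by (simp add: w_def algebra_simps)
        show "((*) (A * c / (\<alpha> + q)) has_vector_derivative A * c / (\<alpha> + q)) (at s)"
          using DERIV_cmult_Id has_real_derivative_iff_has_vector_derivative by blast
        have 1: "s powr \<alpha> \<le> c"
        proof -
          have "s powr \<alpha> \<le> s powr \<bar>\<alpha>\<bar>" using s by (intro powr_mono) auto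
          also have "\<dots> \<le> c" unfolding c_def using s by (intro powr_mono2) auto
          finally show ?thesis .
        qed
        have "norm (G s - G 1) \<le> A / (\<alpha> + q) * (1 - s powr (- \<alpha> - q))" using Gdiff[of 1 s] s by simp
        also have "\<dots> \<le> A / (\<alpha> + q) * 1" using A q by (intro mult_left_mono) auto
        finally have "s powr \<alpha> * norm (G s - G 1) \<le> c * (A / (\<alpha> + q))"
          using 1 c by (intro mult_mono) auto
        then show "norm (of_real (s powr \<alpha>) * (G s - G 1)) \<le> A * c / (\<alpha> + q)"
          by (simp add: norm_mult mult.commute)
      qed simp
      moreover have "w 2 - w 1 = (v 2 - v 1) - G 1 * of_real b"
        by (simp add: w_def b_def diff_divide_distrib algebra_simps)
      ultimately have "norm ((v 2 - v 1) - G 1 * of_real b) \<le> A * c / (\<alpha> + q)" by simp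
      moreover have "norm (G 1 * of_real b) \<le> norm (v 2 - v 1) + norm ((v 2 - v 1) - G 1 * of_real b)"
        by (metis add_diff_cancel_left' diff_add_cancel norm_triangle_ineq4)
      moreover have "norm (v 2 - v 1) \<le> A + A"
      proof -
        have "2 powr (- q) \<le> (1::real)" using q by (simp add: powr_minus_divide ge_one_powr_ge_zero)
        then have "A * 2 powr (-q) \<le> A * 1" using A by (intro mult_left_mono)
        then show ?thesis
          using v[of 1] v[of 2] norm_triangle_ineq4[of "v 2" "v 1"] by simp
      qed
      ultimately have "norm (G 1) * b \<le> A * (2 + c / (\<alpha> + q))"
        using b by (simp add: norm_mult algebra_simps)
      then show ?thesis using b by (simp add: K1_def pos_le_divide_eq)
    qed
    have max0: "y powr (- max (q - 1) 0) \<ge> 1" if "y \<le> 1"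
      using y that by (simp add: powr_minus_divide powr_le1)
    show "norm (v y) \<le> K * A * y powr (- max (q - 1) 0)"
    proof (cases "y < 1")
      case False
      have "norm (v y) \<le> A * y powr (- q)" by (rule v) (use y in auto)
      also have "\<dots> \<le> A * (2 powr q * y powr (- max (q - 1) 0))"
      proof (intro mult_left_mono A)
        have "y powr (max (q - 1) 0) \<le> 2 powr (max (q - 1) 0)" using y by (intro powr_mono2) auto
        also have "\<dots> \<le> 2 powr q" using q by (intro powr_mono) auto
        finally have "1 \<le> 2 powr q * y powr (- max (q - 1) 0)"
          using y by (simp add: powr_minus_divide pos_le_divide_eq)
        moreover have "y powr (- q) \<le> 1" using False q by (simp add: powr_minus_divide ge_one_powr_ge_zero)
        ultimately show "y powr - q \<le> 2 powr q * y powr - max (q - 1) 0" by linarith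
      qed
      also have "\<dots> = 2 powr q * A * y powr (- max (q - 1) 0)" by simp
      also have "\<dots> \<le> K * A * y powr (- max (q - 1) 0)"
        using A K2 by (intro mult_right_mono) (auto simp: K_def)
      finally show ?thesis .
    next
      case True
      have G: "norm (G s) \<le> A * K2 * s powr (- \<alpha> - q)" if s: "0 < s" "s < 1" for s
      proof -
        have s1: "s powr (- \<alpha> - q) \<ge> 1"
          using s q powr_mono'[of "- \<alpha> - q" 0 s] by simp
        have "norm (G s) \<le> norm (G 1) + norm (G 1 - G s)"
          by (metis norm_minus_commute norm_triangle_sub)
        also have "\<dots> \<le> A * K1 * 1 + A / (\<alpha> + q) * (s powr (- \<alpha> - q))"
        proof -
          have "A / (\<alpha> + q) * (s powr (- \<alpha> - q) - 1) \<le> A / (\<alpha> + q) * s powr (- \<alpha> - q)"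
            using A q by (intro mult_left_mono) auto
          then show ?thesis using G1 Gdiff[of s 1] s by simp
        qed
        also have "\<dots> \<le> A * K1 * s powr (- \<alpha> - q) + A / (\<alpha> + q) * (s powr (- \<alpha> - q))"
          using A K1 s1 by (intro add_right_mono mult_left_mono) auto
        finally show ?thesis by (simp add: K2_def algebra_simps)
      qed
      define \<Phi> where "\<Phi> = (\<lambda>s. A * K2 / (1 - q) * s powr (1 - q))"
      have "norm (v 1 - v y) \<le> \<Phi> 1 - \<Phi> y"
      proof (rule differentiable_bound_general[OF True])
        show "continuous_on {y..1} v" by (rule vc) (use y in auto)
        show "continuous_on {y..1} \<Phi>" unfolding \<Phi>_def using y by (intro continuous_intros) auto
        fix s assume s: "y < s" "s < 1"
        show "(v has_vector_derivative of_real (s powr \<alpha>) * G s) (at s)" by (rule v') (use s y in auto)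
        have "(\<Phi> has_real_derivative A * K2 / (1 - q) * ((1 - q) * s powr (1 - q - 1))) (at s)"
          unfolding \<Phi>_def by (intro DERIV_cmult has_real_derivative_powr) (use s y in auto)
        then show "(\<Phi> has_vector_derivative A * K2 * s powr (- q)) (at s)"
          using q by (simp add: has_real_derivative_iff_has_vector_derivative mult.assoc)
        have "norm (of_real (s powr \<alpha>) * G s) \<le> s powr \<alpha> * (A * K2 * s powr (- \<alpha> - q))"
          using G[of s] s y by (simp add: norm_mult mult_left_mono)
        also have "\<dots> = A * K2 * (s powr \<alpha> * s powr (- \<alpha> - q))" by simp
        also have "\<dots> = A * K2 * s powr (- q)" by (simp flip: powr_add)
        finally show "norm (of_real (s powr \<alpha>) * G s) \<le> A * K2 * s powr (- q)" .
      qed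
      also have "\<Phi> 1 - \<Phi> y \<le> A * K2 / \<bar>q - 1\<bar> * y powr (- max (q - 1) 0)"
      proof (cases "q < 1")
        case True
        then show ?thesis using A K2 y by (simp add: \<Phi>_def max_def abs_if)
      next
        case False
        then have "q > 1" using q by simp
        define E where "E = A * K2 / (q - 1)"
        have E: "E \<ge> 0" "A * K2 / (1 - q) = - E"
          using A K2 \<open>q > 1\<close> unfolding E_def by (auto, metis minus_diff_eq minus_divide_right)
        show ?thesis using E \<open>q > 1\<close> unfolding \<Phi>_def E(2) E_def[symmetric] by (simp flip: E_def)
      qed
      finally have "norm (v 1 - v y) \<le> A * K2 / \<bar>q - 1\<bar> * y powr (- max (q - 1) 0)" .
      moreover have "norm (v 1) \<le> A" using v[of 1] by simp
      moreover have "norm (v y) \<le> norm (v 1) + norm (v 1 - v y)"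
        by (metis norm_minus_commute norm_triangle_sub)
      moreover have "A \<le> A * y powr (- max (q - 1) 0)"
        using mult_left_mono[OF max0[OF less_imp_le[OF True]] A] by simp
      moreover have "0 \<le> A * 2 powr q * y powr (- max (q - 1) 0)" using A by simp
      moreover have "K * A * y powr (- max (q - 1) 0) = A * K2 / \<bar>q - 1\<bar> * y powr (- max (q - 1) 0)
         + A * y powr (- max (q - 1) 0) + A * 2 powr q * y powr (- max (q - 1) 0)"
        by (simp add: K_def algebra_simps)
      ultimately show ?thesis by linarith
    qed
  qed
qed

text \<open>Rounding the exponent up is harmless, because |z|^2 / Im z \<ge> 1 once |z| \<ge>
  1.\<close>

lemma temperate_growth_nat:
  assumes "temperate_growth_at_infinity u"
  obtains C R :: real and n :: nat where "C \<ge> 0" "R \<ge> 1"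
    "\<And>z. z \<in> uhp \<Longrightarrow> cmod z \<ge> R \<Longrightarrow> cmod (u z) \<le> C * ((cmod z)\<^sup>2 / Im z) ^ n"
proof -
  obtain C R N :: real where c: "C > 0" "R > 0" "N > 0"
    and g: "\<And>z. z \<in> uhp \<Longrightarrow> cmod z > R \<Longrightarrow> cmod (u z) \<le> C * ((cmod z)\<^sup>2 / Im z) powr N"
    using assms unfolding temperate_growth_at_infinity_def by blast
  define n where "n = nat \<lceil>N\<rceil>"
  have n: "N \<le> real n" unfolding n_def by linarith
  have "cmod (u z) \<le> C * ((cmod z)\<^sup>2 / Im z) ^ n" if z: "z \<in> uhp" "cmod z \<ge> R + 1" for z
  proof -
    have y: "0 < Im z" "Im z \<le> cmod z" using z abs_Im_le_cmod[of z] by auto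
    then have "1 * Im z \<le> cmod z * cmod z" using z c by (intro mult_mono) auto
    then have one: "(cmod z)\<^sup>2 / Im z \<ge> 1" using y by (simp add: power2_eq_square)
    then have "((cmod z)\<^sup>2 / Im z) powr N \<le> ((cmod z)\<^sup>2 / Im z) powr (real n)"
      using n by (intro powr_mono) auto
    also have "\<dots> = ((cmod z)\<^sup>2 / Im z) ^ n" using one by (intro powr_realpow) linarith
    finally show ?thesis using g[of z] z c by (smt (verit) mult_left_mono)
  qed
  then show ?thesis using c that[of C "R + 1" n] by auto
qed

lemma mollify_norm_le:
  assumes "continuous_on uhp u" "continuous_on UNIV \<phi>" "z \<in> uhp"
    and "\<And>t. norm (\<phi> t) \<le> M" "\<And>t. \<bar>t\<bar> \<le> 2 \<Longrightarrow> norm (u (z + of_real t)) \<le> U"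
  shows "norm (mollify u \<phi> z) \<le> 4 * U * M"
proof -
  have "norm (mollify u \<phi> z) \<le> U * M * (2 - (-2))"
    unfolding mollify_def
  proof (rule integral_bound)
    show "continuous_on {-2..2} (\<lambda>t. u (z + of_real t) * \<phi> t)"
      by (intro continuous_on_mult continuous_on_subset[OF assms(2)] continuous_on_compose2[OF assms(1)] continuous_intros)
        (use assms(3) in auto)
    have "0 \<le> U" by (rule order_trans[OF norm_ge_zero assms(5)[of 0]]) simp
    then show "norm (u (z + of_real t) * \<phi> t) \<le> U * M" if "t \<in> {-2..2}" for t
      using assms(4,5) that by (auto simp: norm_mult abs_le_iff intro!: mult_mono)
  qed simp
  then show ?thesis by simp
qed

text \<open>Temperate growth gives a bound by y^(-n), and \<open>ode_bootstrap\<close> removes the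
  singularity one power at a time. The statement \<open>Q q\<close> ranges over all unit bumps,
  since a step for one bump uses the previous bound for its first two derivatives.\<close>

lemma mollify_bound_far:
  assumes a: "alpha_system \<alpha> u p k k'" and \<alpha>: "\<alpha> > -1"
    and g: "\<And>z. z \<in> uhp \<Longrightarrow> cmod z \<ge> R \<Longrightarrow> cmod (u z) \<le> C * ((cmod z)\<^sup>2 / Im z) ^ n"
    and C: "C \<ge> 0" and \<phi>: "unit_bump \<phi>"
  shows "\<exists>K\<ge>0. \<forall>x y. \<bar>x\<bar> \<ge> R + 2 \<and> 0 < y \<and> y \<le> 2 \<longrightarrow>
           norm (mollify u \<phi> (Complex x y)) \<le> K * (1 + \<bar>x\<bar>) ^ (2 * n)"
proof -
  define Q where "Q = (\<lambda>q. \<forall>\<phi>. unit_bump \<phi> \<longrightarrow> (\<exists>K\<ge>0. \<forall>x y. \<bar>x\<bar> \<ge> R + 2 \<and> 0 < y \<and> y \<le> 2 \<longrightarrow>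
           norm (mollify u \<phi> (Complex x y)) \<le> K * (1 + \<bar>x\<bar>) ^ (2 * n) * y powr (- q)))"
  have uc: "continuous_on uhp u"
    using a has_wirtinger_continuous_on unfolding alpha_system_def by blast
  have start: "\<exists>K\<ge>0. \<forall>x y. \<bar>x\<bar> \<ge> R + 2 \<and> 0 < y \<and> y \<le> 2 \<longrightarrow>
           norm (mollify u \<phi> (Complex x y)) \<le> K * (1 + \<bar>x\<bar>) ^ (2 * n) / y ^ n" if \<phi>: "unit_bump \<phi>" for \<phi>
  proof -
    obtain M where M: "M \<ge> 0" "\<And>t. norm (\<phi> t) \<le> M" using unit_bump_bounded[OF \<phi>] by blast
    show ?thesis
    proof (intro exI[of _ "4 * (C * 16 ^ n) * M"] conjI allI impI)
      show "0 \<le> 4 * (C * 16 ^ n) * M" using C M by simp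
      fix x y :: real assume xy: "R + 2 \<le> \<bar>x\<bar> \<and> 0 < y \<and> y \<le> 2"
      have "norm (u (Complex x y + of_real t)) \<le> C * 16 ^ n * (1 + \<bar>x\<bar>) ^ (2 * n) / y ^ n" if t: "\<bar>t\<bar> \<le> 2" for t
      proof -
        define z where "z = Complex x y + of_real t"
        have z: "Im z = y" "Re z = x + t" by (auto simp: z_def)
        have 1: "cmod z \<ge> R" using abs_Re_le_cmod[of z] xy t z by linarith
        have "cmod z \<le> \<bar>x + t\<bar> + \<bar>y\<bar>" using cmod_le[of z] z by simp
        also have "\<dots> \<le> \<bar>x\<bar> + 4" using xy t by linarith
        also have "\<dots> \<le> 4 * (1 + \<bar>x\<bar>)" by simp
        finally have "cmod z \<le> 4 * (1 + \<bar>x\<bar>)" .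
        then have "(cmod z)^2 \<le> (4 * (1 + \<bar>x\<bar>))^2" by (intro power_mono) auto
        also have "\<dots> = 16 * (1 + \<bar>x\<bar>)^2" by (simp only: power_mult_distrib) simp
        finally have "(cmod z)^2 \<le> 16 * (1 + \<bar>x\<bar>)^2" .
        then have "(cmod z)^2 / y \<le> 16 * (1 + \<bar>x\<bar>)^2 / y" 
          using xy by (intro divide_right_mono) auto
        then have "((cmod z)^2 / y)^n \<le> (16 * (1 + \<bar>x\<bar>)^2 / y)^n"
          using xy by (intro power_mono) auto
        also have "\<dots> = 16 ^ n * (1 + \<bar>x\<bar>) ^ (2 * n) / y ^ n"
          by (simp add: power_divide power_mult_distrib power_mult)
        finally have "C * ((cmod z)^2 / y)^n \<le> C * (16 ^ n * (1 + \<bar>x\<bar>) ^ (2 * n) / y ^ n)"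
          using C by (rule mult_left_mono)
        then show ?thesis using g[of z] 1 z xy by (simp flip: z_def)
      qed
      from mollify_norm_le[OF uc unit_bump_continuous_on[OF \<phi>] _ M(2) this]
      show "norm (mollify u \<phi> (Complex x y)) \<le> 4 * (C * 16 ^ n) * M * (1 + \<bar>x\<bar>) ^ (2 * n) / y ^ n"
        using xy by (simp add: mult_ac)
    qed
  qed
  have step: "Q (max (q - 1) 0)" if Q: "Q q" and q: "q > 0" "\<alpha> + q > 0" "q \<noteq> 1" for q
    unfolding Q_def
  proof (intro allI impI)
    fix \<phi> assume \<phi>: "unit_bump \<phi>"
    obtain K0 where K0: "K0 \<ge> 0" "\<And>x y. \<bar>x\<bar> \<ge> R + 2 \<Longrightarrow> 0 < y \<Longrightarrow> y \<le> 2 \<Longrightarrow>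
           norm (mollify u \<phi> (Complex x y)) \<le> K0 * (1 + \<bar>x\<bar>) ^ (2 * n) * y powr (- q)"
      using Q \<phi> unfolding Q_def by meson
    obtain K1 where K1: "K1 \<ge> 0" "\<And>x y. \<bar>x\<bar> \<ge> R + 2 \<Longrightarrow> 0 < y \<Longrightarrow> y \<le> 2 \<Longrightarrow>
           norm (mollify u (vderiv \<phi>) (Complex x y)) \<le> K1 * (1 + \<bar>x\<bar>) ^ (2 * n) * y powr (- q)"
      using Q unit_bump_vderiv[OF \<phi>] unfolding Q_def by meson
    obtain K2 where K2: "K2 \<ge> 0" "\<And>x y. \<bar>x\<bar> \<ge> R + 2 \<Longrightarrow> 0 < y \<Longrightarrow> y \<le> 2 \<Longrightarrow>
           norm (mollify u (vderiv (vderiv \<phi>)) (Complex x y)) \<le> K2 * (1 + \<bar>x\<bar>) ^ (2 * n) * y powr (- q)"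
      using Q unit_bump_vderiv[OF unit_bump_vderiv[OF \<phi>]] unfolding Q_def by meson
    obtain B where B: "B \<ge> 0" "\<And>(v :: real \<Rightarrow> complex) G g A.
      (\<forall>y. 0 < y \<and> y \<le> 2 \<longrightarrow> (v has_vector_derivative of_real (y powr \<alpha>) * G y) (at y) \<and>
         (G has_vector_derivative g y) (at y) \<and> norm (g y) \<le> A * y powr (- \<alpha> - q - 1) \<and>
         norm (v y) \<le> A * y powr (- q)) \<Longrightarrow>
      (\<forall>y. 0 < y \<and> y \<le> 2 \<longrightarrow> norm (v y) \<le> B * A * y powr (- max (q - 1) 0))"
      using ode_bootstrap[OF \<alpha> q] by metis
    \<comment> \<open>\<open>K0\<close> bounds the mollification itself. The equation for G
      contributes |\<alpha>| \<open>K1\<close> and, because y^(-\<alpha>) \<le> 2 y^(-\<alpha>-1)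
      for y \<le> 2, also 2 \<open>K2\<close>.\<close>
    define L where "L = K0 + \<bar>\<alpha>\<bar> * K1 + 2 * K2"
    show "\<exists>K\<ge>0. \<forall>x y. \<bar>x\<bar> \<ge> R + 2 \<and> 0 < y \<and> y \<le> 2 \<longrightarrow>
           norm (mollify u \<phi> (Complex x y)) \<le> K * (1 + \<bar>x\<bar>) ^ (2 * n) * y powr (- max (q - 1) 0)"
    proof (intro exI[of _ "B * L"] conjI allI impI)
      show "0 \<le> B * L" using B K0 K1 K2 by (simp add: L_def)
      fix x y :: real assume xy: "R + 2 \<le> \<bar>x\<bar> \<and> 0 < y \<and> y \<le> 2"
      define D where "D = (1 + \<bar>x\<bar>) ^ (2 * n)"
      have D: "D \<ge> 0" by (simp add: D_def)
      obtain G where G: "\<And>y. y > 0 \<Longrightarrow> ((\<lambda>y. mollify u \<phi> (Complex x y)) has_vector_derivative of_real (y powr \<alpha>) * G y) (at y)"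
        "\<And>y. y > 0 \<Longrightarrow> (G has_vector_derivative
            \<i> * of_real (\<alpha> * y powr (- \<alpha> - 1)) * mollify u (vderiv \<phi>) (Complex x y) 
            - of_real (y powr (- \<alpha>)) * mollify u (vderiv (vderiv \<phi>)) (Complex x y)) (at y)"
        using alpha_system_mollify_ode[OF a \<phi>, of x] by blast
      have "\<forall>y. 0 < y \<and> y \<le> 2 \<longrightarrow> norm (mollify u \<phi> (Complex x y)) \<le> B * (L * D) * y powr (- max (q - 1) 0)"
      proof (rule B(2), intro allI impI conjI)
        fix s :: real assume s: "0 < s \<and> s \<le> 2"
        show "((\<lambda>y. mollify u \<phi> (Complex x y)) has_vector_derivative of_real (s powr \<alpha>) * G s) (at s)"
          using G(1) s by blast
        show "(G has_vector_derivative
            \<i> * of_real (\<alpha> * s powr (- \<alpha> - 1)) * mollify u (vderiv \<phi>) (Complex x s) 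
            - of_real (s powr (- \<alpha>)) * mollify u (vderiv (vderiv \<phi>)) (Complex x s)) (at s)"
          using G(2) s by blast
        have e1: "s powr (- \<alpha> - 1) * s powr (- q) = s powr (- \<alpha> - q - 1)"
          by (simp add: algebra_simps flip: powr_add)
        have "s powr (- \<alpha>) = s * s powr (- \<alpha> - 1)"
          using s powr_mult_base[of s "- \<alpha> - 1"] by simp
        then have e2: "s powr (- \<alpha>) \<le> 2 * s powr (- \<alpha> - 1)" using s by (simp add: mult_right_mono)
        have "norm (\<i> * of_real (\<alpha> * s powr (- \<alpha> - 1)) * mollify u (vderiv \<phi>) (Complex x s) 
            - of_real (s powr (- \<alpha>)) * mollify u (vderiv (vderiv \<phi>)) (Complex x s))
          \<le> \<bar>\<alpha>\<bar> * s powr (- \<alpha> - 1) * norm (mollify u (vderiv \<phi>) (Complex x s))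
            + s powr (- \<alpha>) * norm (mollify u (vderiv (vderiv \<phi>)) (Complex x s))"
          by (rule order_trans[OF norm_triangle_ineq4]) (simp add: norm_mult abs_mult)
        also have "\<dots> \<le> \<bar>\<alpha>\<bar> * s powr (- \<alpha> - 1) * (K1 * D * s powr (- q)) + (2 * s powr (- \<alpha> - 1)) * (K2 * D * s powr (- q))"
          using K1 K2 xy s e2 unfolding D_def by (intro add_mono mult_mono mult_left_mono) auto
        also have "\<dots> = (\<bar>\<alpha>\<bar> * K1 + 2 * K2) * D * (s powr (- \<alpha> - 1) * s powr (- q))"
          by (simp add: algebra_simps)
        also have "\<dots> \<le> L * D * (s powr (- \<alpha> - 1) * s powr (- q))"
          using K0 D by (intro mult_right_mono) (auto simp: L_def)
        finally show "norm (\<i> * of_real (\<alpha> * s powr (- \<alpha> - 1)) * mollify u (vderiv \<phi>) (Complex x s) 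
            - of_real (s powr (- \<alpha>)) * mollify u (vderiv (vderiv \<phi>)) (Complex x s))
          \<le> L * D * s powr (- \<alpha> - q - 1)" unfolding e1 .
        have "norm (mollify u \<phi> (Complex x s)) \<le> K0 * D * s powr (- q)"
          using K0 xy s by (auto simp: D_def)
        also have "\<dots> \<le> L * D * s powr (- q)"
          using K1 K2 D by (intro mult_right_mono) (auto simp: L_def)
        finally show "norm (mollify u \<phi> (Complex x s)) \<le> L * D * s powr (- q)" .
      qed
      then show "norm (mollify u \<phi> (Complex x y)) \<le> B * L * (1 + \<bar>x\<bar>) ^ (2 * n) * y powr (- max (q - 1) 0)"
        using xy by (simp add: D_def mult.assoc)
    qed
  qed
  \<comment> \<open>The midpoint of max 0 (-\<alpha>) and 1. Along n + \<delta>, ..., 1 + \<delta>,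
    \<delta> the exponent never equals 1 and its sum with \<alpha> stays positive, as
    \<open>ode_bootstrap\<close> demands; the last step lands on 0.\<close>
  define \<delta> where "\<delta> = (max 0 (- \<alpha>) + 1) / 2"
  have \<delta>: "0 < \<delta>" "\<delta> < 1" "\<alpha> + \<delta> > 0" using \<alpha> by (auto simp: \<delta>_def max_def field_simps)
  have down: "Q (real m + \<delta>) \<Longrightarrow> Q 0" for m
  proof (induction m)
    case 0
    then show ?case using step[of \<delta>] \<delta> by simp
  next
    case (Suc m)
    have "Q (max (real (Suc m) + \<delta> - 1) 0)" by (rule step[OF Suc.prems]) (use \<delta> in auto)
    moreover have "max (real (Suc m) + \<delta> - 1) 0 = real m + \<delta>" using \<delta> by simp
    ultimately show ?case using Suc.IH by simp
  qed
  have "Q (real n + \<delta>)"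
    unfolding Q_def
  proof (intro allI impI)
    fix \<phi> assume "unit_bump \<phi>"
    from start[OF this] obtain K where K: "K \<ge> 0" "\<And>x y. \<bar>x\<bar> \<ge> R + 2 \<Longrightarrow> 0 < y \<Longrightarrow> y \<le> 2 \<Longrightarrow>
           norm (mollify u \<phi> (Complex x y)) \<le> K * (1 + \<bar>x\<bar>) ^ (2 * n) / y ^ n" by meson
    show "\<exists>K\<ge>0. \<forall>x y. \<bar>x\<bar> \<ge> R + 2 \<and> 0 < y \<and> y \<le> 2 \<longrightarrow>
           norm (mollify u \<phi> (Complex x y)) \<le> K * (1 + \<bar>x\<bar>) ^ (2 * n) * y powr (- (real n + \<delta>))"
    proof (intro exI[of _ "K * 2 powr \<delta>"] conjI allI impI)
      show "0 \<le> K * 2 powr \<delta>" using K by simp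
      fix x y :: real assume xy: "R + 2 \<le> \<bar>x\<bar> \<and> 0 < y \<and> y \<le> 2"
      have "1 / y ^ n \<le> 2 powr \<delta> * y powr (- (real n + \<delta>))"
      proof -
        have "y powr (- (real n + \<delta>)) = (1 / y ^ n) / y powr \<delta>"
          using xy unfolding powr_minus_divide powr_add by (simp add: powr_realpow)
        moreover have "y powr \<delta> \<le> 2 powr \<delta>" using xy \<delta> by (intro powr_mono2) auto
        ultimately show ?thesis using xy
          by (metis divide_pos_pos mult.commute mult_right_mono nonzero_eq_divide_eq order_less_imp_le
              powr_gt_zero zero_less_one zero_less_power less_irrefl)
      qed
      then have "K * (1 + \<bar>x\<bar>) ^ (2 * n) * (1 / y ^ n) \<le> K * (1 + \<bar>x\<bar>) ^ (2 * n) * (2 powr \<delta> * y powr (- (real n + \<delta>)))"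
        using K by (intro mult_left_mono) auto
      then show "norm (mollify u \<phi> (Complex x y)) \<le> K * 2 powr \<delta> * (1 + \<bar>x\<bar>) ^ (2 * n) * y powr (- (real n + \<delta>))"
        using K(2)[of x y] xy by (simp add: mult_ac)
    qed
  qed
  from down[OF this] \<phi> show ?thesis unfolding Q_def by (auto simp: max_def)
qed

text \<open>The exponent comes before the bump: the difference condition must have one order for all
  mollifications in order to pass to \<open>u\<close>. Above height 1 temperate growth is already
  polynomial, apart from a compact set; below it, \<open>mollify_bound_far\<close> serves for large
  |x| and uniform boundedness for the rest.\<close>

lemma mollify_polynomial_growth:
  assumes a: "alpha_system \<alpha> u p k k'" and \<alpha>: "\<alpha> > -1"
    and t: "temperate_growth_at_infinity u" and v: "vanishes_in_distributions_at_boundary u"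
  obtains n :: nat where "\<And>\<phi>. unit_bump \<phi> \<Longrightarrow> \<exists>C. \<forall>z\<in>uhp. cmod (mollify u \<phi> z) \<le> C * (1 + cmod z) ^ n"
proof -
  obtain C R :: real and n :: nat where C: "C \<ge> 0" and R: "R \<ge> 1"
    and g: "\<And>z. z \<in> uhp \<Longrightarrow> cmod z \<ge> R \<Longrightarrow> cmod (u z) \<le> C * ((cmod z)\<^sup>2 / Im z) ^ n"
    using temperate_growth_nat[OF t] by blast
  have uc: "continuous_on uhp u"
    using a has_wirtinger_continuous_on unfolding alpha_system_def by blast
  have "\<exists>C. \<forall>z\<in>uhp. cmod (mollify u \<phi> z) \<le> C * (1 + cmod z) ^ (2 * n)" if \<phi>: "unit_bump \<phi>" for \<phi>
  proof -
    obtain M where M: "M \<ge> 0" "\<And>t. norm (\<phi> t) \<le> M" using unit_bump_bounded[OF \<phi>] by blast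
    obtain K1 where K1: "K1 \<ge> 0" "\<And>x y. \<bar>x\<bar> \<ge> R + 2 \<Longrightarrow> 0 < y \<Longrightarrow> y \<le> 2 \<Longrightarrow>
           norm (mollify u \<phi> (Complex x y)) \<le> K1 * (1 + \<bar>x\<bar>) ^ (2 * n)"
    proof -
      have "\<exists>K\<ge>0. \<forall>x y. \<bar>x\<bar> \<ge> R + 2 \<and> 0 < y \<and> y \<le> 2 \<longrightarrow>
           norm (mollify u \<phi> (Complex x y)) \<le> K * (1 + \<bar>x\<bar>) ^ (2 * n)"
        by (rule mollify_bound_far[OF a \<alpha> g C \<phi>])
      then show ?thesis using that by auto
    qed
    obtain K2 where K2: "\<And>x y. \<bar>x\<bar> \<le> R + 2 \<Longrightarrow> 0 < y \<Longrightarrow> y \<le> 1 \<Longrightarrow>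
           norm (mollify u \<phi> (Complex x y)) \<le> K2"
      using mollify_bounded_near_boundary[OF uc v \<phi>, of "R + 2"] by blast
    define S where "S = {z. Im z \<ge> 1} \<inter> cball 0 (R + 2)"
    have "compact S" unfolding S_def
      by (intro closed_Int_compact compact_cball closed_halfspace_Im_ge)
    moreover have "S \<subseteq> uhp" by (auto simp: S_def)
    ultimately have "compact (mollify u \<phi> ` S)"
      using continuous_on_mollify[OF uc unit_bump_continuous_on[OF \<phi>]]
      by (meson compact_continuous_image continuous_on_subset)
    then obtain K3 where K3: "\<And>z. z \<in> S \<Longrightarrow> norm (mollify u \<phi> z) \<le> K3"
      using compact_imp_bounded bounded_iff by (metis image_eqI)
    define K4 where "K4 = 4 * (C * 4 ^ n) * M"
    have K4: "norm (mollify u \<phi> z) \<le> K4 * (1 + cmod z) ^ (2 * n)" if z: "Im z \<ge> 1" "cmod z \<ge> R + 2" for z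
    proof -
      have "norm (u (z + of_real t)) \<le> C * 4 ^ n * (1 + cmod z) ^ (2 * n)" if t: "\<bar>t\<bar> \<le> 2" for t
      proof -
        define w where "w = z + of_real t"
        have w: "Im w = Im z" by (simp add: w_def)
        have "cmod z \<le> cmod w + \<bar>t\<bar>"
          unfolding w_def by (metis add_diff_cancel_right' norm_of_real norm_triangle_ineq4)
        then have 1: "cmod w \<ge> R" using t z by linarith
        have "cmod w \<le> cmod z + \<bar>t\<bar>"
          unfolding w_def by (metis norm_of_real norm_triangle_ineq)
        also have "\<dots> \<le> cmod z + 2" using t by simp
        also have "\<dots> \<le> 2 * (1 + cmod z)" by simp
        finally have "cmod w \<le> 2 * (1 + cmod z)" .
        then have "(cmod w)^2 \<le> (2 * (1 + cmod z))^2" by (intro power_mono) auto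
        also have "\<dots> = 4 * (1 + cmod z)^2" by (simp only: power_mult_distrib) simp
        finally have "(cmod w)^2 \<le> 4 * (1 + cmod z)^2" .
        moreover have "(cmod w)^2 / Im w \<le> (cmod w)^2 / 1"
          using z w by (intro divide_left_mono) auto
        ultimately have "(cmod w)^2 / Im w \<le> 4 * (1 + cmod z)^2" by simp
        then have "((cmod w)^2 / Im w)^n \<le> (4 * (1 + cmod z)^2)^n"
          using z w by (intro power_mono) auto
        also have "\<dots> = 4 ^ n * (1 + cmod z) ^ (2 * n)"
          by (simp add: power_mult_distrib power_mult)
        finally have "C * ((cmod w)^2 / Im w)^n \<le> C * (4 ^ n * (1 + cmod z) ^ (2 * n))"
          using C by (rule mult_left_mono)
        then show ?thesis using g[of w] 1 z w by (simp flip: w_def)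
      qed
      from mollify_norm_le[OF uc unit_bump_continuous_on[OF \<phi>] _ M(2) this]
      show ?thesis using z by (simp add: K4_def mult_ac)
    qed
    define K where "K = K1 + \<bar>K2\<bar> + \<bar>K3\<bar> + K4"
    have K4p: "K4 \<ge> 0" using C M by (simp add: K4_def)
    have "cmod (mollify u \<phi> z) \<le> K * (1 + cmod z) ^ (2 * n)" if z: "z \<in> uhp" for z
    proof -
      define W where "W = (1 + cmod z) ^ (2 * n)"
      have W: "W \<ge> 1" by (simp add: W_def)
      have KW: "K1 * W \<le> K * W" "\<bar>K2\<bar> * W \<le> K * W" "\<bar>K3\<bar> * W \<le> K * W" "K4 * W \<le> K * W"
        using W K1(1) K4p by (auto intro!: mult_right_mono simp: K_def)
      have one: "\<bar>a\<bar> \<le> \<bar>a\<bar> * W" for a :: real using W mult_left_mono[of 1 W "\<bar>a\<bar>"] by simp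
      consider "Im z \<ge> 1" "cmod z \<ge> R + 2" | "Im z \<ge> 1" "cmod z \<le> R + 2"
        | "Im z \<le> 1" "\<bar>Re z\<bar> \<ge> R + 2" | "Im z \<le> 1" "\<bar>Re z\<bar> \<le> R + 2" by linarith
      then have "cmod (mollify u \<phi> z) \<le> K * W"
      proof cases
        case 1
        then show ?thesis using K4[of z] KW by (simp add: W_def)
      next
        case 2
        then have "z \<in> S" by (auto simp: S_def)
        then show ?thesis using K3[of z] KW one[of K3] by linarith
      next
        case 3
        have "norm (mollify u \<phi> (Complex (Re z) (Im z))) \<le> K1 * (1 + \<bar>Re z\<bar>) ^ (2 * n)"
          by (rule K1(2)) (use 3 z in auto)
        also have "\<dots> \<le> K1 * W"
          unfolding W_def using K1(1) abs_Re_le_cmod[of z] by (intro mult_left_mono power_mono) auto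
        finally show ?thesis using KW by simp
      next
        case 4
        have "norm (mollify u \<phi> (Complex (Re z) (Im z))) \<le> K2"
          by (rule K2) (use 4 z in auto)
        then show ?thesis using KW one[of K2] by simp
      qed
      then show ?thesis by (simp add: W_def)
    qed
    then show ?thesis by blast
  qed
  then show ?thesis using that by blast
qed

text \<open>On one vertical line this is the distributional hypothesis. The x-derivative is, up to
  sign, the mollification with \<open>vderiv \<phi>\<close>, which is bounded near the boundary; so
  the slices are Lipschitz in x uniformly in the height, and the limit holds for every
  approach.\<close>

lemma mollify_tendsto_0_boundary:
  assumes a: "alpha_system \<alpha> u p k k'" and v: "vanishes_in_distributions_at_boundary u"
    and \<phi>: "unit_bump \<phi>"
  shows "(mollify u \<phi> \<longlongrightarrow> 0) (at (of_real x0) within uhp)"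
proof -
  have w: "has_wirtinger u p (\<lambda>z. of_real (Im z powr \<alpha>) * k z) uhp"
    using a unfolding alpha_system_def by blast
  have uc: "continuous_on uhp u" using w has_wirtinger_continuous_on by blast
  obtain K where K: "\<And>x y. \<bar>x\<bar> \<le> \<bar>x0\<bar> + 1 \<Longrightarrow> 0 < y \<Longrightarrow> y \<le> 1 \<Longrightarrow>
           norm (mollify u (vderiv \<phi>) (Complex x y)) \<le> K"
    using mollify_bounded_near_boundary[OF uc v unit_bump_vderiv[OF \<phi>], of "\<bar>x0\<bar> + 1"] by blast
  have K0: "K \<ge> 0" by (rule order_trans[OF norm_ge_zero K[of 0 1]]) auto
  have lip: "norm (mollify u \<phi> (Complex x y) - mollify u \<phi> (Complex x0 y)) \<le> K * \<bar>x - x0\<bar>"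
    if xy: "\<bar>x - x0\<bar> \<le> 1" "0 < y" "y \<le> 1" for x y
  proof -
    define f where "f = (\<lambda>x. mollify u \<phi> (Complex x y))"
    define S where "S = {x0 - 1..x0 + 1}"
    have "norm (f x - f x0) \<le> K * norm (x - x0)"
    proof (rule differentiable_bound)
      show "convex S" unfolding S_def by simp
      show "x \<in> S" "x0 \<in> S" using xy by (auto simp: S_def)
      fix s assume s: "s \<in> S"
      define z where "z = Complex s y"
      have z: "z \<in> uhp" using xy by (simp add: z_def)
      have "((\<lambda>x. Complex x y) has_vector_derivative 1) (at s)"
      proof -
        have "((\<lambda>x. of_real x + \<i> * of_real y) has_vector_derivative 1) (at s)"
          by (auto intro!: derivative_eq_intros)
        then show ?thesis by (simp add: Complex_eq)
      qed
      from has_wirtinger_curve[OF has_wirtinger_mollify[OF w unit_bump_continuous_on[OF \<phi>]] this]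
      have "(f has_vector_derivative - mollify u (vderiv \<phi>) z) (at s)"
        using z mollify_by_parts[OF w \<phi> z] by (simp add: z_def f_def)
      then show "(f has_derivative (\<lambda>h. h *\<^sub>R (- mollify u (vderiv \<phi>) z))) (at s within S)"
        by (simp add: has_vector_derivative_def has_derivative_at_withinI)
      have "norm (mollify u (vderiv \<phi>) z) \<le> K" unfolding z_def
        by (rule K) (use s xy in \<open>auto simp: S_def\<close>)
      then show "onorm (\<lambda>h. h *\<^sub>R (- mollify u (vderiv \<phi>) z)) \<le> K"
        by (intro onorm_le) (simp add: mult_right_mono mult.commute[of "norm _" K] mult.commute[of "\<bar>_\<bar>" "norm _"])
    qed
    then show ?thesis by (simp add: f_def)
  qed
  show ?thesis
  proof (rule tendstoI)
    fix e :: real assume e: "e > 0"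
    have "\<forall>\<^sub>F y in at_right 0. dist (mollify u \<phi> (Complex x0 y)) 0 < e / 2"
      using mollify_tendsto_0_vertical[OF uc v \<phi>] by (rule tendstoD) (use e in simp)
    then obtain b where b: "b > 0" "\<And>y. 0 < y \<Longrightarrow> y < b \<Longrightarrow> norm (mollify u \<phi> (Complex x0 y)) < e / 2"
      by (auto simp: eventually_at_right_field)
    define d where "d = min (min b 1) (e / (2 * (K + 1)))"
    have d: "d > 0" "d \<le> b" "d \<le> 1" "d \<le> e / (2 * (K + 1))" using b e K0 by (auto simp: d_def)
    have "norm (mollify u \<phi> z) < e" if z: "z \<in> uhp" "dist z (of_real x0) < d" for z
    proof -
      have 1: "\<bar>Re z - x0\<bar> < d" "\<bar>Im z\<bar> < d"
        using abs_Re_le_cmod[of "z - of_real x0"] abs_Im_le_cmod[of "z - of_real x0"] z(2)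
        by (auto simp: dist_norm)
      have "norm (mollify u \<phi> (Complex (Re z) (Im z)) - mollify u \<phi> (Complex x0 (Im z))) \<le> K * \<bar>Re z - x0\<bar>"
        by (rule lip) (use 1 z d in auto)
      also have "\<dots> \<le> (K + 1) * (e / (2 * (K + 1)))"
        using 1 d K0 by (intro mult_mono) auto
      also have "\<dots> = e / 2"
      proof -
        have "K + 1 \<noteq> 0" using K0 by simp
        then show ?thesis by (simp add: divide_simps)
      qed
      finally have "norm (mollify u \<phi> z - mollify u \<phi> (Complex x0 (Im z))) \<le> e / 2" by simp
      moreover have "norm (mollify u \<phi> (Complex x0 (Im z))) < e / 2"
        by (rule b(2)) (use 1 z d in auto)
      ultimately show ?thesis
        using norm_triangle_sub[of "mollify u \<phi> z" "mollify u \<phi> (Complex x0 (Im z))"] by linarith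
    qed
    then show "\<forall>\<^sub>F z in at (of_real x0) within uhp. dist (mollify u \<phi> z) 0 < e"
      unfolding eventually_at using d(1) by (intro exI[of _ d]) auto
  qed
qed

section \<open>Fourier coefficients on circles\<close>

definition circle_fourier :: "(complex \<Rightarrow> complex) \<Rightarrow> int \<Rightarrow> real \<Rightarrow> complex" where
  "circle_fourier V m r = integral {0..2 * pi} (\<lambda>t. V (of_real r * cis t) * cis (- (of_int m * t)))"

lemma continuous_on_circle:
  fixes V :: "complex \<Rightarrow> complex"
  assumes "continuous_on (ball 0 R) V" "0 < r" "r < R"
  shows "continuous_on A (\<lambda>t. V (of_real r * cis t))"
  by (intro continuous_on_compose2[OF assms(1)] continuous_intros) (use assms in \<open>auto simp: norm_mult\<close>)

lemma circle_fourier_integrable: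
  assumes "continuous_on (ball 0 R) V" "0 < r" "r < R"
  shows "(\<lambda>t. V (of_real r * cis t) * cis (- (of_int m * t))) integrable_on {a..b}"
  by (intro integrable_continuous_interval continuous_on_mult continuous_on_circle[OF assms] continuous_intros)

lemma has_vector_derivative_cis_linear:
  "((\<lambda>t. cis (a * t)) has_vector_derivative \<i> * of_real a * cis (a * t)) (at t)"
proof -
  have "((\<lambda>t. exp (\<i> * of_real (a * t))) has_vector_derivative \<i> * of_real a * exp (\<i> * of_real (a * t))) (at t)"
  proof -
    have "((\<lambda>z. exp (\<i> * (of_real a * z))) has_field_derivative \<i> * of_real a * exp (\<i> * (of_real a * of_real t))) (at (of_real t))"
      by (auto intro!: derivative_eq_intros)
    from has_vector_derivative_real_field[OF this] show ?thesis by simp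
  qed
  then show ?thesis by (simp add: cis_conv_exp)
qed

text \<open>The angular derivative of the periodic function V(r e^(it)) e^(-imt) integrates to 0.
  The relation serves to eliminate \<open>p\<close>.\<close>

lemma circle_fourier_angular:
  assumes w: "has_wirtinger V p q (ball 0 R)" and r: "0 < r" "r < R"
  shows "of_real r * integral {0..2 * pi} (\<lambda>t. (p (of_real r * cis t) * cis t - q (of_real r * cis t) * cis (- t)) * cis (- (of_int m * t)))
    = of_int m * circle_fourier V m r"
proof -
  note c = has_wirtingerD(2,3)[OF w] has_wirtinger_continuous_on[OF w]
  let ?P = "\<lambda>t. (p (of_real r * cis t) * cis t - q (of_real r * cis t) * cis (- t)) * cis (- (of_int m * t))"
  let ?F = "\<lambda>t. V (of_real r * cis t) * cis (- (of_int m * t))"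
  have "((\<lambda>t. \<i> * of_real r * ?P t - \<i> * of_int m * ?F t) has_integral ?F (2 * pi) - ?F 0) {0..2 * pi}"
  proof (rule fundamental_theorem_of_calculus)
    fix t :: real
    have "((\<lambda>t. of_real r * cis t) has_vector_derivative of_real r * (\<i> * cis t)) (at t)"
      using has_vector_derivative_mult_right[OF has_vector_derivative_cis_linear[of 1 t], of "of_real r"] by simp
    from has_wirtinger_curve[OF w this] r
    have V: "((\<lambda>t. V (of_real r * cis t)) has_vector_derivative 
        p (of_real r * cis t) * (of_real r * (\<i> * cis t)) + q (of_real r * cis t) * cnj (of_real r * (\<i> * cis t))) (at t)"
      by (simp add: norm_mult)
    have C: "((\<lambda>t. cis (- (of_int m * t))) has_vector_derivative - (\<i> * of_int m * cis (- (of_int m * t)))) (at t)"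
      using has_vector_derivative_cis_linear[of "- of_int m" t] by simp
    have "(?F has_vector_derivative (\<i> * of_real r * ?P t - \<i> * of_int m * ?F t)) (at t)"
      using has_vector_derivative_mult[OF V C] by (simp add: algebra_simps cis_cnj)
    then show "(?F has_vector_derivative (\<i> * of_real r * ?P t - \<i> * of_int m * ?F t)) (at t within {0..2 * pi})"
      by (rule has_vector_derivative_at_within)
  qed simp
  then have I1: "((\<lambda>t. \<i> * of_real r * ?P t - \<i> * of_int m * ?F t) has_integral ?F (2 * pi) - ?F 0) {0..2 * pi}" .
  have F0: "?F (2 * pi) - ?F 0 = 0"
  proof -
    have "cis (- (of_int m * (2 * pi))) = 1"
      using cis_multiple_2pi[of "- of_int m"] by (simp add: algebra_simps)
    then show ?thesis by simp
  qed
  have P: "?P integrable_on {0..2 * pi}"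
    by (intro integrable_continuous_interval continuous_on_mult continuous_on_diff
        continuous_on_circle[OF c(1) r] continuous_on_circle[OF c(2) r] continuous_intros)
  have F: "?F integrable_on {0..2 * pi}"
    by (rule circle_fourier_integrable[OF c(3) r])
  have I2: "((\<lambda>t. \<i> * of_real r * ?P t - \<i> * of_int m * ?F t) has_integral 
      \<i> * of_real r * integral {0..2 * pi} ?P - \<i> * of_int m * integral {0..2 * pi} ?F) {0..2 * pi}"
    by (intro has_integral_diff has_integral_mult_right integrable_integral P F)
  from has_integral_unique[OF I2 I1]
  have "\<i> * of_real r * integral {0..2 * pi} ?P - \<i> * of_int m * integral {0..2 * pi} ?F = 0"
    unfolding F0 .
  then have "\<i> * (of_real r * integral {0..2 * pi} ?P) = \<i> * (of_int m * integral {0..2 * pi} ?F)"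
    by (simp add: mult.assoc)
  then show ?thesis unfolding circle_fourier_def using mult_cancel_left complex_i_not_zero by blast
qed

text \<open>The radial derivative yields the sum of the two integrals whose difference
  \<open>circle_fourier_angular\<close> evaluates. Eliminating \<open>p\<close> leaves c_m' = (m/r)
  c_m + 2 c_(m+1)(q), and r^(-m) is the integrating factor. Thus the derivative by cnj z alone
  governs each mode.\<close>

lemma circle_fourier_deriv:
  assumes w: "has_wirtinger V p q (ball 0 R)" and r: "0 < r" "r < R"
  shows "((\<lambda>r. of_real (r powi (- m)) * circle_fourier V m r) has_vector_derivative
     2 * of_real (r powi (- m)) * circle_fourier q (m + 1) r) (at r)"
proof -
  note c = has_wirtingerD(2,3)[OF w] has_wirtinger_continuous_on[OF w]
  let ?P = "\<lambda>t. p (of_real r * cis t) * cis t * cis (- (of_int m * t))"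
  let ?Q = "\<lambda>t. q (of_real r * cis t) * cis (- t) * cis (- (of_int m * t))"
  have P: "?P integrable_on {0..2 * pi}" and Q: "?Q integrable_on {0..2 * pi}"
    by (intro integrable_continuous_interval continuous_on_mult continuous_on_circle[OF c(1) r]
        continuous_on_circle[OF c(2) r] continuous_intros)+
  have "((\<lambda>r. integral (cbox 0 (2 * pi)) (\<lambda>t. V (of_real r * cis t) * cis (- (of_int m * t)))) has_vector_derivative
     integral (cbox 0 (2 * pi)) (\<lambda>t. (p (of_real r * cis t) * cis t + q (of_real r * cis t) * cis (- t)) * cis (- (of_int m * t))))
       (at r within {0<..<R})"
  proof (rule leibniz_rule_vector_derivative)
    fix s t :: real assume s: "s \<in> {0<..<R}"
    have "((\<lambda>r. of_real r * cis t) has_vector_derivative cis t) (at s)"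
      by (auto intro!: derivative_eq_intros)
    from has_wirtinger_curve[OF w this] s
    have V: "((\<lambda>r. V (of_real r * cis t)) has_vector_derivative 
        p (of_real s * cis t) * cis t + q (of_real s * cis t) * cis (- t)) (at s)"
      by (simp add: norm_mult cis_cnj)
    show "((\<lambda>r. V (of_real r * cis t) * cis (- (of_int m * t))) has_vector_derivative 
       (p (of_real s * cis t) * cis t + q (of_real s * cis t) * cis (- t)) * cis (- (of_int m * t))) (at s within {0<..<R})"
      by (rule has_vector_derivative_at_within) (rule has_vector_derivative_mult_left[OF V])
  next
    fix s assume "s \<in> {0<..<R}"
    then show "(\<lambda>t. V (of_real s * cis t) * cis (- (of_int m * t))) integrable_on cbox 0 (2 * pi)"
      using circle_fourier_integrable[OF c(3)] by simp
  next
    show "continuous_on ({0<..<R} \<times> cbox 0 (2 * pi)) (\<lambda>(s, t). (p (of_real s * cis t) * cis t + q (of_real s * cis t) * cis (- t)) * cis (- (of_int m * t)))"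
      unfolding split_beta
      by (intro continuous_on_mult continuous_on_add continuous_on_compose2[OF c(1)] continuous_on_compose2[OF c(2)] continuous_intros)
         (auto simp: norm_mult)
  qed (use r in auto)
  then have "(circle_fourier V m has_vector_derivative integral {0..2 * pi} (\<lambda>t. ?P t + ?Q t)) (at r)"
    using r at_within_open[of r "{0<..<R}"] unfolding circle_fourier_def[abs_def] distrib_right cbox_interval by simp
  also have "integral {0..2 * pi} (\<lambda>t. ?P t + ?Q t) = integral {0..2 * pi} ?P + integral {0..2 * pi} ?Q"
    by (rule integral_add[OF P Q])
  also have "integral {0..2 * pi} ?P = of_int m / of_real r * circle_fourier V m r + integral {0..2 * pi} ?Q"
  proof -
    have solve: "A = X / of_real r + B" if "of_real r * (A - B) = X" for A B X :: complex
      using that r by (auto simp: field_simps)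
    have "of_real r * (integral {0..2 * pi} ?P - integral {0..2 * pi} ?Q) = of_int m * circle_fourier V m r"
      using circle_fourier_angular[OF w r, of m]
      unfolding left_diff_distrib[of _ _ "cis _"] integral_diff[OF P Q] .
    from solve[OF this] show ?thesis by simp
  qed
  also have Qe: "integral {0..2 * pi} ?Q = circle_fourier q (m + 1) r"
  proof -
    have "cis (- t) * cis (- (of_int m * t)) = cis (- (of_int (m + 1) * t))" for t
      by (simp add: cis_mult distrib_right add.commute)
    then show ?thesis unfolding circle_fourier_def by (simp only: mult.assoc)
  qed
  finally have D: "(circle_fourier V m has_vector_derivative
      of_int m / of_real r * circle_fourier V m r + 2 * circle_fourier q (m + 1) r) (at r)"
    by (simp add: algebra_simps)
  have "((\<lambda>r. r powi (- m)) has_real_derivative of_int (- m) * r powi (- m - 1)) (at r)"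
    using r by (auto intro!: derivative_eq_intros)
  then have E: "((\<lambda>r. complex_of_real (r powi (- m))) has_vector_derivative of_real (of_int (- m) * r powi (- m - 1))) (at r)"
    by (rule has_vector_derivative_of_real)
  have "complex_of_real r powi (- m - 1) = complex_of_real r powi (- m) / complex_of_real r"
    using r by (simp add: power_int_diff)
  then show ?thesis
    using has_vector_derivative_mult[OF E D] r
    by (elim has_vector_derivative_eq_rhs) (simp add: field_simps)
qed

lemma circle_fourier_bounded:
  assumes "continuous_on (ball 0 R) V" "0 < R"
  obtains B where "\<And>r. 0 < r \<Longrightarrow> r \<le> R / 2 \<Longrightarrow> norm (circle_fourier V m r) \<le> B"
proof -
  have "compact (V ` cball 0 (R / 2))"
    by (intro compact_continuous_image continuous_on_subset[OF assms(1)]) (use assms(2) in auto)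
  then obtain B where B: "\<And>z. z \<in> cball 0 (R / 2) \<Longrightarrow> norm (V z) \<le> B"
    using compact_imp_bounded bounded_iff by (metis image_eqI)
  have "norm (circle_fourier V m r) \<le> B * (2 * pi - 0)" if r: "0 < r" "r \<le> R / 2" for r
    unfolding circle_fourier_def
    by (rule integral_bound)
      (use r assms(2) in \<open>auto intro!: continuous_on_mult continuous_on_circle[OF assms(1)] continuous_intros B simp: norm_mult\<close>)
  then show ?thesis using that by blast
qed

lemma circle_fourier_0_tendsto:
  fixes g :: "complex \<Rightarrow> complex"
  assumes c: "continuous_on (ball 0 R) g" and R: "0 < R"
  shows "(circle_fourier g 0 \<longlongrightarrow> 2 * pi * g 0) (at_right 0)"
proof (rule tendstoI)
  fix e :: real assume e: "e > 0"
  define e' where "e' = e / (2 * pi + 1)"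
  have e': "e' > 0" using e by (simp add: e'_def add_pos_pos)
  have "isCont g 0" using c R by (simp add: continuous_on_eq_continuous_at)
  then obtain d where d: "d > 0" "\<And>z. dist z 0 < d \<Longrightarrow> dist (g z) (g 0) < e'"
    using e' by (auto simp: continuous_at_eps_delta dist_commute)
  have "dist (circle_fourier g 0 r) (2 * pi * g 0) < e" if r: "0 < r" "r < min d R" for r
  proof -
    have i: "(\<lambda>t. g (of_real r * cis t)) integrable_on {0..2 * pi}"
      using circle_fourier_integrable[OF c, of r 0] r by simp
    have "((\<lambda>t. g (of_real r * cis t) - g 0) has_integral circle_fourier g 0 r - (2 * pi - 0) *\<^sub>R g 0) {0..2 * pi}"
      unfolding circle_fourier_def using has_integral_const_real[of "g 0" 0 "2 * pi"]
      by (intro has_integral_diff) (use i in \<open>auto simp: integrable_integral\<close>)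
    then have "circle_fourier g 0 r - 2 * pi * g 0 = integral {0..2 * pi} (\<lambda>t. g (of_real r * cis t) - g 0)"
      by (simp add: integral_unique scaleR_conv_of_real)
    also have "norm \<dots> \<le> e' * (2 * pi - 0)"
    proof (rule integral_bound)
      show "continuous_on {0..2 * pi} (\<lambda>t. g (of_real r * cis t) - g 0)"
        by (intro continuous_intros continuous_on_circle[OF c]) (use r in auto)
      fix t :: real
      have "dist (g (of_real r * cis t)) (g 0) < e'" by (rule d(2)) (use r in \<open>simp add: norm_mult\<close>)
      then show "norm (g (of_real r * cis t) - g 0) \<le> e'" by (simp add: dist_norm)
    qed simp
    also have "e' * (2 * pi - 0) < e' * (2 * pi + 1)" using e' by (intro mult_strict_left_mono) auto
    also have "\<dots> = e" using pi_gt_zero by (simp add: e'_def add_pos_pos less_imp_neq[symmetric])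
    finally show ?thesis by (simp add: dist_norm)
  qed
  then show "\<forall>\<^sub>F r in at_right 0. dist (circle_fourier g 0 r) (2 * pi * g 0) < e"
    unfolding eventually_at_right_field using d(1) R by (intro exI[of _ "min d R"]) auto
qed

lemma constant_on_interval:
  fixes f :: "real \<Rightarrow> complex"
  assumes "\<And>r. 0 < r \<Longrightarrow> r < R \<Longrightarrow> (f has_vector_derivative 0) (at r)"
  obtains c where "\<And>r. 0 < r \<Longrightarrow> r < R \<Longrightarrow> f r = c"
proof -
  have "\<exists>c. \<forall>r\<in>{0<..<R}. f r = c"
  proof (rule has_derivative_zero_constant)
    show "convex {0<..<R}" by simp
    show "(f has_derivative (\<lambda>h. 0)) (at x within {0<..<R})" if "x \<in> {0<..<R}" for x
      using assms[of x] that by (auto simp: has_vector_derivative_def intro: has_derivative_at_withinI)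
  qed
  then show ?thesis using that by auto
qed

text \<open>Here \<open>q\<close> is 0, so r^(-m) c_m(r) is constant; for m < 0 boundedness of c_m
  near the centre forces the constant to be 0.\<close>

lemma holomorphic_circle_fourier:
  assumes f: "f holomorphic_on ball 0 R" and R: "0 < R"
  obtains \<gamma> :: "int \<Rightarrow> complex" where 
    "\<And>m r. 0 < r \<Longrightarrow> r < R \<Longrightarrow> circle_fourier f m r = \<gamma> m * of_real (r powi m)"
    "\<And>m. m < 0 \<Longrightarrow> \<gamma> m = 0"
proof -
  have w: "has_wirtinger f (deriv f) (\<lambda>_. 0) (ball 0 R)"
    using f by (rule has_wirtinger_holomorphic) simp
  have "\<exists>c. \<forall>r. 0 < r \<and> r < R \<longrightarrow> of_real (r powi (- m)) * circle_fourier f m r = c" for m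
  proof -
    have "((\<lambda>r. of_real (r powi (- m)) * circle_fourier f m r) has_vector_derivative 0) (at r)"
      if "0 < r" "r < R" for r
      using circle_fourier_deriv[OF w that, of m] by (simp add: circle_fourier_def)
    from constant_on_interval[of R, OF this] show ?thesis by metis
  qed
  then obtain \<gamma> where \<gamma>: "\<And>m r. 0 < r \<Longrightarrow> r < R \<Longrightarrow> of_real (r powi (- m)) * circle_fourier f m r = \<gamma> m"
    by metis
  have *: "circle_fourier f m r = \<gamma> m * of_real (r powi m)" if "0 < r" "r < R" for m r
    using \<gamma>[OF that, of m] that by (auto simp: power_int_minus field_simps)
  have "\<gamma> m = 0" if m: "m < 0" for m
  proof -
    obtain B where B: "\<And>r. 0 < r \<Longrightarrow> r \<le> R / 2 \<Longrightarrow> norm (circle_fourier f m r) \<le> B"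
      using circle_fourier_bounded[OF holomorphic_on_imp_continuous_on[OF f] R] by blast
    define k where "k = nat (- m)"
    have k: "k > 0" "- m = int k" using m by (auto simp: k_def)
    have "((\<lambda>r. B * r ^ k) \<longlongrightarrow> B * 0 ^ k) (at_right (0::real))"
      by (intro tendsto_intros)
    then have 0: "((\<lambda>r. B * r ^ k) \<longlongrightarrow> 0) (at_right (0::real))" using k(1) by (simp add: power_0_left)
    have "norm (\<gamma> m) \<le> 0"
    proof (rule tendsto_lowerbound[OF 0])
      show "\<forall>\<^sub>F r in at_right 0. norm (\<gamma> m) \<le> B * r ^ k"
        unfolding eventually_at_right_field
      proof (intro exI[of _ "R / 2"] conjI allI impI)
        fix r assume r: "0 < r" "r < R / 2"
        have "norm (\<gamma> m) = r ^ k * norm (circle_fourier f m r)"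
          using \<gamma>[of r m] r k R by (metis (no_types, lifting) abs_of_pos field_sum_of_halves less_add_same_cancel1
              half_gt_zero less_trans norm_mult norm_of_real power_int_of_nat zero_less_power)
        also have "\<dots> \<le> r ^ k * B" using B[of r] r by (intro mult_left_mono) auto
        finally show "norm (\<gamma> m) \<le> B * r ^ k" by (simp add: mult.commute)
      qed (use R in auto)
    qed simp
    then show ?thesis by simp
  qed
  with * that show ?thesis by blast
qed

text \<open>Otherwise f = w^n g near 0 with g 0 \<noteq> 0. The n-th coefficient of f on a circle of
  radius s is s^n times the 0-th one of g, which tends to 2 pi g 0.\<close>

lemma circle_fourier_eq_0_imp_holomorphic_eq_0:
  assumes f: "f holomorphic_on ball 0 R" and R: "0 < R"
    and z: "\<And>m r. 0 < r \<Longrightarrow> r < R \<Longrightarrow> circle_fourier f m r = 0"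
  shows "\<forall>w\<in>ball 0 R. f w = 0"
proof (rule ccontr)
  assume contr: "\<not> ?thesis"
  obtain g r n where r: "0 < r" "r \<le> R" and g: "g holomorphic_on ball 0 r" 
    and fg: "\<And>w. w \<in> ball 0 r \<Longrightarrow> f w = w ^ n * g w" and g0: "g 0 \<noteq> 0"
  proof (cases "f 0 = 0")
    case False
    then show ?thesis using that[of R f 0] f R by auto
  next
    case True
    have nc: "\<not> f constant_on ball 0 R"
      using contr True R unfolding constant_on_def by (metis centre_in_ball)
    have "0 \<in> ball (0::complex) R" using R by simp
    show ?thesis
    proof (rule holomorphic_factor_zero_nonconstant[OF f open_ball connected_ball \<open>0 \<in> ball 0 R\<close> True nc])
      fix g :: "complex \<Rightarrow> complex" and r :: real and n :: nat
      assume "0 < n" and *: "0 < r" "ball (0::complex) r \<subseteq> ball 0 R" "g holomorphic_on ball 0 r"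
        "\<And>w. w \<in> ball 0 r \<Longrightarrow> f w = (w - 0) ^ n * g w" "\<And>w. w \<in> ball 0 r \<Longrightarrow> g w \<noteq> 0"
      show thesis
        by (rule that[of r g n]) (use * in \<open>auto simp: ball_subset_ball_iff\<close>)
    qed
  qed
  have "circle_fourier g 0 s = 0" if s: "0 < s" "s < r" for s
  proof -
    have "circle_fourier f (int n) s = integral {0..2 * pi} (\<lambda>t. of_real s ^ n * g (of_real s * cis t))"
      unfolding circle_fourier_def
    proof (intro integral_cong)
      fix t :: real
      have "f (of_real s * cis t) = (of_real s * cis t) ^ n * g (of_real s * cis t)"
        by (rule fg) (use s in \<open>simp add: norm_mult\<close>)
      then show "f (of_real s * cis t) * cis (- (of_int (int n) * t)) = of_real s ^ n * g (of_real s * cis t)"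
        by (simp add: power_mult_distrib Complex.DeMoivre cis_mult[symmetric] mult_ac)
           (simp add: cis_mult flip: mult.assoc)
    qed
    also have "\<dots> = of_real s ^ n * circle_fourier g 0 s"
      by (simp add: circle_fourier_def)
    finally show ?thesis using z[of s "int n"] s r by simp
  qed
  then have "\<forall>\<^sub>F s in at_right 0. 0 = circle_fourier g 0 s"
    unfolding eventually_at_right_field using r by (intro exI[of _ r]) auto
  then have "(circle_fourier g 0 \<longlongrightarrow> 0) (at_right 0)"
    by (rule Lim_transform_eventually[OF tendsto_const])
  moreover have "(circle_fourier g 0 \<longlongrightarrow> 2 * pi * g 0) (at_right 0)"
    by (rule circle_fourier_0_tendsto[OF holomorphic_on_imp_continuous_on[OF g] r(1)])
  ultimately have "2 * pi * g 0 = 0"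
    using tendsto_unique[OF trivial_limit_at_right_real] by blast
  then show False using g0 by simp
qed

section \<open>Solutions on the unit disc\<close>

text \<open>Closed form of \<open>\<integral> s\<^bsup>2k+1\<^esup> (1 - s\<^sup>2)\<^sup>\<alpha> ds\<close> over \<open>[0,r]\<close>, obtained by expanding
  \<open>s\<^bsup>2k\<^esup> = (1 - (1 - s\<^sup>2))\<^sup>k\<close>.\<close>

definition inc_beta :: "real \<Rightarrow> nat \<Rightarrow> real \<Rightarrow> real" where
  "inc_beta \<alpha> k r = (\<Sum>j\<le>k. (-1) ^ j * of_nat (k choose j) *
      ((1 - (1 - r\<^sup>2) powr (\<alpha> + 1 + real j)) / (2 * (\<alpha> + 1 + real j))))"

lemma inc_beta_0 [simp]: "inc_beta \<alpha> k 0 = 0"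
  by (simp add: inc_beta_def)

lemma continuous_on_inc_beta:
  assumes "\<alpha> > -1"
  shows "continuous_on {0..1} (inc_beta \<alpha> k)"
proof -
  have *: "0 \<le> 1 - x\<^sup>2" if "x \<in> {0..1}" for x :: real
  proof -
    have "x\<^sup>2 \<le> 1" using that by (auto intro: power_le_one)
    then show ?thesis by linarith
  qed
  have "continuous_on {0..1} (\<lambda>x::real. (1 - x\<^sup>2) powr (\<alpha> + 1 + real j))" for j
    by (rule continuous_on_powr') (use * assms in \<open>auto intro!: continuous_intros\<close>)
  moreover have "2 * (\<alpha> + 1 + real j) \<noteq> 0" for j
  proof -
    have "\<alpha> + 1 + real j > 0" using assms by linarith
    then show ?thesis by simp
  qed
  ultimately show ?thesis
    unfolding inc_beta_def[abs_def]
    by (intro continuous_on_sum continuous_on_mult continuous_on_divide continuous_on_diff continuous_on_const) auto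
qed

lemma inc_beta_deriv:
  assumes \<alpha>: "\<alpha> > -1" and r: "0 < r" "r < 1"
  shows "(inc_beta \<alpha> k has_real_derivative r ^ (2 * k + 1) * (1 - r\<^sup>2) powr \<alpha>) (at r)"
proof -
  have r2: "1 - r\<^sup>2 > 0" using r by (simp add: power_less_one_iff)
  have "(inc_beta \<alpha> k has_real_derivative 
     (\<Sum>j\<le>k. (-1) ^ j * of_nat (k choose j) * (r * (1 - r\<^sup>2) powr (\<alpha> + real j)))) (at r)"
    unfolding inc_beta_def[abs_def]
  proof (intro DERIV_sum DERIV_cmult)
    fix j
    have b: "\<alpha> + 1 + real j > 0" using \<alpha> by linarith
    have "((\<lambda>r. 1 - r\<^sup>2) has_real_derivative - (2 * r)) (at r)"
      by (auto intro!: derivative_eq_intros)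
    from DERIV_chain2[OF has_real_derivative_powr[OF r2, of "\<alpha> + 1 + real j"] this]
    have "((\<lambda>r. (1 - r\<^sup>2) powr (\<alpha> + 1 + real j)) has_real_derivative 
        (\<alpha> + 1 + real j) * (1 - r\<^sup>2) powr (\<alpha> + 1 + real j - 1) * - (2 * r)) (at r)" .
    from DERIV_cdivide[OF DERIV_diff[OF DERIV_const[of 1] this], of "2 * (\<alpha> + 1 + real j)"]
    show "((\<lambda>r. (1 - (1 - r\<^sup>2) powr (\<alpha> + 1 + real j)) / (2 * (\<alpha> + 1 + real j))) has_real_derivative
       r * (1 - r\<^sup>2) powr (\<alpha> + real j)) (at r)"
      by (rule DERIV_cong) (use b in \<open>simp add: field_simps\<close>)
  qed
  also have "(\<Sum>j\<le>k. (-1) ^ j * of_nat (k choose j) * (r * (1 - r\<^sup>2) powr (\<alpha> + real j))) = 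
     r * (1 - r\<^sup>2) powr \<alpha> * (\<Sum>j\<le>k. of_nat (k choose j) * (- (1 - r\<^sup>2)) ^ j * 1 ^ (k - j))"
    unfolding sum_distrib_left
  proof (rule sum.cong)
    fix j
    have "(1 - r\<^sup>2) powr (\<alpha> + real j) = (1 - r\<^sup>2) powr \<alpha> * (1 - r\<^sup>2) ^ j"
      using r2 by (simp add: powr_add powr_realpow)
    moreover have "(- (1 - r\<^sup>2)) ^ j = (-1) ^ j * (1 - r\<^sup>2) ^ j" by (rule power_minus)
    ultimately show "(-1) ^ j * of_nat (k choose j) * (r * (1 - r\<^sup>2) powr (\<alpha> + real j)) =
        r * (1 - r\<^sup>2) powr \<alpha> * (of_nat (k choose j) * (- (1 - r\<^sup>2)) ^ j * 1 ^ (k - j))"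
      by (simp only: power_one mult_ac)
  qed simp
  also have "\<dots> = r * (1 - r\<^sup>2) powr \<alpha> * (- (1 - r\<^sup>2) + 1) ^ k"
    by (simp only: binomial_ring)
  also have "\<dots> = r ^ (2 * k + 1) * (1 - r\<^sup>2) powr \<alpha>"
    by (simp add: power_mult)
  finally show ?thesis .
qed

lemma inc_beta_pos:
  assumes \<alpha>: "\<alpha> > -1" and r: "0 < r" "r \<le> 1"
  shows "inc_beta \<alpha> k r > 0"
proof -
  have "inc_beta \<alpha> k 0 < inc_beta \<alpha> k r"
  proof (rule DERIV_pos_imp_increasing_open[OF r(1)])
    fix x assume x: "0 < x" "x < r"
    have "(inc_beta \<alpha> k has_real_derivative x ^ (2 * k + 1) * (1 - x\<^sup>2) powr \<alpha>) (at x)"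
      by (rule inc_beta_deriv[OF \<alpha>]) (use x r in auto)
    moreover have "1 - x\<^sup>2 > 0" using x r by (simp add: power_less_one_iff)
    then have "x ^ (2 * k + 1) * (1 - x\<^sup>2) powr \<alpha> > 0" using x by simp
    ultimately show "\<exists>y. (inc_beta \<alpha> k has_real_derivative y) (at x) \<and> 0 < y" by blast
  qed (use r continuous_on_subset[OF continuous_on_inc_beta[OF \<alpha>]] in auto)
  then show ?thesis by simp
qed

text \<open>The profile of mode m for a solution regular at 0: r^m for m \<ge> 0, and for m = -(k+1)
  a multiple of r^m times the integral of s^(2k+1) (1 - s^2)^\<alpha> over [0,r]. The value 1 at r =
  1 makes the multiples of different profiles comparable on the boundary circle.\<close>

definition radial_factor :: "real \<Rightarrow> int \<Rightarrow> real \<Rightarrow> real" where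
  "radial_factor \<alpha> m r = (if m \<ge> 0 then 1 else 
      inc_beta \<alpha> (nat (- m - 1)) r / inc_beta \<alpha> (nat (- m - 1)) 1) * r powi m"

lemma radial_factor_pos:
  assumes "\<alpha> > -1" "0 < r" "r \<le> 1"
  shows "radial_factor \<alpha> m r > 0"
  using assms by (auto simp: radial_factor_def inc_beta_pos)

lemma radial_factor_tendsto:
  assumes "\<alpha> > -1" "\<And>n. 0 < s n \<and> s n \<le> 1" "s \<longlonglongrightarrow> 1"
  shows "(\<lambda>n. radial_factor \<alpha> m (s n)) \<longlonglongrightarrow> 1"
proof -
  have p: "(\<lambda>n. s n powi m) \<longlonglongrightarrow> 1 powi m"
    by (intro tendsto_power_int assms) auto
  have "(\<lambda>n. inc_beta \<alpha> k (s n)) \<longlonglongrightarrow> inc_beta \<alpha> k 1" for k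
    by (rule continuous_on_tendsto_compose[OF continuous_on_inc_beta[OF assms(1)] assms(3)])
      (use assms(2) in \<open>auto simp: less_imp_le\<close>)
  then have "(\<lambda>n. inc_beta \<alpha> k (s n) / inc_beta \<alpha> k 1) \<longlonglongrightarrow> inc_beta \<alpha> k 1 / inc_beta \<alpha> k 1" for k
    by (intro tendsto_divide tendsto_const) (use inc_beta_pos[OF assms(1), of 1 k] in auto)
  moreover have "inc_beta \<alpha> k 1 \<noteq> 0" for k using inc_beta_pos[OF assms(1), of 1 k] by simp
  ultimately have b: "(\<lambda>n. inc_beta \<alpha> k (s n) / inc_beta \<alpha> k 1) \<longlonglongrightarrow> 1" for k by simp
  show ?thesis
  proof (cases "m \<ge> 0")
    case True
    then show ?thesis using p by (simp add: radial_factor_def)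
  next
    case False
    then show ?thesis using tendsto_mult[OF b p] by (simp add: radial_factor_def)
  qed
qed

text \<open>Counterpart of \<open>alpha_system\<close> with 1 - |z|^2 in place of y. The
  antiholomorphic factor is stored as a conjugate so that the results on holomorphic functions apply
  to \<open>F\<close>.\<close>

definition disc_system :: "real \<Rightarrow> (complex \<Rightarrow> complex) \<Rightarrow> bool" where
  "disc_system \<alpha> V \<longleftrightarrow> (\<exists>p q F. has_wirtinger V p q (ball 0 1) \<and> F holomorphic_on ball 0 1 \<and>
     (\<forall>z\<in>ball 0 1. q z = of_real ((1 - (cmod z)\<^sup>2) powr \<alpha>) * cnj (F z)))"

text \<open>For solutions the radius is immaterial by \<open>circle_fourier_disc_system\<close>;
  fixing it gives a functional defined for any continuous V.\<close>

definition disc_coeff :: "real \<Rightarrow> (complex \<Rightarrow> complex) \<Rightarrow> int \<Rightarrow> complex" where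
  "disc_coeff \<alpha> V m = circle_fourier V m (1/2) / of_real (radial_factor \<alpha> m (1/2))"

lemma circle_fourier_disc_dbar:
  assumes q: "\<And>z. z \<in> ball 0 1 \<Longrightarrow> q z = of_real ((1 - (cmod z)\<^sup>2) powr \<alpha>) * cnj (F z)"
    and r: "0 < r" "r < 1"
  shows "circle_fourier q m r = of_real ((1 - r\<^sup>2) powr \<alpha>) * cnj (circle_fourier F (- m) r)"
proof -
  have "circle_fourier q m r = integral {0..2 * pi} (\<lambda>t. of_real ((1 - r\<^sup>2) powr \<alpha>) * 
      cnj (F (of_real r * cis t) * cis (- (of_int (- m) * t))))"
    unfolding circle_fourier_def
  proof (rule integral_cong)
    fix t
    have "q (of_real r * cis t) = of_real ((1 - r\<^sup>2) powr \<alpha>) * cnj (F (of_real r * cis t))"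
      using q[of "of_real r * cis t"] r by (simp add: norm_mult)
    then show "q (of_real r * cis t) * cis (- (of_int m * t)) = of_real ((1 - r\<^sup>2) powr \<alpha>) * 
      cnj (F (of_real r * cis t) * cis (- (of_int (- m) * t)))"
      by (simp add: cis_cnj)
  qed
  also have "\<dots> = of_real ((1 - r\<^sup>2) powr \<alpha>) * 
      integral {0..2 * pi} (\<lambda>t. cnj (F (of_real r * cis t) * cis (- (of_int (- m) * t))))"
    by (rule integral_mult_right)
  also have "integral {0..2 * pi} (\<lambda>t. cnj (F (of_real r * cis t) * cis (- (of_int (- m) * t)))) = 
     cnj (circle_fourier F (- m) r)"
    by (simp add: circle_fourier_def integral_cnj)
  finally show ?thesis .
qed

text \<open>Mode m of V is driven by mode -m-1 of \<open>F\<close>. For m \<ge> 0 that index is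
  negative, so r^(-m) c_m is constant. For m = -(k+1) its derivative is a multiple of r^(2k+1) (1 -
  r^2)^\<alpha>, which \<open>inc_beta\<close> integrates.\<close>

lemma circle_fourier_disc_system:
  assumes V: "disc_system \<alpha> V" and \<alpha>: "\<alpha> > -1" and r: "0 < r" "r < 1"
  shows "circle_fourier V m r = disc_coeff \<alpha> V m * of_real (radial_factor \<alpha> m r)"
proof -
  obtain p q F where w: "has_wirtinger V p q (ball 0 1)" and F: "F holomorphic_on ball 0 1"
    and q: "\<And>z. z \<in> ball 0 1 \<Longrightarrow> q z = of_real ((1 - (cmod z)\<^sup>2) powr \<alpha>) * cnj (F z)"
    using V unfolding disc_system_def by blast
  obtain \<gamma> where \<gamma>: "\<And>m r. 0 < r \<Longrightarrow> r < 1 \<Longrightarrow> circle_fourier F m r = \<gamma> m * of_real (r powi m)"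
    "\<And>m. m < 0 \<Longrightarrow> \<gamma> m = 0"
    using holomorphic_circle_fourier[OF F] by (metis zero_less_one)
  define J where "J = (\<lambda>r. of_real (r powi (- m)) * circle_fourier V m r)"
  have J: "(J has_vector_derivative 2 * of_real (r powi (- m)) * of_real ((1 - r\<^sup>2) powr \<alpha>) * 
      cnj (\<gamma> (- m - 1)) * of_real (r powi (- m - 1))) (at r)" if r: "0 < r" "r < 1" for r
    using circle_fourier_deriv[OF w r, of m] circle_fourier_disc_dbar[OF q r, of "m + 1"] \<gamma>(1)[OF r, of "- m - 1"]
    by (simp add: J_def mult.assoc)
  have "\<exists>c. \<forall>r. 0 < r \<and> r < 1 \<longrightarrow> circle_fourier V m r = c * of_real (radial_factor \<alpha> m r)"
  proof (cases "m \<ge> 0")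
    case True
    have "(J has_vector_derivative 0) (at r)" if "0 < r" "r < 1" for r
      using J[OF that] \<gamma>(2)[of "- m - 1"] True by simp
    from constant_on_interval[of 1, OF this] obtain c where "\<And>r. 0 < r \<Longrightarrow> r < 1 \<Longrightarrow> J r = c" by blast
    then have "circle_fourier V m r = c * of_real (radial_factor \<alpha> m r)" if "0 < r" "r < 1" for r
      using that True by (auto simp: J_def radial_factor_def power_int_minus field_simps)
    then show ?thesis by blast
  next
    case False
    define k where "k = nat (- m - 1)"
    have k: "m = - int (Suc k)" using False by (simp add: k_def)
    have pw: "r powi (- m) = r ^ Suc k" "r powi (- m - 1) = r ^ k" for r :: real
    proof -
      have "- m = int (Suc k)" "- m - 1 = int k" using k by auto
      then show "r powi (- m) = r ^ Suc k" "r powi (- m - 1) = r ^ k" by (simp_all only: power_int_of_nat)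
    qed
    define d where "d = 2 * cnj (\<gamma> (- m - 1))"
    have "((\<lambda>r. J r - d * of_real (inc_beta \<alpha> k r)) has_vector_derivative 0) (at r)" if r: "0 < r" "r < 1" for r
    proof -
      have "((\<lambda>r. d * complex_of_real (inc_beta \<alpha> k r)) has_vector_derivative 
        d * of_real (r ^ (2 * k + 1) * (1 - r\<^sup>2) powr \<alpha>)) (at r)"
        by (intro has_vector_derivative_mult_right has_vector_derivative_of_real inc_beta_deriv \<alpha> r)
      from has_vector_derivative_diff[OF J[OF r] this]
      have D: "((\<lambda>r. J r - d * of_real (inc_beta \<alpha> k r)) has_vector_derivative
        2 * of_real (r ^ Suc k) * of_real ((1 - r\<^sup>2) powr \<alpha>) * cnj (\<gamma> (- m - 1)) * of_real (r ^ k)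
        - d * of_real (r ^ (2 * k + 1) * (1 - r\<^sup>2) powr \<alpha>)) (at r)" by (simp only: pw)
      have "r ^ (2 * k + 1) = r ^ Suc k * r ^ k" by (simp add: power_add[symmetric] mult_2)
      then have "complex_of_real (r ^ (2 * k + 1) * (1 - r\<^sup>2) powr \<alpha>) = of_real (r ^ Suc k) * of_real (r ^ k) * of_real ((1 - r\<^sup>2) powr \<alpha>)"
        by (simp only: of_real_mult)
      with D show ?thesis
        unfolding d_def by (simp only: mult_ac diff_self)
    qed
    from constant_on_interval[of 1, OF this] obtain c where c: "\<And>r. 0 < r \<Longrightarrow> r < 1 \<Longrightarrow> 
      J r - d * of_real (inc_beta \<alpha> k r) = c" by blast
    obtain B where B: "\<And>r. 0 < r \<Longrightarrow> r \<le> 1 / 2 \<Longrightarrow> norm (circle_fourier V m r) \<le> B"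
      using circle_fourier_bounded[OF has_wirtinger_continuous_on[OF w] zero_less_one] by blast
    have i0: "((\<lambda>r. inc_beta \<alpha> k r) \<longlongrightarrow> 0) (at_right 0)" 
      using continuous_on_Icc_at_rightD[OF continuous_on_inc_beta[OF \<alpha>], of k] by simp
    have "((\<lambda>r. B * r ^ Suc k + norm d * inc_beta \<alpha> k r) \<longlongrightarrow> B * 0 ^ Suc k + norm d * 0) (at_right (0::real))"
      by (intro tendsto_intros i0)
    then have lim0: "((\<lambda>r. B * r ^ Suc k + norm d * inc_beta \<alpha> k r) \<longlongrightarrow> 0) (at_right (0::real))"
      by simp
    \<comment> \<open>The constant of integration is 0, as r^(k+1) c_m(r) and
      \<open>inc_beta\<close> both tend to 0 at the centre.\<close>
    have "norm c \<le> 0"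
    proof (rule tendsto_lowerbound[OF lim0])
      show "\<forall>\<^sub>F r in at_right 0. norm c \<le> B * r ^ Suc k + norm d * inc_beta \<alpha> k r"
        unfolding eventually_at_right_field
      proof (intro exI[of _ "1/2"] conjI allI impI)
        fix r :: real assume r: "0 < r" "r < 1/2"
        have "norm c \<le> norm (J r) + norm (d * of_real (inc_beta \<alpha> k r))"
          using c[of r] r norm_triangle_ineq4[of "J r" "d * of_real (inc_beta \<alpha> k r)"] by simp
        also have "norm (d * of_real (inc_beta \<alpha> k r)) = norm d * inc_beta \<alpha> k r"
          using inc_beta_pos[OF \<alpha>, of r k] r by (simp add: norm_mult)
        also have "norm (J r) = r ^ Suc k * norm (circle_fourier V m r)"
          using r by (simp add: J_def pw norm_mult norm_power)
        also have "\<dots> \<le> r ^ Suc k * B" using B[of r] r by (intro mult_left_mono) auto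
        finally show "norm c \<le> B * r ^ Suc k + norm d * inc_beta \<alpha> k r" by (simp add: mult.commute)
      qed auto
    qed simp
    then have c0: "c = 0" by simp
    have "circle_fourier V m r = d * of_real (inc_beta \<alpha> k 1) * of_real (radial_factor \<alpha> m r)"
      if r: "0 < r" "r < 1" for r
    proof -
      have i1: "inc_beta \<alpha> k 1 \<noteq> 0" using inc_beta_pos[OF \<alpha>, of 1 k] by simp
      have "of_real (r powi (- m)) * circle_fourier V m r = d * of_real (inc_beta \<alpha> k r)"
        using c[OF r] c0 by (simp add: J_def)
      then have "circle_fourier V m r = d * of_real (inc_beta \<alpha> k r) * of_real (r powi m)"
        using r by (simp add: power_int_minus field_simps)
      then show ?thesis using False i1 by (simp add: radial_factor_def flip: k_def)
    qed
    then show ?thesis by blast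
  qed
  then obtain c where c: "\<And>r. 0 < r \<Longrightarrow> r < 1 \<Longrightarrow> circle_fourier V m r = c * of_real (radial_factor \<alpha> m r)"
    by blast
  have "disc_coeff \<alpha> V m = c"
    using c[of "1/2"] radial_factor_pos[OF \<alpha>, of "1/2" m] by (simp add: disc_coeff_def)
  then show ?thesis using c r by simp
qed

lemma disc_system_eq_0:
  assumes V: "disc_system \<alpha> V" and \<alpha>: "\<alpha> > -1" and c: "\<And>m. disc_coeff \<alpha> V m = 0"
  shows "\<forall>z\<in>ball 0 1. V z = 0"
proof -
  obtain p q F where w: "has_wirtinger V p q (ball 0 1)" and F: "F holomorphic_on ball 0 1"
    and q: "\<And>z. z \<in> ball 0 1 \<Longrightarrow> q z = of_real ((1 - (cmod z)\<^sup>2) powr \<alpha>) * cnj (F z)"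
    using V unfolding disc_system_def by blast
  have J0: "circle_fourier V m r = 0" if "0 < r" "r < 1" for m r
    using circle_fourier_disc_system[OF V \<alpha> that] c by simp
  have "circle_fourier F m r = 0" if r: "0 < r" "r < 1" for m r
  proof -
    define m' where "m' = - m - 1"
    have "((\<lambda>r. 0) has_vector_derivative (0::complex)) (at r)" by simp
    then have "((\<lambda>r. of_real (r powi (- m')) * circle_fourier V m' r) has_vector_derivative 0) (at r)"
      by (rule has_vector_derivative_transform_within_open[where S = "{0<..<1}"]) (use J0 r in auto)
    from vector_derivative_unique_at[OF this circle_fourier_deriv[OF w r]]
    have "circle_fourier q (m' + 1) r = 0" using r by simp
    moreover have "1 - r\<^sup>2 > 0" using r by (simp add: power_less_one_iff)
    ultimately show ?thesis
      using circle_fourier_disc_dbar[OF q r, of "m' + 1"] by (simp add: m'_def)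
  qed
  from circle_fourier_eq_0_imp_holomorphic_eq_0[OF F zero_less_one this]
  have "q z = 0" if "z \<in> ball 0 1" for z using q[OF that] that by simp
  then have "V holomorphic_on ball 0 1"
    using has_wirtinger_imp_holomorphic[OF w] by simp
  from circle_fourier_eq_0_imp_holomorphic_eq_0[OF this zero_less_one] J0
  show ?thesis by blast
qed

text \<open>Multiplying \<open>V\<close> by \<open>(1 - e\<^bsup>it\<^esup>)\<^sup>M\<close> kills the singularity at \<open>1\<close> and turns the coefficients
  into their \<open>M\<close>-th differences.\<close>

lemma disc_coeff_differences_eq_0:
  assumes V: "disc_system \<alpha> V" and \<alpha>: "\<alpha> > -1" and M: "M > 0"
    and bound: "\<And>z. z \<in> ball 0 1 \<Longrightarrow> cmod (V z) * cmod (1 - z) ^ M \<le> C"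
    and lim: "\<And>t. 0 < t \<Longrightarrow> t < 2 * pi \<Longrightarrow> (\<lambda>n. V (of_real (1 - 1 / (real n + 2)) * cis t)) \<longlonglongrightarrow> 0"
  shows "(\<Sum>j\<le>M. (-1) ^ j * of_nat (M choose j) * disc_coeff \<alpha> V (m - int j)) = 0"
proof -
  define s where "s = (\<lambda>n. 1 - 1 / (real n + 2))"
  have s: "0 < s n" "s n < 1" for n by (auto simp: s_def field_simps)
  have s1: "s \<longlonglongrightarrow> 1" unfolding s_def by real_asymp
  obtain p q where w: "has_wirtinger V p q (ball 0 1)" using V unfolding disc_system_def by blast
  note Vc = has_wirtinger_continuous_on[OF w]
  define f where "f = (\<lambda>n t. V (of_real (s n) * cis t) * (1 - cis t) ^ M * cis (- (of_int m * t)))"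
  have "(\<lambda>n. integral {0..2 * pi} (f n)) \<longlonglongrightarrow> integral {0..2 * pi} (\<lambda>t. 0)"
  proof (rule dominated_convergence(2))
    show "f n integrable_on {0..2 * pi}" for n
      unfolding f_def using s
      by (intro integrable_continuous_interval continuous_on_mult continuous_on_circle[OF Vc] continuous_intros) auto
    show "(\<lambda>t. C * 2 ^ M) integrable_on {0..2 * pi}" by auto
    fix n t assume t: "t \<in> {0..2 * pi}"
    define z where "z = of_real (s n) * cis t"
    have z: "z \<in> ball 0 1" using s[of n] by (simp add: z_def norm_mult)
    \<comment> \<open>The radial distance from z to the unit circle is at most |1 - z|, so |1 -
      e^(it)| \<le> 2 |1 - z|. This turns the bound at z into a constant majorant.\<close>
    have "cmod (1 - cis t) \<le> cmod (1 - z) + cmod (z - cis t)"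
      using norm_triangle_ineq[of "1 - z" "z - cis t"] by simp
    also have "z - cis t = of_real (s n - 1) * cis t" by (simp add: z_def algebra_simps)
    also have "cmod (of_real (s n - 1) * cis t) = 1 - cmod z" using s[of n] by (simp add: z_def norm_mult del: of_real_diff)
    also have "1 - cmod z \<le> cmod (1 - z)" using norm_triangle_ineq2[of 1 z] by simp
    finally have "cmod (1 - cis t) \<le> 2 * cmod (1 - z)" by simp
    then have "cmod (1 - cis t) ^ M \<le> (2 * cmod (1 - z)) ^ M" by (intro power_mono) auto
    then have "cmod (V z) * cmod (1 - cis t) ^ M \<le> cmod (V z) * (2 * cmod (1 - z)) ^ M"
      by (intro mult_left_mono) auto
    also have "\<dots> = cmod (V z) * cmod (1 - z) ^ M * 2 ^ M" by (simp add: power_mult_distrib)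
    also have "\<dots> \<le> C * 2 ^ M" by (intro mult_right_mono bound z) auto
    finally show "norm (f n t) \<le> C * 2 ^ M" by (simp add: f_def norm_mult norm_power z_def)
  next
    fix t assume t: "t \<in> {0..2 * pi}"
    show "(\<lambda>n. f n t) \<longlonglongrightarrow> 0"
    proof (cases "0 < t \<and> t < 2 * pi")
      case True
      then have "(\<lambda>n. V (of_real (s n) * cis t)) \<longlonglongrightarrow> 0" using lim by (simp add: s_def)
      from tendsto_mult_right[OF this, of "(1 - cis t) ^ M * cis (- (of_int m * t))"]
      show ?thesis by (simp add: f_def mult.assoc)
    next
      case False
      \<comment> \<open>At the endpoints no limit is assumed; there the factor (1 - e^(it))^M is 0
        because M > 0.\<close>
      then have "cis t = 1" using t by auto
      then show ?thesis using M by (simp add: f_def power_0_left)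
    qed
  qed
  then have lim1: "(\<lambda>n. integral {0..2 * pi} (f n)) \<longlonglongrightarrow> 0" by simp
  have "integral {0..2 * pi} (f n) = (\<Sum>j\<le>M. (-1) ^ j * of_nat (M choose j) * 
      (disc_coeff \<alpha> V (m - int j) * of_real (radial_factor \<alpha> (m - int j) (s n))))" for n
  proof -
    have "f n t = (\<Sum>j\<le>M. (-1) ^ j * of_nat (M choose j) * (V (of_real (s n) * cis t) * cis (- (of_int (m - int j) * t))))" for t
    proof -
      have "(1 - cis t) ^ M = (\<Sum>j\<le>M. of_nat (M choose j) * (- cis t) ^ j * 1 ^ (M - j))"
        using binomial_ring[of "- cis t" 1 M] by simp
      then have "f n t = (\<Sum>j\<le>M. V (of_real (s n) * cis t) * (of_nat (M choose j) * (- cis t) ^ j) * cis (- (of_int m * t)))"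
        unfolding f_def by (simp add: sum_distrib_left sum_distrib_right)
      also have "\<dots> = (\<Sum>j\<le>M. (-1) ^ j * of_nat (M choose j) * (V (of_real (s n) * cis t) * cis (- (of_int (m - int j) * t))))"
      proof (rule sum.cong)
        fix j
        have "(- cis t) ^ j * cis (- (of_int m * t)) = (-1) ^ j * cis (- (of_int (m - int j) * t))"
        proof -
          have "(- cis t) ^ j = (-1) ^ j * cis (real j * t)"
            by (simp add: power_minus[of "cis t"] Complex.DeMoivre)
          then show ?thesis by (simp add: cis_mult mult.assoc) (simp add: algebra_simps)
        qed
        then show "V (of_real (s n) * cis t) * (of_nat (M choose j) * (- cis t) ^ j) * cis (- (of_int m * t)) =
          (-1) ^ j * of_nat (M choose j) * (V (of_real (s n) * cis t) * cis (- (of_int (m - int j) * t)))"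
          by (simp add: mult.left_commute mult.assoc)
      qed simp
      finally show ?thesis .
    qed
    then have "integral {0..2 * pi} (f n) = integral {0..2 * pi} (\<lambda>t. \<Sum>j\<le>M. (-1) ^ j * of_nat (M choose j) * (V (of_real (s n) * cis t) * cis (- (of_int (m - int j) * t))))"
      by presburger
    also have "\<dots> = (\<Sum>j\<le>M. integral {0..2 * pi} (\<lambda>t. (-1) ^ j * of_nat (M choose j) * (V (of_real (s n) * cis t) * cis (- (of_int (m - int j) * t)))))"
      by (intro integral_sum finite_atMost integrable_on_mult_right circle_fourier_integrable[OF Vc s])
    also have "\<dots> = (\<Sum>j\<le>M. (-1) ^ j * of_nat (M choose j) * circle_fourier V (m - int j) (s n))"
      unfolding circle_fourier_def by (simp only: integral_mult_right)
    finally show ?thesis by (simp only: circle_fourier_disc_system[OF V \<alpha> s])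
  qed
  moreover have "(\<lambda>n. \<Sum>j\<le>M. (-1) ^ j * of_nat (M choose j) * 
      (disc_coeff \<alpha> V (m - int j) * of_real (radial_factor \<alpha> (m - int j) (s n)))) \<longlonglongrightarrow> 
     (\<Sum>j\<le>M. (-1) ^ j * of_nat (M choose j) * (disc_coeff \<alpha> V (m - int j) * of_real 1))"
    by (intro tendsto_intros radial_factor_tendsto \<alpha> s1) (use s in \<open>auto simp: less_imp_le\<close>)
  ultimately have "(\<lambda>n. integral {0..2 * pi} (f n)) \<longlonglongrightarrow> 
     (\<Sum>j\<le>M. (-1) ^ j * of_nat (M choose j) * (disc_coeff \<alpha> V (m - int j) * of_real 1))" by simp
  from LIMSEQ_unique[OF this lim1] show ?thesis by simp
qed

section \<open>The Cayley transform\<close>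

definition cayley :: "complex \<Rightarrow> complex" where
  "cayley w = \<i> * (1 + w) / (1 - w)"

lemma one_minus_unit_ball:
  assumes "w \<in> ball 0 1"
  shows "1 - w \<noteq> 0" "Re (1 - w) > 0" "1 - w \<notin> \<real>\<^sub>\<le>\<^sub>0"
proof -
  have "\<bar>Re w\<bar> < 1" using abs_Re_le_cmod[of w] assms by simp
  then show "Re (1 - w) > 0" by simp
  then show "1 - w \<noteq> 0" "1 - w \<notin> \<real>\<^sub>\<le>\<^sub>0" by (auto simp: complex_nonpos_Reals_iff)
qed

lemma Im_cayley:
  assumes "w \<noteq> 1"
  shows "Im (cayley w) = (1 - (cmod w)\<^sup>2) / (cmod (1 - w))\<^sup>2"
proof -
  have "cayley w = \<i> * (1 + w) * cnj (1 - w) / (of_real ((cmod (1 - w))\<^sup>2))"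
    unfolding cayley_def by (rule complex_div_cnj)
  moreover have "Im (\<i> * (1 + w) * cnj (1 - w)) = 1 - (cmod w)\<^sup>2"
    unfolding cmod_power2 by (simp add: algebra_simps power2_eq_square)
  ultimately show ?thesis by (simp only: Im_divide_of_real)
qed

lemma cayley_in_uhp: "w \<in> ball 0 1 \<Longrightarrow> cayley w \<in> uhp"
  using one_minus_unit_ball[of w] Im_cayley[of w] by (auto simp: power_less_one_iff)

lemma holomorphic_cayley: "cayley holomorphic_on ball 0 1"
  unfolding cayley_def[abs_def] using one_minus_unit_ball(1)
  by (intro holomorphic_intros) auto

lemma cayley_surj:
  assumes "z \<in> uhp"
  obtains w where "w \<in> ball 0 1" "cayley w = z"
proof
  define w where "w = (z - \<i>) / (z + \<i>)"
  have n: "z + \<i> \<noteq> 0" using assms by (auto simp: complex_eq_iff)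
  have "(cmod (z - \<i>))\<^sup>2 < (cmod (z + \<i>))\<^sup>2"
    using assms unfolding cmod_power2 by (simp add: power2_eq_square algebra_simps)
  then have "cmod (z - \<i>) < cmod (z + \<i>)"
    by (rule power_less_imp_less_base) simp
  then show "w \<in> ball 0 1" using n by (simp add: w_def norm_divide)
  have "1 + w = 2 * z / (z + \<i>)" "1 - w = 2 * \<i> / (z + \<i>)"
    using n by (simp_all add: w_def field_simps)
  then show "cayley w = z" using n by (simp add: cayley_def)
qed

lemma norm_powr_of_real:
  assumes "w \<noteq> 0"
  shows "cmod (w powr of_real a) = cmod w powr a"
  using assms by (simp add: powr_def)

text \<open>The factor \<open>(1 - w)\<^sup>\<alpha>\<close> makes the lift of a solution on the half-plane a solution on the disc.\<close>

definition disc_lift :: "real \<Rightarrow> (complex \<Rightarrow> complex) \<Rightarrow> complex \<Rightarrow> complex" where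
  "disc_lift \<alpha> u w = (1 - w) powr of_real \<alpha> * u (cayley w)"

text \<open>Im (cayley w) carries the denominator |1 - w|^2, and |1 - w|^(2 \<alpha>) is (1 -
  w)^\<alpha> times its conjugate. So the holomorphic factor (1 - w)^\<alpha> replaces the weight
  y^\<alpha> by (1 - |w|^2)^\<alpha> and leaves only an antiholomorphic factor, which may join the
  conjugate of \<open>F\<close>.\<close>

lemma powr_conjugate_factor:
  assumes "w \<in> ball 0 1"
  shows "(1 - w) powr of_real \<alpha> * of_real (Im (cayley w) powr \<alpha>) =
     of_real ((1 - (cmod w)\<^sup>2) powr \<alpha>) * cnj ((1 - w) powr (- of_real \<alpha>))"
proof -
  define z where "z = 1 - w"
  define L where "L = Ln z"
  have z: "z \<noteq> 0" using one_minus_unit_ball[OF assms] by (simp add: z_def)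
  have n: "cmod z = exp (Re L)" using z by (simp add: L_def)
  have y: "Im (cayley w) = (1 - (cmod w)\<^sup>2) / (cmod z)\<^sup>2"
    using Im_cayley z by (simp add: z_def)
  have "Im (cayley w) powr \<alpha> = (1 - (cmod w)\<^sup>2) powr \<alpha> / ((cmod z)\<^sup>2) powr \<alpha>"
    unfolding y by (rule powr_divide)
  also have "((cmod z)\<^sup>2) powr \<alpha> = exp (2 * \<alpha> * Re L)"
    by (simp add: n powr_def power2_eq_square flip: exp_add)
  finally have I: "Im (cayley w) powr \<alpha> = (1 - (cmod w)\<^sup>2) powr \<alpha> * exp (- (2 * \<alpha> * Re L))"
    by (simp add: exp_minus divide_inverse)
  have "z powr of_real \<alpha> * of_real (exp (- (2 * \<alpha> * Re L))) = exp (of_real \<alpha> * L + of_real (- (2 * \<alpha> * Re L)))"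
    using z by (simp only: powr_def L_def[symmetric] if_False exp_add exp_of_real)
  also have "of_real \<alpha> * L + of_real (- (2 * \<alpha> * Re L)) = cnj (- of_real \<alpha> * L)"
    by (simp add: complex_eq_iff)
  also have "exp (cnj (- of_real \<alpha> * L)) = cnj (z powr (- of_real \<alpha>))"
    using z by (simp add: powr_def exp_cnj flip: L_def)
  finally have E: "z powr of_real \<alpha> * of_real (exp (- (2 * \<alpha> * Re L))) = cnj (z powr (- of_real \<alpha>))" .
  have "a * (b * d) = b * c" if "a * d = c" for a b c d :: complex
    using that by (simp add: mult.left_commute)
  from this[OF E] show ?thesis unfolding I z_def[symmetric] of_real_mult .
qed

lemma disc_system_lift:
  assumes "alpha_system \<alpha> u p k k'"
  shows "disc_system \<alpha> (disc_lift \<alpha> u)"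
proof -
  have w: "has_wirtinger u p (\<lambda>z. of_real (Im z powr \<alpha>) * k z) uhp" "has_wirtinger k (\<lambda>_. 0) k' uhp"
    using assms by (auto simp: alpha_system_def)
  have sub: "cayley ` ball 0 1 \<subseteq> uhp" using cayley_in_uhp by blast
  have hp: "(\<lambda>w. (1 - w) powr complex_of_real a) holomorphic_on ball 0 1" for a
    by (intro holomorphic_intros) (use one_minus_unit_ball in auto)
  have hp': "(\<lambda>w. (1 - w) powr (- complex_of_real a)) holomorphic_on ball 0 1" for a
    using hp[of "- a"] by simp
  define P where "P = (\<lambda>w. (1 - w) powr complex_of_real \<alpha>)"
  define F where "F = (\<lambda>w. (1 - w) powr (- of_real \<alpha>) * cnj (k (cayley w)) * deriv cayley w)"
  have "(\<lambda>z. cnj (k z)) holomorphic_on uhp"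
    by (rule has_wirtinger_imp_holomorphic[OF has_wirtinger_cnj[OF w(2)] open_uhp]) simp
  then have "(\<lambda>w. cnj (k (cayley w))) holomorphic_on ball 0 1"
    using holomorphic_on_compose_gen[OF holomorphic_cayley, of "\<lambda>z. cnj (k z)" uhp] sub by (simp add: o_def)
  then have F: "F holomorphic_on ball 0 1" unfolding F_def
    by (intro holomorphic_on_mult hp' holomorphic_deriv holomorphic_cayley) auto
  have "has_wirtinger (\<lambda>w. P w * u (cayley w))
     (\<lambda>w. P w * (p (cayley w) * deriv cayley w) + deriv P w * u (cayley w))
     (\<lambda>w. P w * (of_real (Im (cayley w) powr \<alpha>) * k (cayley w) * cnj (deriv cayley w)) + 0 * u (cayley w)) (ball 0 1)"
    unfolding P_def
    by (intro has_wirtinger_mult has_wirtinger_holomorphic hp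
         has_wirtinger_compose_holomorphic[OF w(1) holomorphic_cayley _ sub] open_ball)
  moreover have "P w * (of_real (Im (cayley w) powr \<alpha>) * k (cayley w) * cnj (deriv cayley w)) + 0 * u (cayley w) = 
     of_real ((1 - (cmod w)\<^sup>2) powr \<alpha>) * cnj (F w)" if "w \<in> ball 0 1" for w
  proof -
    have "P w * (of_real (Im (cayley w) powr \<alpha>) * k (cayley w) * cnj (deriv cayley w)) = 
      ((1 - w) powr of_real \<alpha> * of_real (Im (cayley w) powr \<alpha>)) * (k (cayley w) * cnj (deriv cayley w))"
      by (simp add: P_def mult.assoc)
    then show ?thesis unfolding powr_conjugate_factor[OF that] by (simp add: F_def mult.assoc)
  qed
  ultimately show ?thesis
    unfolding disc_system_def disc_lift_def[abs_def] P_def using F by blast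
qed

lemma norm_cayley_le:
  assumes "w \<in> ball 0 1"
  shows "1 + cmod (cayley w) \<le> 4 / cmod (1 - w)" "Im (cayley w) \<le> 2 / cmod (1 - w)"
proof -
  have w: "cmod w < 1" using assms by simp
  have p: "cmod (1 - w) > 0" using one_minus_unit_ball(1)[OF assms] by simp
  have "cmod (1 + w) \<le> 2" "cmod (1 - w) \<le> 2"
    using norm_triangle_ineq[of 1 w] norm_triangle_ineq4[of 1 w] w by auto
  then have "cmod (1 - w) + cmod (1 + w) \<le> 4" by linarith
  then have "(cmod (1 - w) + cmod (1 + w)) / cmod (1 - w) \<le> 4 / cmod (1 - w)"
    using p by (intro divide_right_mono) auto
  then show "1 + cmod (cayley w) \<le> 4 / cmod (1 - w)"
    using p by (simp add: cayley_def norm_divide norm_mult add_divide_distrib)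
  have "1 - cmod w \<le> cmod (1 - w)" using norm_triangle_ineq2[of 1 w] by simp
  moreover have "(1 - cmod w) * (1 + cmod w) \<le> (1 - cmod w) * 2" using w by (intro mult_left_mono) auto
  ultimately have "1 - (cmod w)\<^sup>2 \<le> 2 * cmod (1 - w)" by (simp add: power2_eq_square algebra_simps)
  then have "Im (cayley w) \<le> 2 * cmod (1 - w) / (cmod (1 - w))\<^sup>2"
    using Im_cayley[of w] p by (simp add: divide_right_mono)
  also have "\<dots> = 2 / cmod (1 - w)" using p by (simp add: power2_eq_square)
  finally show "Im (cayley w) \<le> 2 / cmod (1 - w)" .
qed

text \<open>b = 0 is meant for mollifications, b = \<alpha> + 1 for the homogeneous solutions. One
  extra factor |1 - w| suffices in both cases: |1 - w|^(\<alpha>+1) is bounded on the disc, and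
  since Im (cayley w) \<le> 2 / |1 - w| it also absorbs y^(\<alpha>+1). This saving gives the j-th
  homogeneous solution order j + 1, exactly what the dimension count requires.\<close>

lemma disc_lift_bound:
  assumes \<alpha>: "\<alpha> > -1" and b: "b = 0 \<or> b = \<alpha> + 1" and C: "C \<ge> 0"
    and u: "\<And>z. z \<in> uhp \<Longrightarrow> cmod (u z) \<le> C * Im z powr b * (1 + cmod z) ^ n"
    and w: "w \<in> ball 0 1"
  shows "cmod (disc_lift \<alpha> u w) * cmod (1 - w) ^ Suc n \<le> 2 powr (\<alpha> + 1) * C * 4 ^ n"
proof -
  define d where "d = cmod (1 - w)"
  have d: "d > 0" "d \<le> 2"
    using one_minus_unit_ball(1)[OF w] norm_triangle_ineq4[of 1 w] w by (auto simp: d_def)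
  have z: "cayley w \<in> uhp" by (rule cayley_in_uhp[OF w])
  have n: "(1 + cmod (cayley w)) ^ n \<le> (4 / d) ^ n"
    using norm_cayley_le(1)[OF w] by (intro power_mono) (auto simp: d_def)
  have y: "d powr (\<alpha> + 1) * Im (cayley w) powr b \<le> 2 powr (\<alpha> + 1)"
  proof (cases "b = 0")
    case True
    then show ?thesis using d \<alpha> z by (auto intro: powr_mono2)
  next
    case False
    then have b: "b = \<alpha> + 1" using b by simp
    have "d powr (\<alpha> + 1) * Im (cayley w) powr b = (d * Im (cayley w)) powr (\<alpha> + 1)"
      using d z unfolding b by (simp add: powr_mult)
    also have "\<dots> \<le> 2 powr (\<alpha> + 1)"
    proof (rule powr_mono2)
      have "d * Im (cayley w) \<le> d * (2 / d)"
        using norm_cayley_le(2)[OF w] d by (intro mult_left_mono) (auto simp: d_def)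
      then show "d * Im (cayley w) \<le> 2" using d by simp
    qed (use d z \<alpha> in auto)
    finally show ?thesis .
  qed
  have "cmod (disc_lift \<alpha> u w) * d ^ Suc n = d powr \<alpha> * d * (d ^ n * cmod (u (cayley w)))"
    using d by (simp add: disc_lift_def norm_mult norm_powr_of_real d_def)
  also have "d powr \<alpha> * d = d powr (\<alpha> + 1)" using d by (simp add: powr_add)
  also have "d powr (\<alpha> + 1) * (d ^ n * cmod (u (cayley w))) \<le> 
      d powr (\<alpha> + 1) * (d ^ n * (C * Im (cayley w) powr b * (4 / d) ^ n))"
  proof (intro mult_left_mono)
    have "C * Im (cayley w) powr b * (1 + cmod (cayley w)) ^ n \<le> C * Im (cayley w) powr b * (4 / d) ^ n"
      using n C by (intro mult_left_mono) auto
    then show "cmod (u (cayley w)) \<le> C * Im (cayley w) powr b * (4 / d) ^ n"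
      using u[OF z] by linarith
  qed (use d in auto)
  also have "\<dots> = (d powr (\<alpha> + 1) * Im (cayley w) powr b) * (C * 4 ^ n)"
    using d by (simp add: power_divide)
  also have "\<dots> \<le> 2 powr (\<alpha> + 1) * (C * 4 ^ n)"
    using y C by (intro mult_right_mono) auto
  finally show ?thesis by (simp add: d_def mult.assoc)
qed

text \<open>For 0 < t < 2 pi the point e^(it) is not 1, so \<open>cayley\<close> sends it to a real
  point, and Re (1 - e^(it)) > 0 keeps (1 - w)^\<alpha> continuous there.\<close>

lemma disc_lift_tendsto_0:
  assumes u: "\<And>x. (u \<longlongrightarrow> 0) (at (of_real x) within uhp)" and t: "0 < t" "t < 2 * pi"
    and s: "s \<longlonglongrightarrow> 1" "\<And>n. 0 < s n \<and> s n < 1"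
  shows "(\<lambda>n. disc_lift \<alpha> u (of_real (s n) * cis t)) \<longlonglongrightarrow> 0"
proof -
  define w where "w = (\<lambda>n. of_real (s n) * cis t)"
  have wb: "w n \<in> ball 0 1" for n using s(2)[of n] by (simp add: w_def norm_mult)
  have wl: "w \<longlonglongrightarrow> of_real 1 * cis t"
    unfolding w_def by (intro tendsto_intros s)
  then have wl: "w \<longlonglongrightarrow> cis t" by simp
  have ne: "cis t \<noteq> 1"
  proof
    assume "cis t = 1"
    then have "cos t = 1" by (simp add: complex_eq_iff)
    then obtain n :: int where "t = of_int n * 2 * pi" using cos_one_2pi_int by auto
    with t show False by (auto simp: mult_less_cancel_right_pos zero_less_mult_iff)
  qed
  have re: "Re (1 - cis t) > 0"
  proof -
    have "cos t \<noteq> 1"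
      using ne by (metis cis.sel complex_eqI cos_one_sin_zero one_complex.sel)
    then show ?thesis using cos_le_one[of t] by (simp add: less_le)
  qed
  have "(\<lambda>n. cayley (w n)) \<longlonglongrightarrow> cayley (cis t)"
    unfolding cayley_def by (intro tendsto_intros wl) (use ne in auto)
  moreover have "cayley (cis t) = of_real (Re (cayley (cis t)))"
    using Im_cayley[OF ne] by (simp add: complex_eq_iff)
  ultimately have "(\<lambda>n. cayley (w n)) \<longlonglongrightarrow> of_real (Re (cayley (cis t)))" by simp
  moreover have "cayley (w n) \<in> uhp \<and> cayley (w n) \<noteq> of_real (Re (cayley (cis t)))" for n
    using cayley_in_uhp[OF wb[of n]] by (auto simp: complex_eq_iff)
  ultimately have "filterlim (\<lambda>n. cayley (w n)) (at (of_real (Re (cayley (cis t)))) within uhp) sequentially"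
    by (auto simp: filterlim_at)
  from filterlim_compose[OF u this] have "(\<lambda>n. u (cayley (w n))) \<longlonglongrightarrow> 0" .
  moreover have "(\<lambda>n. (1 - w n) powr of_real \<alpha>) \<longlonglongrightarrow> (1 - cis t) powr of_real \<alpha>"
    by (intro tendsto_powr_complex tendsto_intros wl) (use re in \<open>auto simp: complex_nonpos_Reals_iff\<close>)
  ultimately have "(\<lambda>n. (1 - w n) powr of_real \<alpha> * u (cayley (w n))) \<longlonglongrightarrow> (1 - cis t) powr of_real \<alpha> * 0"
    by (intro tendsto_mult)
  then show ?thesis by (simp add: disc_lift_def w_def)
qed

section \<open>Difference conditions on the lifted coefficients\<close>

text \<open>The M-th backward difference in m; it vanishes for all m iff the coefficients are a
  polynomial in m of degree below M.\<close>

definition lift_difference :: "real \<Rightarrow> nat \<Rightarrow> (complex \<Rightarrow> complex) \<Rightarrow> int \<Rightarrow> complex" where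
  "lift_difference \<alpha> M u m =
     (\<Sum>j\<le>M. (-1) ^ j * of_nat (M choose j) * disc_coeff \<alpha> (disc_lift \<alpha> u) (m - int j))"

lemma lift_difference_eq_0:
  assumes a: "alpha_system \<alpha> u p k k'" and \<alpha>: "\<alpha> > -1"
    and b: "b = 0 \<or> b = \<alpha> + 1"
    and u: "\<And>z. z \<in> uhp \<Longrightarrow> cmod (u z) \<le> C * Im z powr b * (1 + cmod z) ^ n"
    and u0: "\<And>x. (u \<longlongrightarrow> 0) (at (of_real x) within uhp)"
  shows "lift_difference \<alpha> (Suc n) u m = 0"
  unfolding lift_difference_def
proof (rule disc_coeff_differences_eq_0[OF disc_system_lift[OF a] \<alpha>])
  have "0 \<le> C * 1 powr b * (1 + cmod \<i>) ^ n"
    using order_trans[OF norm_ge_zero u[of \<i>]] by simp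
  then have "0 \<le> C * 2 ^ n" by simp
  then have C: "C \<ge> 0" by (meson mult_neg_pos not_le zero_less_numeral zero_less_power)
  show "cmod (disc_lift \<alpha> u w) * cmod (1 - w) ^ Suc n \<le> 2 powr (\<alpha> + 1) * C * 4 ^ n" if "w \<in> ball 0 1" for w
    by (rule disc_lift_bound[OF \<alpha> b C u that])
  fix t assume "0 < t" "t < 2 * pi"
  then show "(\<lambda>n. disc_lift \<alpha> u (of_real (1 - 1 / (real n + 2)) * cis t)) \<longlonglongrightarrow> 0"
    by (rule disc_lift_tendsto_0[OF u0]) (real_asymp, simp add: field_simps)
qed simp

lemma lift_difference_Suc:
  "lift_difference \<alpha> (Suc M) u m = lift_difference \<alpha> M u m - lift_difference \<alpha> M u (m - 1)"
proof -
  define f where "f = (\<lambda>j::nat. disc_coeff \<alpha> (disc_lift \<alpha> u) (m - int j))"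
  define g where "g = (\<lambda>j. (-1) ^ j * of_nat (M choose j) * f j)"
  have "lift_difference \<alpha> (Suc M) u m = f 0 + (\<Sum>j\<le>M. (-1) ^ Suc j * of_nat (Suc M choose Suc j) * f (Suc j))"
    unfolding lift_difference_def f_def by (subst sum.atMost_Suc_shift) simp
  also have "(\<Sum>j\<le>M. (-1) ^ Suc j * of_nat (Suc M choose Suc j) * f (Suc j)) = 
      (\<Sum>j\<le>M. g (Suc j)) - (\<Sum>j\<le>M. (-1) ^ j * of_nat (M choose j) * f (Suc j))"
    unfolding sum_subtractf[symmetric] by (rule sum.cong) (auto simp: g_def algebra_simps)
  also have "f 0 + ((\<Sum>j\<le>M. g (Suc j)) - (\<Sum>j\<le>M. (-1) ^ j * of_nat (M choose j) * f (Suc j))) =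
      (\<Sum>j\<le>Suc M. g j) - (\<Sum>j\<le>M. (-1) ^ j * of_nat (M choose j) * f (Suc j))"
    by (subst sum.atMost_Suc_shift) (simp add: g_def)
  also have "(\<Sum>j\<le>Suc M. g j) = lift_difference \<alpha> M u m"
    by (simp add: g_def lift_difference_def f_def)
  also have "(\<Sum>j\<le>M. (-1) ^ j * of_nat (M choose j) * f (Suc j)) = lift_difference \<alpha> M u (m - 1)"
    by (simp add: lift_difference_def f_def algebra_simps)
  finally show ?thesis .
qed

lemma continuous_on_disc_lift:
  assumes "continuous_on uhp u"
  shows "continuous_on (ball 0 1) (disc_lift \<alpha> u)"
  unfolding disc_lift_def[abs_def]
proof (intro continuous_on_mult)
  have "(\<lambda>w. (1 - w) powr complex_of_real \<alpha>) holomorphic_on ball 0 1"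
    by (intro holomorphic_intros) (use one_minus_unit_ball in auto)
  then show "continuous_on (ball 0 1) (\<lambda>w. (1 - w) powr complex_of_real \<alpha>)"
    by (rule holomorphic_on_imp_continuous_on)
  show "continuous_on (ball 0 1) (\<lambda>w. u (cayley w))"
    by (rule continuous_on_compose2[OF assms holomorphic_on_imp_continuous_on[OF holomorphic_cayley]])
      (use cayley_in_uhp in blast)
qed

lemma lift_difference_diff:
  assumes "continuous_on uhp u" "continuous_on uhp v"
  shows "lift_difference \<alpha> M (\<lambda>z. u z - c * v z) m = lift_difference \<alpha> M u m - c * lift_difference \<alpha> M v m"
proof -
  have "circle_fourier (disc_lift \<alpha> (\<lambda>z. u z - c * v z)) m (1/2) =
     circle_fourier (disc_lift \<alpha> u) m (1/2) - c * circle_fourier (disc_lift \<alpha> v) m (1/2)" for m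
  proof -
    have i: "(\<lambda>t. disc_lift \<alpha> f (of_real (1/2) * cis t) * cis (- (of_int m * t))) integrable_on {0..2 * pi}"
      if "continuous_on uhp f" for f
      by (rule circle_fourier_integrable[OF continuous_on_disc_lift[OF that]]) auto
    have "circle_fourier (disc_lift \<alpha> (\<lambda>z. u z - c * v z)) m (1/2) = 
       integral {0..2 * pi} (\<lambda>t. disc_lift \<alpha> u (of_real (1/2) * cis t) * cis (- (of_int m * t)) 
         - c * (disc_lift \<alpha> v (of_real (1/2) * cis t) * cis (- (of_int m * t))))"
      unfolding circle_fourier_def disc_lift_def by (intro integral_cong) (simp add: algebra_simps)
    also have "\<dots> = circle_fourier (disc_lift \<alpha> u) m (1/2) - c * circle_fourier (disc_lift \<alpha> v) m (1/2)"
      unfolding circle_fourier_def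
      by (subst integral_diff) (use i[OF assms(1)] i[OF assms(2)] in \<open>auto intro: integrable_on_mult_right\<close>)
    finally show ?thesis .
  qed
  then have "disc_coeff \<alpha> (disc_lift \<alpha> (\<lambda>z. u z - c * v z)) m =
     disc_coeff \<alpha> (disc_lift \<alpha> u) m - c * disc_coeff \<alpha> (disc_lift \<alpha> v) m" for m
    by (simp add: disc_coeff_def diff_divide_distrib)
  then show ?thesis
    unfolding lift_difference_def by (simp only: right_diff_distrib sum_subtractf sum_distrib_left mult_ac)
qed

text \<open>The coefficients only see the values on the compact set \<open>cayley ` sphere 0 (1/2)\<close>.\<close>

lemma lift_difference_bound:
  obtains T where "T \<ge> 0" 
    "\<And>u e. continuous_on uhp u \<Longrightarrow> (\<And>z. z \<in> cayley ` sphere 0 (1/2) \<Longrightarrow> cmod (u z) \<le> e) \<Longrightarrow>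
       cmod (lift_difference \<alpha> M u m) \<le> T * e"
proof -
  have sub: "sphere 0 (1/2) \<subseteq> ball (0::complex) 1" by auto
  have "(\<lambda>w. (1 - w) powr complex_of_real \<alpha>) holomorphic_on ball 0 1"
    by (intro holomorphic_intros) (use one_minus_unit_ball in auto)
  then have "compact ((\<lambda>w. (1 - w) powr complex_of_real \<alpha>) ` sphere 0 (1/2))"
    using holomorphic_on_imp_continuous_on continuous_on_subset sub
    by (intro compact_continuous_image) (blast, simp)
  then obtain B where B: "\<And>w. w \<in> sphere 0 (1/2) \<Longrightarrow> cmod ((1 - w) powr complex_of_real \<alpha>) \<le> B"
    using compact_imp_bounded bounded_iff by (metis image_eqI)
  define T where "T = (\<Sum>j\<le>M. of_nat (M choose j) * (\<bar>B\<bar> * (2 * pi) / \<bar>radial_factor \<alpha> (m - int j) (1/2)\<bar>))"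
  show ?thesis
  proof (rule that[of T])
    show "T \<ge> 0" unfolding T_def by (intro sum_nonneg) auto
    fix u and e :: real
    assume uc: "continuous_on uhp u" and ue: "\<And>z. z \<in> cayley ` sphere 0 (1/2) \<Longrightarrow> cmod (u z) \<le> e"
    have F: "cmod (circle_fourier (disc_lift \<alpha> u) m (1/2)) \<le> \<bar>B\<bar> * e * (2 * pi - 0)" for m
      unfolding circle_fourier_def
    proof (rule integral_bound)
      show "continuous_on {0..2 * pi} (\<lambda>t. disc_lift \<alpha> u (of_real (1/2) * cis t) * cis (- (of_int m * t)))"
        by (intro continuous_on_mult continuous_on_circle[OF continuous_on_disc_lift[OF uc]] continuous_intros) auto
      fix t
      have s: "of_real (1/2) * cis t \<in> sphere 0 (1/2)" by (simp add: norm_mult)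
      have "cmod ((1 - of_real (1/2) * cis t) powr of_real \<alpha>) \<le> \<bar>B\<bar>" using B[OF s] by linarith
      moreover have "cmod (u (cayley (of_real (1/2) * cis t))) \<le> e" by (rule ue) (use s in blast)
      ultimately show "cmod (disc_lift \<alpha> u (of_real (1/2) * cis t) * cis (- (of_int m * t))) \<le> \<bar>B\<bar> * e"
        unfolding disc_lift_def norm_mult norm_cis mult_1_right by (intro mult_mono) auto
    qed simp
    have c: "cmod (disc_coeff \<alpha> (disc_lift \<alpha> u) m) \<le> \<bar>B\<bar> * (2 * pi) / \<bar>radial_factor \<alpha> m (1/2)\<bar> * e" for m
      unfolding disc_coeff_def norm_divide norm_of_real 
      using divide_right_mono[OF F[of m], of "\<bar>radial_factor \<alpha> m (1/2)\<bar>"] by (simp add: mult_ac)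
    have "cmod (lift_difference \<alpha> M u m) \<le> (\<Sum>j\<le>M. cmod ((-1) ^ j * of_nat (M choose j) * disc_coeff \<alpha> (disc_lift \<alpha> u) (m - int j)))"
      unfolding lift_difference_def by (rule norm_sum)
    also have "\<dots> \<le> (\<Sum>j\<le>M. of_nat (M choose j) * (\<bar>B\<bar> * (2 * pi) / \<bar>radial_factor \<alpha> (m - int j) (1/2)\<bar> * e))"
    proof (rule sum_mono)
      fix j
      have "cmod ((-1) ^ j * of_nat (M choose j) * disc_coeff \<alpha> (disc_lift \<alpha> u) (m - int j)) = 
         of_nat (M choose j) * cmod (disc_coeff \<alpha> (disc_lift \<alpha> u) (m - int j))"
        by (simp add: norm_mult norm_power)
      also have "\<dots> \<le> of_nat (M choose j) * (\<bar>B\<bar> * (2 * pi) / \<bar>radial_factor \<alpha> (m - int j) (1/2)\<bar> * e)"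
        by (intro mult_left_mono c) simp
      finally show "cmod ((-1) ^ j * of_nat (M choose j) * disc_coeff \<alpha> (disc_lift \<alpha> u) (m - int j)) \<le> 
         of_nat (M choose j) * (\<bar>B\<bar> * (2 * pi) / \<bar>radial_factor \<alpha> (m - int j) (1/2)\<bar> * e)" .
    qed
    also have "\<dots> = T * e" by (simp add: T_def sum_distrib_right mult.assoc)
    finally show "cmod (lift_difference \<alpha> M u m) \<le> T * e" .
  qed
qed

lemma lift_difference_mollify:
  assumes u: "continuous_on uhp u"
    and z: "\<And>\<phi>. unit_bump \<phi> \<Longrightarrow> lift_difference \<alpha> M (mollify u \<phi>) m = 0"
  shows "lift_difference \<alpha> M u m = 0"
proof -
  define K where "K = cayley ` sphere 0 (1/2)"
  have sub: "sphere 0 (1/2) \<subseteq> ball (0::complex) 1" by auto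
  have "compact K" unfolding K_def
    using holomorphic_on_imp_continuous_on[OF holomorphic_cayley] continuous_on_subset sub
    by (intro compact_continuous_image) (blast, simp)
  moreover have "K \<subseteq> uhp" unfolding K_def using sub cayley_in_uhp by blast
  ultimately have ap: "\<exists>\<phi>. unit_bump \<phi> \<and> (\<forall>z\<in>K. norm (mollify u \<phi> z - u z) \<le> e)" if "e > 0" for e
    using mollify_approx[OF u _ _ that] by blast
  obtain T where T: "T \<ge> 0" 
    "\<And>u e. continuous_on uhp u \<Longrightarrow> (\<And>z. z \<in> K \<Longrightarrow> cmod (u z) \<le> e) \<Longrightarrow> cmod (lift_difference \<alpha> M u m) \<le> T * e"
    unfolding K_def using lift_difference_bound[where M = M and \<alpha> = \<alpha> and m = m] by blast
  have key: "cmod (lift_difference \<alpha> M u m) \<le> T * e" if "e > 0" for e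
  proof -
    obtain \<phi> where \<phi>: "unit_bump \<phi>" "\<forall>z\<in>K. norm (mollify u \<phi> z - u z) \<le> e" using ap[OF \<open>e > 0\<close>] by blast
    have mc: "continuous_on uhp (mollify u \<phi>)"
      by (rule continuous_on_mollify[OF u unit_bump_continuous_on[OF \<phi>(1)]])
    have "cmod (lift_difference \<alpha> M (\<lambda>z. mollify u \<phi> z - 1 * u z) m) \<le> T * e"
      by (rule T(2)) (use \<phi> mc u in \<open>auto intro!: continuous_intros\<close>)
    then show ?thesis
      unfolding lift_difference_diff[OF mc u] z[OF \<phi>(1)] by simp
  qed
  have "cmod (lift_difference \<alpha> M u m) \<le> 0"
  proof (rule field_le_epsilon)
    fix e :: real assume e: "e > 0"
    have "cmod (lift_difference \<alpha> M u m) \<le> T * (e / (T + 1))"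
      by (rule key) (use e T(1) in auto)
    also have "\<dots> \<le> e" using e T(1) by (simp add: field_simps)
    finally show "cmod (lift_difference \<alpha> M u m) \<le> 0 + e" by simp
  qed
  then show ?thesis by simp
qed

text \<open>Differences of order 0 are the coefficients themselves; this is the base case of the
  dimension count.\<close>

lemma lift_difference_0_eq_0:
  assumes a: "alpha_system \<alpha> u p k k'" and \<alpha>: "\<alpha> > -1" and z: "\<And>m. lift_difference \<alpha> 0 u m = 0"
  shows "\<forall>z\<in>uhp. u z = 0"
proof
  fix z assume "z \<in> uhp"
  then obtain w where w: "w \<in> ball 0 1" "cayley w = z" by (rule cayley_surj)
  have "disc_lift \<alpha> u w = 0"
    using disc_system_eq_0[OF disc_system_lift[OF a] \<alpha>] z w(1) by (simp add: lift_difference_def)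
  then show "u z = 0" using one_minus_unit_ball(1)[OF w(1)] w(2) by (simp add: disc_lift_def)
qed

section \<open>Homogeneous solutions\<close>

text \<open>The Taylor coefficients of (1 - t)^(-\<alpha>-1). Accordingly
  \<open>hpoly \<alpha> n z\<close> below is the coefficient of t^n in (1 - z t)^(-1) (1 - cnj z
  t)^(-\<alpha>-1).\<close>

definition hpoly_coeff :: "real \<Rightarrow> nat \<Rightarrow> real" where
  "hpoly_coeff \<alpha> j = pochhammer (\<alpha> + 1) j / fact j"

lemma hpoly_coeff_0 [simp]: "hpoly_coeff \<alpha> 0 = 1"
  by (simp add: hpoly_coeff_def)

lemma hpoly_coeff_Suc: "(real j + 1) * hpoly_coeff \<alpha> (Suc j) = (\<alpha> + 1 + real j) * hpoly_coeff \<alpha> j"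
  by (simp add: hpoly_coeff_def pochhammer_Suc add_ac)

lemma hpoly_coeff_pos: "\<alpha> > -1 \<Longrightarrow> hpoly_coeff \<alpha> j > 0"
  by (simp add: hpoly_coeff_def pochhammer_pos)

text \<open>The sign of \<alpha> decides between increasing and decreasing coefficients; this is
  where \<alpha> \<noteq> 0 enters.\<close>

lemma hpoly_coeff_diff: "hpoly_coeff \<alpha> (Suc j) - hpoly_coeff \<alpha> j = \<alpha> / (real j + 1) * hpoly_coeff \<alpha> j"
proof -
  have "hpoly_coeff \<alpha> (Suc j) = (\<alpha> + 1 + real j) * hpoly_coeff \<alpha> j / (real j + 1)"
    using hpoly_coeff_Suc[of j \<alpha>] by (simp add: eq_divide_eq mult.commute)
  then show ?thesis by (simp add: field_simps)
qed

text \<open>\<open>y\<^bsup>\<alpha>+1\<^esup> hpoly \<alpha> j\<close> is the homogeneous solution of degree \<open>\<alpha> + 1 + j\<close> vanishing on the real line.\<close>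

primrec hpoly :: "real \<Rightarrow> nat \<Rightarrow> complex \<Rightarrow> complex" where
  "hpoly \<alpha> 0 z = 1"
| "hpoly \<alpha> (Suc j) z = z * hpoly \<alpha> j z + of_real (hpoly_coeff \<alpha> (Suc j)) * cnj z ^ Suc j"

lemma hpoly_eq_sum: "hpoly \<alpha> n z = (\<Sum>i\<le>n. of_real (hpoly_coeff \<alpha> i) * z ^ (n - i) * cnj z ^ i)"
proof (induction n)
  case (Suc n)
  have "z * (\<Sum>i\<le>n. of_real (hpoly_coeff \<alpha> i) * z ^ (n - i) * cnj z ^ i) = 
     (\<Sum>i\<le>n. of_real (hpoly_coeff \<alpha> i) * z ^ (Suc n - i) * cnj z ^ i)"
    unfolding sum_distrib_left by (rule sum.cong) (auto simp: Suc_diff_le)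
  then show ?case using Suc by simp
qed simp

text \<open>As y = -(\<i>/2) (z - cnj z), the derivative of y^(\<alpha>+1)
  \<open>hpoly \<alpha> j\<close> by cnj z is -(\<i>/2) y^\<alpha> times the left-hand side of this
  identity. The product is a solution because the right-hand side is antiholomorphic.\<close>

lemma hpoly_wirtinger:
  "\<exists>p q. has_wirtinger (hpoly \<alpha> j) p q uhp \<and>
     (\<forall>z. (z - cnj z) * q z - of_real (\<alpha> + 1) * hpoly \<alpha> j z = - of_real ((\<alpha> + 1 + real j) * hpoly_coeff \<alpha> j) * cnj z ^ j)"
proof (induction j)
  case 0
  have "hpoly \<alpha> 0 = (\<lambda>_. 1)" by auto
  then show ?case
    using has_wirtinger_const[of 1 uhp] by (intro exI[of _ "\<lambda>_. 0"]) simp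
next
  case (Suc j)
  then obtain p q where w: "has_wirtinger (hpoly \<alpha> j) p q uhp"
    and q: "\<And>z. (z - cnj z) * q z - of_real (\<alpha> + 1) * hpoly \<alpha> j z = - of_real ((\<alpha> + 1 + real j) * hpoly_coeff \<alpha> j) * cnj z ^ j"
    by blast
  have id: "has_wirtinger (\<lambda>z. z) (\<lambda>_. 1) (\<lambda>_. 0) uhp"
    by (rule has_wirtinger_cong[OF has_wirtinger_holomorphic open_uhp]) (auto intro: open_uhp)
  have "has_wirtinger (\<lambda>z. z ^ Suc j) (deriv (\<lambda>z. z ^ Suc j)) (\<lambda>_. 0) uhp"
    by (intro has_wirtinger_holomorphic holomorphic_intros open_uhp)
  note cnj_pow = has_wirtinger_cnj[OF this]
  have dpow: "deriv (\<lambda>z. z ^ Suc j) z = of_nat (Suc j) * z ^ j" for z :: complex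
    by (rule DERIV_imp_deriv, (rule derivative_eq_intros refl)+) (simp del: power_Suc of_nat_Suc)
  have "has_wirtinger (\<lambda>z. cnj z ^ Suc j) (\<lambda>_. 0) (\<lambda>z. of_nat (Suc j) * cnj z ^ j) uhp"
    by (rule has_wirtinger_cong[OF cnj_pow open_uhp])
      (simp_all only: dpow complex_cnj_power complex_cnj_mult complex_cnj_of_nat complex_cnj_zero)
  from has_wirtinger_add[OF has_wirtinger_mult[OF id w] has_wirtinger_cmult[OF this, of "of_real (hpoly_coeff \<alpha> (Suc j))"]]
  have "has_wirtinger (hpoly \<alpha> (Suc j)) (\<lambda>z. z * p z + 1 * hpoly \<alpha> j z + of_real (hpoly_coeff \<alpha> (Suc j)) * 0)
     (\<lambda>z. z * q z + of_real (hpoly_coeff \<alpha> (Suc j)) * (of_nat (Suc j) * cnj z ^ j)) uhp"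
    by (rule has_wirtinger_cong[OF _ open_uhp]) simp_all
  moreover have "(z - cnj z) * (z * q z + of_real (hpoly_coeff \<alpha> (Suc j)) * (of_nat (Suc j) * cnj z ^ j)) - of_real (\<alpha> + 1) * hpoly \<alpha> (Suc j) z
     = - of_real ((\<alpha> + 1 + real (Suc j)) * hpoly_coeff \<alpha> (Suc j)) * cnj z ^ Suc j" for z
  proof -
    define a where "a = complex_of_real (hpoly_coeff \<alpha> j)"
    define b where "b = complex_of_real (hpoly_coeff \<alpha> (Suc j))"
    define A where "A = complex_of_real (\<alpha> + 1)"
    define N where "N = complex_of_nat j"
    have "complex_of_real ((real j + 1) * hpoly_coeff \<alpha> (Suc j)) = complex_of_real ((\<alpha> + 1 + real j) * hpoly_coeff \<alpha> j)"
      by (simp only: hpoly_coeff_Suc)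
    then have ab: "(N + 1) * b = (A + N) * a" by (simp add: a_def b_def A_def N_def)
    have q': "(z - cnj z) * q z - A * hpoly \<alpha> j z = - ((A + N) * a) * cnj z ^ j"
      using q[of z] by (simp add: a_def A_def N_def)
    have "(z - cnj z) * (z * q z + b * ((N + 1) * cnj z ^ j)) - A * (z * hpoly \<alpha> j z + b * (cnj z * cnj z ^ j))
      = z * ((z - cnj z) * q z - A * hpoly \<alpha> j z) + (z - cnj z) * ((N + 1) * b) * cnj z ^ j - A * b * (cnj z * cnj z ^ j)"
      by (simp add: algebra_simps)
    \<comment> \<open>The relation \<open>ab\<close> between consecutive coefficients cancels the
      two terms containing \<open>z * cnj z ^ j\<close>.\<close>
    also have "\<dots> = - ((N + 1) * b) * cnj z * cnj z ^ j - A * b * (cnj z * cnj z ^ j)"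
      unfolding q' ab by (simp add: algebra_simps)
    also have "\<dots> = - ((A + (N + 1)) * b) * (cnj z * cnj z ^ j)"
      by (simp add: algebra_simps)
    finally show ?thesis by (simp add: a_def b_def A_def N_def add_ac)
  qed
  ultimately show ?case by blast
qed

definition hsol :: "real \<Rightarrow> nat \<Rightarrow> complex \<Rightarrow> complex" where
  "hsol \<alpha> j z = of_real (Im z powr (\<alpha> + 1)) * hpoly \<alpha> j z"

lemma alpha_system_hsol: "\<exists>p k k'. alpha_system \<alpha> (hsol \<alpha> j) p k k'"
proof -
  obtain p q where w: "has_wirtinger (hpoly \<alpha> j) p q uhp"
    and q: "\<And>z. (z - cnj z) * q z - of_real (\<alpha> + 1) * hpoly \<alpha> j z = - of_real ((\<alpha> + 1 + real j) * hpoly_coeff \<alpha> j) * cnj z ^ j"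
    using hpoly_wirtinger by blast
  define c where "c = \<i> / 2 * complex_of_real ((\<alpha> + 1 + real j) * hpoly_coeff \<alpha> j)"
  define k where "k = (\<lambda>z. c * cnj z ^ j)"
  have "has_wirtinger (\<lambda>z. z ^ j) (deriv (\<lambda>z. z ^ j)) (\<lambda>_. 0) uhp"
    by (intro has_wirtinger_holomorphic holomorphic_intros open_uhp)
  from has_wirtinger_cmult[OF has_wirtinger_cnj[OF this], of c]
  obtain k' where k': "has_wirtinger k (\<lambda>_. 0) k' uhp" by (auto simp: k_def)
  obtain p' where p': "has_wirtinger (hsol \<alpha> j) p' (\<lambda>z. of_real (Im z powr (\<alpha> + 1)) * q z + 
      \<i> / 2 * of_real ((\<alpha> + 1) * Im z powr (\<alpha> + 1 - 1)) * hpoly \<alpha> j z) uhp"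
    using has_wirtinger_mult[OF has_wirtinger_Im_powr[of "\<alpha> + 1"] w] unfolding hsol_def[abs_def] by blast
  have "has_wirtinger (hsol \<alpha> j) p' (\<lambda>z. of_real (Im z powr \<alpha>) * k z) uhp"
  proof (rule has_wirtinger_cong[OF p' open_uhp])
    fix z assume z: "z \<in> uhp"
    have y: "complex_of_real (Im z powr (\<alpha> + 1)) = of_real (Im z powr \<alpha>) * of_real (Im z)"
      using z by (simp add: powr_add)
    have i: "of_real (Im z) = - \<i> / 2 * (z - cnj z)" by (simp add: complex_eq_iff)
    have "of_real (Im z powr (\<alpha> + 1)) * q z + \<i> / 2 * of_real ((\<alpha> + 1) * Im z powr (\<alpha> + 1 - 1)) * hpoly \<alpha> j z
       = of_real (Im z powr \<alpha>) * (- \<i> / 2 * ((z - cnj z) * q z - of_real (\<alpha> + 1) * hpoly \<alpha> j z))"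
    proof -
      have "P * (- \<i> / 2 * D) * Q + \<i> / 2 * (A * P) * h = P * (- \<i> / 2 * (D * Q - A * h))" for P D Q A h :: complex
        by (simp add: field_simps)
      then show ?thesis unfolding y i by (simp only: of_real_mult add_diff_cancel_right')
    qed
    also have "\<dots> = of_real (Im z powr \<alpha>) * k z"
      unfolding q k_def c_def by (simp add: mult.assoc)
    finally show "of_real (Im z powr (\<alpha> + 1)) * q z + \<i> / 2 * of_real ((\<alpha> + 1) * Im z powr (\<alpha> + 1 - 1)) * hpoly \<alpha> j z = 
       of_real (Im z powr \<alpha>) * k z" .
  qed auto
  with k' show ?thesis unfolding alpha_system_def by blast
qed

lemma hpoly_upper_bound:
  assumes "\<alpha> > -1"
  obtains C where "C \<ge> 0" "\<And>z. cmod (hpoly \<alpha> n z) \<le> C * cmod z ^ n"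
proof
  show "0 \<le> (\<Sum>i\<le>n. hpoly_coeff \<alpha> i)"
    using hpoly_coeff_pos[OF assms] by (intro sum_nonneg) (simp add: less_imp_le)
  fix z
  have "cmod (hpoly \<alpha> n z) \<le> (\<Sum>i\<le>n. cmod (of_real (hpoly_coeff \<alpha> i) * z ^ (n - i) * cnj z ^ i))"
    unfolding hpoly_eq_sum by (rule norm_sum)
  also have "\<dots> = (\<Sum>i\<le>n. hpoly_coeff \<alpha> i * cmod z ^ n)"
  proof (rule sum.cong)
    fix i assume "i \<in> {..n}"
    then have "cmod z ^ (n - i) * cmod z ^ i = cmod z ^ n" by (simp flip: power_add)
    then show "cmod (of_real (hpoly_coeff \<alpha> i) * z ^ (n - i) * cnj z ^ i) = hpoly_coeff \<alpha> i * cmod z ^ n"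
      using hpoly_coeff_pos[OF assms, of i] by (simp add: norm_mult norm_power mult.assoc)
  qed simp
  finally show "cmod (hpoly \<alpha> n z) \<le> (\<Sum>i\<le>n. hpoly_coeff \<alpha> i) * cmod z ^ n"
    by (simp add: sum_distrib_right)
qed

text \<open>The Enestroem--Kakeya argument: multiply by \<open>1 - w\<close>; the first two terms of the result are not aligned unless \<open>w = 1\<close>.\<close>

lemma norm_add_unit_less:
  fixes w :: complex
  assumes "a > 0" "b > 0" "cmod w = 1" "w \<noteq> 1"
  shows "cmod (of_real a + of_real b * w) < a + b"
proof -
  have w2: "(Re w)\<^sup>2 + (Im w)\<^sup>2 = 1" using assms(3) by (metis cmod_power2 power_one)
  have "Re w < 1"
  proof -
    have "Re w \<le> 1" using complex_Re_le_cmod[of w] assms(3) by simp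
    moreover have "Re w \<noteq> 1"
    proof
      assume "Re w = 1"
      with w2 have "Im w = 0" by simp
      with \<open>Re w = 1\<close> assms(4) show False by (simp add: complex_eq_iff)
    qed
    ultimately show ?thesis by simp
  qed
  then have "2 * a * b * Re w < 2 * a * b * 1" using assms by (intro mult_strict_left_mono) auto
  moreover have "(cmod (of_real a + of_real b * w))\<^sup>2 = a\<^sup>2 + 2 * a * b * Re w + b\<^sup>2 * ((Re w)\<^sup>2 + (Im w)\<^sup>2)"
    by (simp add: cmod_power2) (simp add: power2_eq_square algebra_simps)
  ultimately have "(cmod (of_real a + of_real b * w))\<^sup>2 < (a + b)\<^sup>2"
    unfolding w2 by (simp add: power2_eq_square algebra_simps)
  then show ?thesis by (rule power_less_imp_less_base) (use assms in simp)
qed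

lemma increasing_coeffs_nonzero_on_circle:
  fixes b :: "nat \<Rightarrow> real"
  assumes pos: "b 0 > 0" and inc: "\<And>i. i < n \<Longrightarrow> b i < b (Suc i)" and w: "cmod w = 1"
  shows "(\<Sum>i\<le>n. of_real (b i) * w ^ i) \<noteq> 0"
proof (cases "w = 1")
  case True
  have "b i > 0" if "i \<le> n" for i
    using that
  proof (induction i)
    case (Suc i)
    then show ?case using inc[of i] by simp
  qed (rule pos)
  then have "(\<Sum>i\<le>n. b i) > 0" by (intro sum_pos) auto
  then show ?thesis using True by (simp flip: of_real_sum)
next
  case False
  show ?thesis
  proof (cases n)
    case 0
    then show ?thesis using pos by simp
  next
    case (Suc m)
    have tele: "(1 - w) * (\<Sum>i\<le>l. of_real (b i) * w ^ i) = 
       of_real (b 0) + (\<Sum>i<l. of_real (b (Suc i) - b i) * w ^ Suc i) - of_real (b l) * w ^ Suc l" for l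
      by (induction l) (simp_all add: algebra_simps)
    \<comment> \<open>Strictness is won in b 0 + (b 1 - b 0) w, as w \<noteq> 1, and the triangle
      inequality preserves it while the other increments are added. It contradicts a zero of the
      sum, for which this modulus would equal b n.\<close>
    have bl: "cmod (of_real (b 0) + (\<Sum>i<Suc l. of_real (b (Suc i) - b i) * w ^ Suc i)) < b (Suc l)" if "l \<le> m" for l
      using that
    proof (induction l)
      case 0
      have "b 0 < b 1" using inc[of 0] Suc by simp
      then show ?case using norm_add_unit_less[OF pos _ w False, of "b 1 - b 0"] by simp
    next
      case (Suc l)
      have "b (Suc l) < b (Suc (Suc l))" using inc[of "Suc l"] Suc.prems \<open>n = Suc m\<close> by simp
      then have "cmod (of_real (b (Suc (Suc l)) - b (Suc l)) * w ^ Suc (Suc l)) = b (Suc (Suc l)) - b (Suc l)"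
        using w unfolding norm_mult norm_power norm_of_real by simp
      then show ?case
        using Suc norm_triangle_ineq[of "of_real (b 0) + (\<Sum>i<Suc l. of_real (b (Suc i) - b i) * w ^ Suc i)"
            "of_real (b (Suc (Suc l)) - b (Suc l)) * w ^ Suc (Suc l)"]
        by (simp add: add.assoc)
    qed
    show ?thesis
    proof
      assume "(\<Sum>i\<le>n. of_real (b i) * w ^ i) = 0"
      then have "of_real (b 0) + (\<Sum>i<n. of_real (b (Suc i) - b i) * w ^ Suc i) = of_real (b n) * w ^ Suc n"
        using tele[of n] by simp
      moreover have "cmod (of_real (b n) * w ^ Suc n) = \<bar>b n\<bar>"
        using w unfolding norm_mult norm_power norm_of_real by simp
      ultimately show False using bl[of m] Suc by simp
    qed
  qed
qed

text \<open>For \<alpha> > 0 the coefficients increase. For \<alpha> < 0 they decrease, and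
  factoring out w^n leaves the reversed polynomial at 1/w, whose coefficients increase. For \<alpha>
  = 0 all are 1, and the (n+1)-st roots of unity other than 1 would be zeros.\<close>

lemma hpoly_coeffs_nonzero_on_circle:
  assumes \<alpha>: "\<alpha> > -1" "\<alpha> \<noteq> 0" and w: "cmod w = 1"
  shows "(\<Sum>i\<le>n. of_real (hpoly_coeff \<alpha> i) * w ^ i) \<noteq> 0"
proof (cases "\<alpha> > 0")
  case True
  show ?thesis
  proof (rule increasing_coeffs_nonzero_on_circle[OF _ _ w])
    fix i
    have "hpoly_coeff \<alpha> (Suc i) - hpoly_coeff \<alpha> i > 0"
      unfolding hpoly_coeff_diff using True hpoly_coeff_pos[OF \<alpha>(1), of i] by simp
    then show "hpoly_coeff \<alpha> i < hpoly_coeff \<alpha> (Suc i)" by simp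
  qed simp
next
  case False
  have w0: "w \<noteq> 0" using w by auto
  have dec: "hpoly_coeff \<alpha> (Suc i) < hpoly_coeff \<alpha> i" for i
  proof -
    have "hpoly_coeff \<alpha> (Suc i) - hpoly_coeff \<alpha> i < 0"
      unfolding hpoly_coeff_diff using False \<alpha> hpoly_coeff_pos[OF \<alpha>(1), of i]
      by (intro mult_neg_pos divide_neg_pos) auto
    then show ?thesis by simp
  qed
  have "(\<Sum>i\<le>n. of_real (hpoly_coeff \<alpha> (n - i)) * inverse w ^ i) \<noteq> 0"
  proof (rule increasing_coeffs_nonzero_on_circle)
    show "hpoly_coeff \<alpha> (n - 0) > 0" by (rule hpoly_coeff_pos[OF \<alpha>(1)])
    show "cmod (inverse w) = 1" using w by (simp add: norm_inverse)
    fix i assume "i < n"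
    then show "hpoly_coeff \<alpha> (n - i) < hpoly_coeff \<alpha> (n - Suc i)"
      using dec[of "n - Suc i"] by (simp add: Suc_diff_Suc)
  qed
  moreover have "(\<Sum>i\<le>n. of_real (hpoly_coeff \<alpha> i) * w ^ i) = 
      w ^ n * (\<Sum>i\<le>n. of_real (hpoly_coeff \<alpha> (n - i)) * inverse w ^ i)"
  proof -
    have "(\<Sum>i\<le>n. of_real (hpoly_coeff \<alpha> i) * w ^ i) = (\<Sum>i\<le>n. of_real (hpoly_coeff \<alpha> (n - i)) * w ^ (n - i))"
      by (rule sum.reindex_bij_witness[of _ "\<lambda>i. n - i" "\<lambda>i. n - i"]) auto
    also have "\<dots> = (\<Sum>i\<le>n. w ^ n * (of_real (hpoly_coeff \<alpha> (n - i)) * inverse w ^ i))"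
      using w0 by (intro sum.cong) (auto simp: power_diff divide_inverse power_inverse)
    finally show ?thesis by (simp add: sum_distrib_left)
  qed
  ultimately show ?thesis using w0 by simp
qed

text \<open>By homogeneity \<open>hpoly \<alpha> n z\<close> is z^n times a polynomial in cnj z / z,
  a point of the unit circle, where the modulus of that polynomial has a positive minimum.\<close>

lemma hpoly_lower_bound:
  assumes \<alpha>: "\<alpha> > -1" "\<alpha> \<noteq> 0"
  obtains e where "e > 0" "\<And>z. z \<noteq> 0 \<Longrightarrow> cmod (hpoly \<alpha> n z) \<ge> e * cmod z ^ n"
proof -
  define S where "S = (\<lambda>w. \<Sum>i\<le>n. complex_of_real (hpoly_coeff \<alpha> i) * w ^ i)"
  have "continuous_on (sphere 0 1) (\<lambda>w. cmod (S w))" unfolding S_def by (intro continuous_intros)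
  moreover have "compact (sphere (0::complex) 1)" "sphere (0::complex) 1 \<noteq> {}" by auto
  ultimately obtain w0 where w0: "w0 \<in> sphere 0 1" "\<And>w. w \<in> sphere 0 1 \<Longrightarrow> cmod (S w0) \<le> cmod (S w)"
    using continuous_attains_inf[of "sphere (0::complex) 1" "\<lambda>w. cmod (S w)"] by blast
  have "cmod (S w0) > 0"
    using hpoly_coeffs_nonzero_on_circle[OF \<alpha>, of w0 n] w0(1) by (simp add: S_def)
  moreover have "cmod (hpoly \<alpha> n z) \<ge> cmod (S w0) * cmod z ^ n" if z: "z \<noteq> 0" for z
  proof -
    have "hpoly \<alpha> n z = S (cnj z / z) * z ^ n"
      unfolding hpoly_eq_sum S_def sum_distrib_right
      by (rule sum.cong) (use z in \<open>auto simp: power_divide power_diff\<close>)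
    moreover have "cmod (S w0) \<le> cmod (S (cnj z / z))"
      by (rule w0(2)) (use z in \<open>simp add: norm_divide\<close>)
    ultimately show ?thesis by (simp add: norm_mult norm_power mult_right_mono)
  qed
  ultimately show ?thesis using that by blast
qed

text \<open>The top term dominates uniformly in the direction of z, so the bound holds along every
  sequence going to infinity.\<close>

lemma hpoly_combination_large:
  assumes \<alpha>: "\<alpha> > -1" "\<alpha> \<noteq> 0" and a: "a n \<noteq> 0"
  obtains \<delta> R where "\<delta> > 0" "\<And>z. cmod z \<ge> R \<Longrightarrow> cmod (\<Sum>j\<le>n. a j * hpoly \<alpha> j z) \<ge> \<delta>"
proof -
  obtain e where e: "e > 0" "\<And>z. z \<noteq> 0 \<Longrightarrow> cmod (hpoly \<alpha> n z) \<ge> e * cmod z ^ n"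
    using hpoly_lower_bound[OF \<alpha>] by metis
  obtain C where C: "\<And>j. C j \<ge> 0" "\<And>j z. cmod (hpoly \<alpha> j z) \<le> C j * cmod z ^ j"
  proof -
    have "\<exists>C. C \<ge> 0 \<and> (\<forall>z. cmod (hpoly \<alpha> j z) \<le> C * cmod z ^ j)" for j
      by (rule hpoly_upper_bound[OF \<alpha>(1), of j]) blast
    then show ?thesis using that by metis
  qed
  define B where "B = (\<Sum>j<n. cmod (a j) * C j)"
  have B: "B \<ge> 0" unfolding B_def using C by (intro sum_nonneg) auto
  define \<epsilon> where "\<epsilon> = e * cmod (a n)"
  have \<epsilon>: "\<epsilon> > 0" using e a by (simp add: \<epsilon>_def)
  \<comment> \<open>From modulus 2B/\<epsilon> on, the lower terms use up at most half of the top
    one; the 1 ensures |z|^j \<le> |z|^(n-1) for j < n.\<close>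
  define R where "R = max 1 (2 * B / \<epsilon>)"
  have "cmod (\<Sum>j\<le>n. a j * hpoly \<alpha> j z) \<ge> \<epsilon> / 2" if z: "cmod z \<ge> R" for z
  proof -
    have z1: "cmod z \<ge> 1" "cmod z \<ge> 2 * B / \<epsilon>" using z by (auto simp: R_def)
    then have B': "2 * B \<le> \<epsilon> * cmod z" using \<epsilon> by (simp add: divide_le_eq mult.commute)
    have top: "cmod (a n * hpoly \<alpha> n z) \<ge> \<epsilon> * cmod z ^ n"
    proof -
      have "cmod (a n) * (e * cmod z ^ n) \<le> cmod (a n) * cmod (hpoly \<alpha> n z)"
        using z1 by (intro mult_left_mono e(2)) auto
      then show ?thesis by (simp add: \<epsilon>_def norm_mult mult_ac)
    qed
    have low: "cmod (\<Sum>j<n. a j * hpoly \<alpha> j z) \<le> \<epsilon> / 2 * cmod z ^ n"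
    proof (cases n)
      case 0
      then show ?thesis using \<epsilon> by simp
    next
      case (Suc m)
      have "cmod (\<Sum>j<n. a j * hpoly \<alpha> j z) \<le> (\<Sum>j<n. cmod (a j) * C j * cmod z ^ m)"
      proof (rule sum_norm_le)
        fix j assume j: "j \<in> {..<n}"
        have "cmod (a j) * cmod (hpoly \<alpha> j z) \<le> cmod (a j) * (C j * cmod z ^ j)"
          by (intro mult_left_mono C) auto
        also have "\<dots> \<le> cmod (a j) * (C j * cmod z ^ m)"
          using j Suc z1 C by (intro mult_left_mono power_increasing) auto
        finally show "cmod (a j * hpoly \<alpha> j z) \<le> cmod (a j) * C j * cmod z ^ m"
          by (simp add: norm_mult mult.assoc)
      qed
      also have "\<dots> = B * cmod z ^ m" by (simp add: B_def sum_distrib_right)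
      also have "\<dots> \<le> (\<epsilon> * cmod z / 2) * cmod z ^ m" using B' by (intro mult_right_mono) auto
      also have "\<dots> = \<epsilon> / 2 * cmod z ^ n" using Suc by simp
      finally show ?thesis .
    qed
    have "{..n} = insert n {..<n}" by auto
    then have "(\<Sum>j\<le>n. a j * hpoly \<alpha> j z) = a n * hpoly \<alpha> n z + (\<Sum>j<n. a j * hpoly \<alpha> j z)" by simp
    then have "cmod (\<Sum>j\<le>n. a j * hpoly \<alpha> j z) \<ge> \<epsilon> * cmod z ^ n - \<epsilon> / 2 * cmod z ^ n"
      using norm_diff_ineq[of "a n * hpoly \<alpha> n z" "\<Sum>j<n. a j * hpoly \<alpha> j z"] top low by simp
    moreover have "\<epsilon> / 2 * 1 \<le> \<epsilon> / 2 * cmod z ^ n"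
      using z1 \<epsilon> by (intro mult_left_mono one_le_power) auto
    ultimately show ?thesis by simp
  qed
  with \<epsilon> that[of "\<epsilon> / 2" R] show ?thesis by simp
qed

section \<open>Dimension count for the difference conditions\<close>

text \<open>The factor y^(\<alpha>+1) gives the zero boundary values and costs nothing in
  \<open>disc_lift_bound\<close>, so the polynomial degree alone determines the order.\<close>

lemma lift_difference_hsol:
  assumes \<alpha>: "\<alpha> > -1"
  shows "lift_difference \<alpha> (Suc j) (hsol \<alpha> j) m = 0"
proof -
  obtain p k k' where a: "alpha_system \<alpha> (hsol \<alpha> j) p k k'" using alpha_system_hsol by blast
  obtain C where C: "C \<ge> 0" "\<And>z. cmod (hpoly \<alpha> j z) \<le> C * cmod z ^ j"
    using hpoly_upper_bound[OF \<alpha>] by metis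
  have le: "cmod (hsol \<alpha> j z) \<le> C * Im z powr (\<alpha> + 1) * (1 + cmod z) ^ j" if "z \<in> uhp" for z
  proof -
    have "C * cmod z ^ j \<le> C * (1 + cmod z) ^ j" using C by (intro mult_left_mono power_mono) auto
    then have "Im z powr (\<alpha> + 1) * cmod (hpoly \<alpha> j z) \<le> Im z powr (\<alpha> + 1) * (C * (1 + cmod z) ^ j)"
      using C(2)[of z] by (intro mult_left_mono) auto
    then show ?thesis by (simp add: hsol_def norm_mult mult_ac)
  qed
  show ?thesis
  proof (rule lift_difference_eq_0[OF a \<alpha> _ le])
    fix x :: real
    have "((\<lambda>z. C * Im z powr (\<alpha> + 1) * (1 + cmod z) ^ j) \<longlongrightarrow> C * Im (of_real x) powr (\<alpha> + 1) * (1 + cmod (of_real x)) ^ j) (at (of_real x) within uhp)"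
    proof (intro tendsto_intros tendsto_powr')
      have "\<forall>\<^sub>F z in at (complex_of_real x) within uhp. 0 \<le> Im z"
        unfolding eventually_at by (intro exI[of _ 1]) auto
      then show "Im (complex_of_real x) \<noteq> 0 \<or> 0 < \<alpha> + 1 \<and> (\<forall>\<^sub>F z in at (complex_of_real x) within uhp. 0 \<le> Im z)"
        using \<alpha> by auto
    qed
    then have "((\<lambda>z. C * Im z powr (\<alpha> + 1) * (1 + cmod z) ^ j) \<longlongrightarrow> 0) (at (of_real x) within uhp)" by simp
    then show "(hsol \<alpha> j \<longlongrightarrow> 0) (at (of_real x) within uhp)"
      by (rule Lim_null_comparison[rotated]) (use le in \<open>auto simp: eventually_at intro!: exI[of _ 1]\<close>)
  qed simp
qed

lemma alpha_system_diff:
  assumes "alpha_system \<alpha> u p k k'" "alpha_system \<alpha> v p1 k1 k1'"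
  shows "\<exists>p k k'. alpha_system \<alpha> (\<lambda>z. u z - c * v z) p k k'"
proof -
  have a: "has_wirtinger u p (\<lambda>z. of_real (Im z powr \<alpha>) * k z) uhp" "has_wirtinger k (\<lambda>_. 0) k' uhp"
    "has_wirtinger v p1 (\<lambda>z. of_real (Im z powr \<alpha>) * k1 z) uhp" "has_wirtinger k1 (\<lambda>_. 0) k1' uhp"
    using assms by (auto simp: alpha_system_def)
  have "has_wirtinger (\<lambda>z. u z - c * v z) (\<lambda>z. p z + (- c) * p1 z) (\<lambda>z. of_real (Im z powr \<alpha>) * (k z + (- c) * k1 z)) uhp"
    by (rule has_wirtinger_cong[OF has_wirtinger_add[OF a(1) has_wirtinger_cmult[OF a(3), of "- c"]] open_uhp])
      (auto simp: algebra_simps)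
  moreover have "has_wirtinger (\<lambda>z. k z + (- c) * k1 z) (\<lambda>_. 0) (\<lambda>z. k' z + (- c) * k1' z) uhp"
    using has_wirtinger_add[OF a(2) has_wirtinger_cmult[OF a(4), of "- c"]] by simp
  ultimately have "alpha_system \<alpha> (\<lambda>z. u z - c * v z) (\<lambda>z. p z + (- c) * p1 z) (\<lambda>z. k z + (- c) * k1 z) (\<lambda>z. k' z + (- c) * k1' z)"
    unfolding alpha_system_def by (intro conjI)
  then show ?thesis by blast
qed

lemma alpha_system_continuous_on: "alpha_system \<alpha> u p k k' \<Longrightarrow> continuous_on uhp u"
  unfolding alpha_system_def using has_wirtinger_continuous_on by blast

text \<open>\<open>span\<close> is the induction hypothesis of the next lemma. The (M+1)-st
  differences of \<open>hsol \<alpha> M\<close> vanish, so its M-th ones do not depend on m. Were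
  they 0, \<open>span\<close> would express \<open>hsol \<alpha> M\<close> by the solutions of lower
  degree, which \<open>hpoly_combination_large\<close> refutes.\<close>

lemma lift_difference_hsol_leading:
  assumes \<alpha>: "\<alpha> > -1" "\<alpha> \<noteq> 0"
    and span: "\<And>u p k k'. alpha_system \<alpha> u p k k' \<Longrightarrow> (\<And>m. lift_difference \<alpha> M u m = 0) \<Longrightarrow>
      \<exists>a. \<forall>z\<in>uhp. u z = (\<Sum>j<M. a j * hsol \<alpha> j z)"
  shows "lift_difference \<alpha> M (hsol \<alpha> M) 0 \<noteq> 0"
proof
  assume z: "lift_difference \<alpha> M (hsol \<alpha> M) 0 = 0"
  have step: "lift_difference \<alpha> M (hsol \<alpha> M) m = lift_difference \<alpha> M (hsol \<alpha> M) (m - 1)" for m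
    using lift_difference_hsol[OF \<alpha>(1), of M m] by (simp add: lift_difference_Suc)
  have "lift_difference \<alpha> M (hsol \<alpha> M) m = 0" for m
  proof (induction m rule: int_induct[where k = 0])
    case (step1 i)
    then show ?case using step[of "i + 1"] by simp
  next
    case (step2 i)
    then show ?case using step[of i] by simp
  qed (rule z)
  then obtain a where a: "\<forall>z\<in>uhp. hsol \<alpha> M z = (\<Sum>j<M. a j * hsol \<alpha> j z)"
    using span alpha_system_hsol by blast
  define b where "b = (\<lambda>j. if j = M then 1 else - a j)"
  have "b M \<noteq> 0" by (simp add: b_def)
  then obtain \<delta> R where \<delta>: "\<delta> > 0" "\<And>z. cmod z \<ge> R \<Longrightarrow> cmod (\<Sum>j\<le>M. b j * hpoly \<alpha> j z) \<ge> \<delta>"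
    using hpoly_combination_large[OF \<alpha>] by metis
  define z where "z = \<i> * of_real (\<bar>R\<bar> + 1)"
  have y: "Im z = \<bar>R\<bar> + 1" by (simp add: z_def)
  have zu: "z \<in> uhp" using y by simp
  have "cmod z = \<bar>R\<bar> + 1" unfolding z_def norm_mult norm_of_real by simp
  then have zR: "cmod z \<ge> R" by simp
  have "of_real (Im z powr (\<alpha> + 1)) * (\<Sum>j\<le>M. b j * hpoly \<alpha> j z) = (\<Sum>j\<le>M. b j * hsol \<alpha> j z)"
    by (simp add: sum_distrib_left hsol_def mult_ac)
  also have "\<dots> = hsol \<alpha> M z - (\<Sum>j<M. a j * hsol \<alpha> j z)"
  proof -
    have "{..M} = insert M {..<M}" by auto
    then have "(\<Sum>j\<le>M. b j * hsol \<alpha> j z) = hsol \<alpha> M z + (\<Sum>j<M. b j * hsol \<alpha> j z)" by (simp add: b_def)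
    also have "(\<Sum>j<M. b j * hsol \<alpha> j z) = - (\<Sum>j<M. a j * hsol \<alpha> j z)"
      unfolding sum_negf[symmetric] by (rule sum.cong) (auto simp: b_def)
    finally show ?thesis by simp
  qed
  also have "\<dots> = 0" using a zu by simp
  finally have "(\<Sum>j\<le>M. b j * hpoly \<alpha> j z) = 0" using zu by simp
  then show False using \<delta>(1) \<delta>(2)[OF zR] by simp
qed

text \<open>Vanishing differences of order M + 1 make those of order M constant in m. Subtracting
  the right multiple of \<open>hsol \<alpha> M\<close>, whose own constant is nonzero, makes the
  constant 0 and lowers the order.\<close>

lemma lift_difference_eq_0_imp_span:
  assumes \<alpha>: "\<alpha> > -1" "\<alpha> \<noteq> 0"
    and "alpha_system \<alpha> u p k k'" "\<And>m. lift_difference \<alpha> M u m = 0"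
  shows "\<exists>a. \<forall>z\<in>uhp. u z = (\<Sum>j<M. a j * hsol \<alpha> j z)"
  using assms(3,4)
proof (induction M arbitrary: u p k k')
  case 0
  then show ?case using lift_difference_0_eq_0[OF _ \<alpha>(1)] by (metis lessThan_0 sum.empty)
next
  case (Suc M)
  define L where "L = lift_difference \<alpha> M (hsol \<alpha> M) 0"
  have L: "L \<noteq> 0" unfolding L_def
    by (rule lift_difference_hsol_leading[OF \<alpha>]) (rule Suc.IH)
  define c where "c = lift_difference \<alpha> M u 0 / L"
  obtain p1 k1 k1' where h: "alpha_system \<alpha> (hsol \<alpha> M) p1 k1 k1'" using alpha_system_hsol by blast
  obtain p2 k2 k2' where v: "alpha_system \<alpha> (\<lambda>z. u z - c * hsol \<alpha> M z) p2 k2 k2'"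
    using alpha_system_diff[OF Suc.prems(1) h] by blast
  define v where "v = (\<lambda>z. u z - c * hsol \<alpha> M z)"
  have lin: "lift_difference \<alpha> N v m = lift_difference \<alpha> N u m - c * lift_difference \<alpha> N (hsol \<alpha> M) m" for N m
    unfolding v_def
    by (intro lift_difference_diff alpha_system_continuous_on[OF Suc.prems(1)] alpha_system_continuous_on[OF h])
  have step: "lift_difference \<alpha> M v m = lift_difference \<alpha> M v (m - 1)" for m
    using lin[of "Suc M" m] Suc.prems(2)[of m] lift_difference_hsol[OF \<alpha>(1), of M m]
    by (simp add: lift_difference_Suc)
  have v0: "lift_difference \<alpha> M v 0 = 0"
    unfolding lin using L by (simp add: c_def flip: L_def)
  have "lift_difference \<alpha> M v m = 0" for m
  proof (induction m rule: int_induct[where k = 0])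
    case (step1 i)
    then show ?case using step[of "i + 1"] by simp
  next
    case (step2 i)
    then show ?case using step[of i] by simp
  qed (rule v0)
  with Suc.IH[of v] v obtain a where a: "\<forall>z\<in>uhp. v z = (\<Sum>j<M. a j * hsol \<alpha> j z)"
    unfolding v_def by blast
  have "u z = (\<Sum>j<Suc M. (a(M := c)) j * hsol \<alpha> j z)" if "z \<in> uhp" for z
  proof -
    have "(\<Sum>j<M. (a(M := c)) j * hsol \<alpha> j z) = (\<Sum>j<M. a j * hsol \<alpha> j z)"
      by (rule sum.cong) auto
    then show ?thesis using a that by (simp add: v_def diff_eq_eq)
  qed
  then show ?case by blast
qed

theorem theorem6p5:
  fixes \<alpha> :: real and u :: "complex \<Rightarrow> complex" and z :: "nat \<Rightarrow> complex"
  assumes "\<alpha> > -1" and "\<alpha> \<noteq> 0"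
    and "alpha_harmonic \<alpha> u"
    and "temperate_growth_at_infinity u"
    and "vanishes_in_distributions_at_boundary u"
    and "\<And>j. z j \<in> upper_half_plane"
    and "filterlim z at_infinity sequentially"
    and "(\<lambda>j. u (z j) / of_real (Im (z j) powr (\<alpha> + 1))) \<longlonglongrightarrow> 0"
  shows "\<forall>w\<in>upper_half_plane. u w = 0"
proof -
  note \<alpha> = assms(1,2) and zu = assms(6)
  obtain p k k' where a: "alpha_system \<alpha> u p k k'"
    using alpha_harmonic_imp_alpha_system[OF assms(3)] by blast
  obtain n where n: "\<And>\<phi>. unit_bump \<phi> \<Longrightarrow> \<exists>C. \<forall>z\<in>uhp. cmod (mollify u \<phi> z) \<le> C * (1 + cmod z) ^ n"
    using mollify_polynomial_growth[OF a \<alpha>(1) assms(4,5)] by blast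
  have "lift_difference \<alpha> (Suc n) (mollify u \<phi>) m = 0" if \<phi>: "unit_bump \<phi>" for \<phi> m
  proof -
    obtain C where C: "\<forall>z\<in>uhp. cmod (mollify u \<phi> z) \<le> C * (1 + cmod z) ^ n" using n[OF \<phi>] by blast
    show ?thesis
    proof (rule lift_difference_eq_0[OF alpha_system_mollify[OF a unit_bump_continuous_on[OF \<phi>]] \<alpha>(1)])
      show "(0::real) = 0 \<or> 0 = \<alpha> + 1" by simp
      show "cmod (mollify u \<phi> w) \<le> C * Im w powr 0 * (1 + cmod w) ^ n" if "w \<in> uhp" for w
        using C that by simp
      show "(mollify u \<phi> \<longlongrightarrow> 0) (at (of_real x) within uhp)" for x
        by (rule mollify_tendsto_0_boundary[OF a assms(5) \<phi>])
    qed
  qed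
  then have "lift_difference \<alpha> (Suc n) u m = 0" for m
    by (rule lift_difference_mollify[OF alpha_system_continuous_on[OF a]])
  from lift_difference_eq_0_imp_span[OF \<alpha> a this]
  obtain c where c: "\<forall>w\<in>uhp. u w = (\<Sum>j<Suc n. c j * hsol \<alpha> j w)" ..
  have c0: "c j = 0" if "j < Suc n" for j
  proof (rule ccontr)
    assume "c j \<noteq> 0"
    \<comment> \<open>With the top nonzero coefficient at N, the quotient u / y^(\<alpha>+1) is a
      combination of polynomials that stays above some \<delta> > 0 in modulus for all large |z|;
      this contradicts its limit 0 along \<open>z j\<close>.\<close>
    define N where "N = Max {i. i < Suc n \<and> c i \<noteq> 0}"
    have "N \<in> {i. i < Suc n \<and> c i \<noteq> 0}"
      unfolding N_def by (rule Max_in) (use \<open>c j \<noteq> 0\<close> that in auto)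
    then have N: "N < Suc n" "c N \<noteq> 0" by auto
    have above: "c i = 0" if "N < i" "i < Suc n" for i
    proof (rule ccontr)
      assume "c i \<noteq> 0"
      then have "i \<le> N" unfolding N_def by (intro Max_ge) (use that in auto)
      with that show False by simp
    qed
    have u: "u w = of_real (Im w powr (\<alpha> + 1)) * (\<Sum>j\<le>N. c j * hpoly \<alpha> j w)" if "w \<in> uhp" for w
    proof -
      have "u w = (\<Sum>j<Suc n. c j * hsol \<alpha> j w)" using c that by blast
      also have "\<dots> = (\<Sum>j\<le>N. c j * hsol \<alpha> j w)"
        by (rule sum.mono_neutral_right) (use N above in auto)
      finally show ?thesis by (simp add: hsol_def sum_distrib_left mult_ac)
    qed
    obtain \<delta> R where \<delta>: "\<delta> > 0" "\<And>z. cmod z \<ge> R \<Longrightarrow> cmod (\<Sum>j\<le>N. c j * hpoly \<alpha> j z) \<ge> \<delta>"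
      using hpoly_combination_large[where a = c and n = N, OF \<alpha> N(2)] by metis
    have "\<forall>\<^sub>F j in sequentially. cmod (z j) \<ge> R"
      using assms(7) by (simp add: filterlim_at_infinity_conv_norm_at_top filterlim_at_top)
    moreover have "\<forall>\<^sub>F j in sequentially. cmod (u (z j) / of_real (Im (z j) powr (\<alpha> + 1))) < \<delta>"
      using tendstoD[OF assms(8) \<delta>(1)] by simp
    ultimately have "\<forall>\<^sub>F j in sequentially. False"
    proof eventually_elim
      case (elim j)
      have "Im (z j) powr (\<alpha> + 1) \<noteq> 0" using zu[of j] by simp
      then have "u (z j) / of_real (Im (z j) powr (\<alpha> + 1)) = (\<Sum>i\<le>N. c i * hpoly \<alpha> i (z j))"
        using u[OF zu[of j]] by simp
      then show False using elim \<delta>(2)[of "z j"] by simp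
    qed
    then show False by simp
  qed
  show ?thesis
  proof
    fix w assume "w \<in> uhp"
    then have "u w = (\<Sum>j<Suc n. c j * hsol \<alpha> j w)" using c by blast
    also have "\<dots> = 0" by (rule sum.neutral) (use c0 in auto)
    finally show "u w = 0" .
  qed
qed

end
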